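(* Let $X_0(t)$ be a Lévy process in $\mathbb{R}^d$ starting at zero, let $X(t)=x+X_0(t)$, and let $L_x$ be the generator of the semigroup $T(t)f(x)=\mathbb{E}_x[f(X(t))]$, with domain $D(L_x)$. Let $k\ge 1$ be an integer and $m=2^k$. Let $I_k$ and $J_k$ be the two versions of (real-valued) $k$-iterated Brownian motion defined in the context. Then for any $f\in D(L_x)$: (i) If $I_k$ is independent of $X$, the function $u(t,x)=\mathbb{E}_x\big(f(X(|I_k(t)|))\big)$ is the unique solution both of the Cauchy problem $$\frac{\partial u(t,x)}{\partial t}=\sum_{j=1}^{m-1}\frac{t^{j/m-1}}{\Gamma(j/m)}L_x^j f(x)+L_x^m u(t,x),\qquad u(0,x)=f(x),$$ and of the fractional Cauchy problem $$\frac{\partial^{1/m}}{\partial t^{1/m}}u(t,x)=L_x u(t,x),\qquad u(0,x)=f(x),$$ for $t>0$, $x\in\mathbb{R}^d$. (ii) If $Z(t)$, $t\in\mathbb{R}$, is a two-sided Lévy process formed from independent copies of $X$ for positive and for negative times, independent of $J_k$, then $u(t,x)=\mathbb{E}_x\big(f(Z(J_k(t)))\big)$ is also the unique solution of both of these Cauchy problems (with $m=2^k$).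
   Context: Brownian motions are normalized to have variance $2t$ at time $t$ (generator $\Delta$). First version of $k$-iterated Brownian motion: $I_k(t)=B_1(|B_2(|B_3(|\cdots(|B_k(t)|)\cdots|)|)|)$, $t\ge0$, where $B_1,\dots,B_k$ are independent real-valued Brownian motions started at $0$ (so $I_1=B_1$). Two-sided Brownian motion: $X(t)=X^+(t)$ for $t\ge 0$ and $X(t)=X^-(-t)$ for $t<0$, where $X^+,X^-$ are independent one-dimensional Brownian motions started at $0$. Second version of $k$-iterated Brownian motion: $J_k(t)=X_1(X_2(X_3(\cdots(X_k(t))\cdots)))$, $t\ge 0$, where $X_1,\dots,X_k$ are independent real-valued two-sided Brownian motions started at $0$. Two-sided Lévy process: $Z(t)=X^+(t)$ for $t\ge0$, $Z(t)=X^-(-t)$ for $t<0$, where $X^+,X^-$ are independent copies of the Lévy process $X$ started at $x$. Generator: if $\mathbb{E}[\exp(ik\cdot X_0(t))]=\exp(t\psi(k))$ for $k\in\mathbb{R}^d$, and $\hat f(k)=\int_{\mathbb{R}^d}e^{-ik\cdot x}f(x)\,dx$, then $D(L_x)=\{f\in L^1(\mathbb{R}^d):\ \psi(k)\hat f(k)=\hat h(k)\text{ for some }h\in L^1(\mathbb{R}^d)\}$, and $L_xf$ is the inverse Fourier transform of $\psi(k)\hat f(k)$. For $0<\beta<1$, the Caputo fractional derivative $\partial^\beta g(t)/\partial t^\beta$ is the function whose Laplace transform is $s^\beta\tilde g(s)-s^{\beta-1}g(0)$, where $\tilde g(s)=\int_0^\infty e^{-st}g(t)\,dt$. *)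

theory Defs
  imports "HOL-Probability.Probability"
begin

section \<open>Stochastic processes\<close>

definition process_sigma :: "'w measure \<Rightarrow> real set \<Rightarrow> (real \<Rightarrow> 'w \<Rightarrow> 'b::topological_space) \<Rightarrow> 'w set set" where
  "process_sigma M T X =
     sigma_sets (space M) {X t -` A \<inter> space M | t A. t \<in> T \<and> A \<in> sets borel}"

definition path_law :: "'w measure \<Rightarrow> (real \<Rightarrow> 'w \<Rightarrow> 'b::topological_space) \<Rightarrow> (real \<Rightarrow> 'b) measure" where
  "path_law M X = distr M (\<Pi>\<^sub>M t\<in>{0..}. borel) (\<lambda>\<omega>. \<lambda>t\<in>{0..}. X t \<omega>)"

definition indep_increments :: "'w measure \<Rightarrow> (real \<Rightarrow> 'w \<Rightarrow> 'a::euclidean_space) \<Rightarrow> bool" where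
  "indep_increments M X \<longleftrightarrow>
     (\<forall>n. \<forall>t :: nat \<Rightarrow> real. 0 \<le> t 0 \<and> (\<forall>i<n. t i \<le> t (Suc i)) \<longrightarrow>
        prob_space.indep_vars M (\<lambda>_. borel) (\<lambda>i \<omega>. X (t (Suc i)) \<omega> - X (t i) \<omega>) {..<n})"

text \<open>Only times \<open>t \<ge> 0\<close> matter. The path properties are required of every path (not just almost
  every one), so that composing a process with an independent random time gives a random variable
  even when \<open>M\<close> is not complete.\<close>

definition levy_process :: "'w measure \<Rightarrow> (real \<Rightarrow> 'w \<Rightarrow> 'a::euclidean_space) \<Rightarrow> bool" where
  "levy_process M X \<longleftrightarrow>
     prob_space M \<and>
     (\<forall>t\<ge>0. X t \<in> borel_measurable M) \<and>
     (\<forall>\<omega>\<in>space M. X 0 \<omega> = 0) \<and>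
     indep_increments M X \<and>
     (\<forall>s\<ge>0. \<forall>t\<ge>0. distr M borel (\<lambda>\<omega>. X (s + t) \<omega> - X s \<omega>) = distr M borel (X t)) \<and>
     (\<forall>\<omega>\<in>space M. \<forall>t\<ge>0. ((\<lambda>s. X s \<omega>) \<longlongrightarrow> X t \<omega>) (at_right t)) \<and>
     (\<forall>\<omega>\<in>space M. \<forall>t>0. \<exists>l. ((\<lambda>s. X s \<omega>) \<longlongrightarrow> l) (at_left t))"

definition brownian_motion :: "'w measure \<Rightarrow> (real \<Rightarrow> 'w \<Rightarrow> real) \<Rightarrow> bool" where
  "brownian_motion M B \<longleftrightarrow>
     prob_space M \<and>
     (\<forall>t\<ge>0. B t \<in> borel_measurable M) \<and>
     (\<forall>\<omega>\<in>space M. B 0 \<omega> = 0) \<and>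
     indep_increments M B \<and>
     (\<forall>s\<ge>0. \<forall>t>s. distributed M lborel (\<lambda>\<omega>. B t \<omega> - B s \<omega>)
        (normal_density 0 (sqrt (2 * (t - s))))) \<and>
     (\<forall>\<omega>\<in>space M. continuous_on {0..} (\<lambda>t. B t \<omega>))"

definition two_sided :: "(real \<Rightarrow> 'w \<Rightarrow> 'b) \<Rightarrow> (real \<Rightarrow> 'w \<Rightarrow> 'b) \<Rightarrow> real \<Rightarrow> 'w \<Rightarrow> 'b" where
  "two_sided Xp Xm t = (if 0 \<le> t then Xp t else Xm (- t))"

definition two_sided_brownian_motion :: "'w measure \<Rightarrow> (real \<Rightarrow> 'w \<Rightarrow> real) \<Rightarrow> bool" where
  "two_sided_brownian_motion M X \<longleftrightarrow>
     (\<exists>Xp Xm. brownian_motion M Xp \<and> brownian_motion M Xm \<and>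
        prob_space.indep_set M (process_sigma M {0..} Xp) (process_sigma M {0..} Xm) \<and>
        X = two_sided Xp Xm)"

text \<open>Paths of the two versions of \<open>k\<close>-iterated Brownian motion, indexed from \<open>1\<close>;
  the value at \<open>k = 0\<close> is a dummy for the first version.\<close>

fun iterated_abs :: "(nat \<Rightarrow> real \<Rightarrow> 'w \<Rightarrow> real) \<Rightarrow> nat \<Rightarrow> real \<Rightarrow> 'w \<Rightarrow> real" where
  "iterated_abs B 0 t \<omega> = t"
| "iterated_abs B (Suc 0) t \<omega> = B 1 t \<omega>"
| "iterated_abs B (Suc (Suc k)) t \<omega> = iterated_abs B (Suc k) \<bar>B (Suc (Suc k)) t \<omega>\<bar> \<omega>"

fun iterated :: "(nat \<Rightarrow> real \<Rightarrow> 'w \<Rightarrow> real) \<Rightarrow> nat \<Rightarrow> real \<Rightarrow> 'w \<Rightarrow> real" where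
  "iterated X 0 t \<omega> = t"
| "iterated X (Suc k) t \<omega> = iterated X k (X (Suc k) t \<omega>) \<omega>"


section \<open>Fourier transform and generator\<close>

definition fourier :: "('a::euclidean_space \<Rightarrow> complex) \<Rightarrow> 'a \<Rightarrow> complex" where
  "fourier f \<xi> = (LINT x|lborel. exp (- \<i> * complex_of_real (\<xi> \<bullet> x)) * f x)"

definition levy_symbol :: "'w measure \<Rightarrow> (real \<Rightarrow> 'w \<Rightarrow> 'a::euclidean_space) \<Rightarrow> ('a \<Rightarrow> complex) \<Rightarrow> bool" where
  "levy_symbol M X \<psi> \<longleftrightarrow>
     (\<forall>t\<ge>0. \<forall>\<xi>. (LINT \<omega>|M. exp (\<i> * complex_of_real (\<xi> \<bullet> X t \<omega>))) = exp (complex_of_real t * \<psi> \<xi>))"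

text \<open>The generator as a relation: \<open>h\<close> is (a version of) \<open>L f\<close>. Its powers in \<open>L\<^sup>1\<close>, with their
  natural domains, are the relation powers \<open>gen \<psi> ^^ j\<close>.\<close>

definition gen :: "('a::euclidean_space \<Rightarrow> complex) \<Rightarrow> ('a \<Rightarrow> complex) \<Rightarrow> ('a \<Rightarrow> complex) \<Rightarrow> bool" where
  "gen \<psi> f h \<longleftrightarrow> integrable lborel f \<and> integrable lborel h \<and> (\<forall>\<xi>. \<psi> \<xi> * fourier f \<xi> = fourier h \<xi>)"

definition gen_dom :: "('a::euclidean_space \<Rightarrow> complex) \<Rightarrow> nat \<Rightarrow> ('a \<Rightarrow> complex) set" where
  "gen_dom \<psi> j = {f. integrable lborel f \<and> (\<exists>h. (gen \<psi> ^^ j) f h)}"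

coinductive schwartz :: "('a::euclidean_space \<Rightarrow> complex) \<Rightarrow> bool" where
  "\<lbrakk>\<forall>x. \<phi> differentiable (at x);
    \<forall>N::nat. bounded (range (\<lambda>x. (1 + norm x) ^ N *\<^sub>R \<phi> x));
    \<forall>b\<in>Basis. schwartz (\<lambda>x. frechet_derivative \<phi> (at x) b)\<rbrakk>
   \<Longrightarrow> schwartz \<phi>"

text \<open>For \<open>f\<close> in the domain of \<open>L\<close> only, \<open>L\<^sup>j f\<close> with \<open>j \<ge> 2\<close> (the inverse Fourier transform of
  \<open>\<psi>\<^sup>j\<close> times the transform of \<open>f\<close>) is in general not a function but a tempered distribution.
  The inverse Fourier transform of a continuous function \<open>G\<close> of polynomial growth is the
  tempered distribution \<open>T\<close> with \<open>T (fourier \<eta>) = \<integral> G \<eta>\<close> for all Schwartz functions \<open>\<eta>\<close>;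
  this determines \<open>T\<close>, because \<open>fourier\<close> is a bijection of the Schwartz space. All
  distributions are thus written as functionals of \<open>\<eta>\<close>, standing for their value at the test
  function \<open>fourier \<eta>\<close>.\<close>

definition distr_of_fun :: "('a::euclidean_space \<Rightarrow> complex) \<Rightarrow> ('a \<Rightarrow> complex) \<Rightarrow> complex" where
  "distr_of_fun h \<eta> = (LINT x|lborel. h x * fourier \<eta> x)"

definition inv_fourier_distr :: "('a::euclidean_space \<Rightarrow> complex) \<Rightarrow> ('a \<Rightarrow> complex) \<Rightarrow> complex" where
  "inv_fourier_distr G \<eta> = (LINT \<xi>|lborel. G \<xi> * \<eta> \<xi>)"

definition gen_pow_distr ::
    "('a::euclidean_space \<Rightarrow> complex) \<Rightarrow> nat \<Rightarrow> ('a \<Rightarrow> complex) \<Rightarrow> ('a \<Rightarrow> complex) \<Rightarrow> complex" where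
  "gen_pow_distr \<psi> j g = inv_fourier_distr (\<lambda>\<xi>. \<psi> \<xi> ^ j * fourier g \<xi>)"


section \<open>Cauchy problems for functions of time with values in \<open>L\<^sup>1\<close>\<close>

definition L1_dist :: "('a::euclidean_space \<Rightarrow> complex) \<Rightarrow> ('a \<Rightarrow> complex) \<Rightarrow> real" where
  "L1_dist g h = (LINT x|lborel. norm (g x - h x))"

definition L1_continuous :: "(real \<Rightarrow> 'a::euclidean_space \<Rightarrow> complex) \<Rightarrow> bool" where
  "L1_continuous v \<longleftrightarrow>
     (\<forall>t\<ge>0. integrable lborel (v t)) \<and>
     (\<forall>t\<ge>0. ((\<lambda>s. L1_dist (v s) (v t)) \<longlongrightarrow> 0) (at t within {0..}))"

definition has_L1_derivative ::
    "(real \<Rightarrow> 'a::euclidean_space \<Rightarrow> complex) \<Rightarrow> ('a \<Rightarrow> complex) \<Rightarrow> real \<Rightarrow> bool" where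
  "has_L1_derivative v h t \<longleftrightarrow>
     integrable lborel h \<and>
     ((\<lambda>s. L1_dist (\<lambda>x. (v s x - v t x) / complex_of_real (s - t)) h) \<longlongrightarrow> 0) (at t)"

definition laplace :: "(real \<Rightarrow> complex) \<Rightarrow> real \<Rightarrow> complex" where
  "laplace g s = (LINT t:{0..}|lborel. exp (- s * t) *\<^sub>R g t)"

definition laplace_integrable :: "(real \<Rightarrow> 'a::euclidean_space \<Rightarrow> complex) \<Rightarrow> real \<Rightarrow> bool" where
  "laplace_integrable g s \<longleftrightarrow>
     set_integrable (lborel \<Otimes>\<^sub>M lborel) ({0..} \<times> UNIV) (\<lambda>(t, x). exp (- s * t) *\<^sub>R g t x)"

definition has_caputo_derivative ::
    "real \<Rightarrow> (real \<Rightarrow> 'a::euclidean_space \<Rightarrow> complex) \<Rightarrow> (real \<Rightarrow> 'a \<Rightarrow> complex) \<Rightarrow> bool" where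
  "has_caputo_derivative \<beta> g h \<longleftrightarrow>
     (\<exists>s0\<ge>0. \<forall>s>s0. laplace_integrable g s \<and> laplace_integrable h s \<and>
        (AE x in lborel. laplace (\<lambda>t. h t x) s =
           complex_of_real (s powr \<beta>) * laplace (\<lambda>t. g t x) s
           - complex_of_real (s powr (\<beta> - 1)) * g 0 x))"

definition cauchy_coeff :: "nat \<Rightarrow> nat \<Rightarrow> real \<Rightarrow> complex" where
  "cauchy_coeff m j t = complex_of_real (t powr (real j / real m - 1) / Gamma (real j / real m))"

text \<open>The Cauchy problem of order \<open>m\<close>, for arbitrary \<open>f\<close> in \<open>L\<^sup>1\<close>: the time derivative is taken in
  \<open>L\<^sup>1\<close>, the right hand side is read in the space of tempered distributions.\<close>

definition solves_cauchy ::
    "('a::euclidean_space \<Rightarrow> complex) \<Rightarrow> nat \<Rightarrow> ('a \<Rightarrow> complex) \<Rightarrow> (real \<Rightarrow> 'a \<Rightarrow> complex) \<Rightarrow> bool" where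
  "solves_cauchy \<psi> m f v \<longleftrightarrow>
     L1_continuous v \<and> (AE x in lborel. v 0 x = f x) \<and>
     (\<forall>t>0. \<exists>h. has_L1_derivative v h t \<and>
        (\<forall>\<eta>. schwartz \<eta> \<longrightarrow>
           distr_of_fun h \<eta> =
             (\<Sum>j=1..m-1. cauchy_coeff m j t * gen_pow_distr \<psi> j f \<eta>)
             + gen_pow_distr \<psi> m (v t) \<eta>))"

text \<open>The same problem with every term in \<open>L\<^sup>1\<close>; this only makes sense when \<open>f\<close> is in the domain
  of the power \<open>m - 1\<close> of the generator.\<close>

definition solves_cauchy_strongly ::
    "('a::euclidean_space \<Rightarrow> complex) \<Rightarrow> nat \<Rightarrow> ('a \<Rightarrow> complex) \<Rightarrow> (real \<Rightarrow> 'a \<Rightarrow> complex) \<Rightarrow> bool" where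
  "solves_cauchy_strongly \<psi> m f v \<longleftrightarrow>
     L1_continuous v \<and> (AE x in lborel. v 0 x = f x) \<and>
     (\<forall>t>0. \<exists>h Lf Lv. has_L1_derivative v h t \<and>
        (\<forall>j\<in>{1..m-1}. (gen \<psi> ^^ j) f (Lf j)) \<and> (gen \<psi> ^^ m) (v t) Lv \<and>
        (AE x in lborel. h x = (\<Sum>j=1..m-1. cauchy_coeff m j t * Lf j x) + Lv x))"

definition solves_fractional_cauchy ::
    "('a::euclidean_space \<Rightarrow> complex) \<Rightarrow> real \<Rightarrow> ('a \<Rightarrow> complex) \<Rightarrow> (real \<Rightarrow> 'a \<Rightarrow> complex) \<Rightarrow> bool" where
  "solves_fractional_cauchy \<psi> \<beta> f v \<longleftrightarrow>
     L1_continuous v \<and> (AE x in lborel. v 0 x = f x) \<and>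
     (\<exists>h. has_caputo_derivative \<beta> v h \<and> (\<forall>t>0. gen \<psi> (v t) (h t)))"

definition unique_solution ::
    "((real \<Rightarrow> 'a::euclidean_space \<Rightarrow> complex) \<Rightarrow> bool) \<Rightarrow> (real \<Rightarrow> 'a \<Rightarrow> complex) \<Rightarrow> bool" where
  "unique_solution P u \<longleftrightarrow>
     P u \<and> (\<forall>v. P v \<longrightarrow> (\<forall>t\<ge>0. AE x in lborel. v t x = u t x))"

definition unique_solution_of_both ::
    "('a::euclidean_space \<Rightarrow> complex) \<Rightarrow> nat \<Rightarrow> ('a \<Rightarrow> complex) \<Rightarrow> (real \<Rightarrow> 'a \<Rightarrow> complex) \<Rightarrow> bool" where
  "unique_solution_of_both \<psi> m f u \<longleftrightarrow>
     unique_solution (solves_cauchy \<psi> m f) u \<and>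
     (f \<in> gen_dom \<psi> (m - 1) \<longrightarrow> unique_solution (solves_cauchy_strongly \<psi> m f) u) \<and>
     unique_solution (solves_fractional_cauchy \<psi> (1 / real m) f) u"

end

theory Submission
  imports Defs "HOL-Real_Asymp.Real_Asymp"
begin

text \<open>Both sides are compared through the Fourier transform in \<open>x\<close>. Conditioning on the iterated Brownian
  motion, the transform of \<open>u(t)\<close> is the transform of \<open>f\<close> times \<open>\<phi>\<^sub>k(t, \<psi>)\<close>, where \<open>\<phi>\<^sub>k(t, z)\<close> is the mean
  of \<open>exp (z * \<bar>I\<^sub>k(t)\<bar>)\<close>. Each Brownian layer replaces \<open>s\<close> by \<open>sqrt s\<close> in the Laplace transform
  in \<open>t\<close>, so that the transform of \<open>\<phi>\<^sub>k\<close> is \<open>s powr (b - 1) / (s powr b - z)\<close> with \<open>b = 1 / 2 ^ k\<close>. This is the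
  fractional equation; expanding the quotient as a finite geometric sum with remainder gives the equation of order \<open>m\<close>.
  Uniqueness follows from injectivity of the Fourier transform on L1, uniqueness of Laplace transforms, and uniqueness for
  scalar linear differential equations. Smoothness in \<open>t > 0\<close> comes from the heat kernel of the outermost
  time change, and continuity at \<open>0\<close> from \<open>f\<close> lying in the domain of the generator.\<close>

section \<open>The Fourier transform on L1\<close>

text \<open>The obstacle is that the two sides of the equation of order m live in different spaces.
  The time derivative is an L1 limit, while \<open>\<psi> \<xi> ^ j\<close> times the transform of
  \<open>f\<close> is for \<open>j \<ge> 2\<close> in general not the transform of an integrable
  function. Differentiating for each fixed \<xi> therefore yields the equation, but not the
  existence of the L1 derivative. For \<open>t > 0\<close> that existence comes from writing the
  solution as an average, over the value of the Brownian layer run up to time t, of the evolution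
  with one layer fewer: in this average only the Gaussian weight depends on t. At time 0 the weight
  degenerates. There the Levy semigroup satisfies T(t) f - f = integral of T(r) L f over [0, t],
  which gives the rate t, and each layer halves the exponent. Only the modulus of the iterated
  motion enters the transform, so both versions reduce to one predicate, \<open>evolves\<close>,
  phrased through the symbol alone. The same predicate, started from L f instead of f, supplies the
  Caputo derivative.\<close>

text \<open>Tonelli in the form used throughout: the inner L1 norm is controlled by the mass of a
  kernel or by the norm of a translate, so an integrable majorant \<open>g\<close> of that norm
  replaces a majorant on the product.\<close>

lemma integrable_pair_bound:
  fixes F :: "_ \<Rightarrow> _::{banach, second_countable_topology}"
  assumes "sigma_finite_measure P" "sigma_finite_measure Q"
    and F[measurable]: "F \<in> borel_measurable (P \<Otimes>\<^sub>M Q)"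
    and g: "integrable P g"
    and int: "\<And>p. p \<in> space P \<Longrightarrow> integrable Q (\<lambda>x. F (p, x))"
    and bound: "\<And>p. p \<in> space P \<Longrightarrow> (LINT x|Q. norm (F (p, x))) \<le> g p"
  shows "integrable (P \<Otimes>\<^sub>M Q) F"
proof -
  interpret P: sigma_finite_measure P by fact
  interpret Q: sigma_finite_measure Q by fact
  interpret pair_sigma_finite P Q ..
  show ?thesis
  proof (rule Fubini_integrable)
    show "integrable P (\<lambda>x. LINT y|Q. norm (F (x, y)))"
    proof (rule Bochner_Integration.integrable_bound[OF g])
      show "AE x in P. norm (LINT y|Q. norm (F (x, y))) \<le> norm (g x)"
        using bound by (intro AE_I2) (smt (verit) integral_nonneg_AE AE_I2 norm_ge_zero real_norm_def)
    qed measurable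
  qed (use int in auto)
qed

lemma lborel_integral_affine:
  fixes h :: "'a::euclidean_space \<Rightarrow> 'b::{banach, second_countable_topology}"
  assumes [measurable]: "h \<in> borel_measurable borel" and c: "c \<noteq> 0"
  shows "(LINT x|lborel. h x) = \<bar>c\<bar> ^ DIM('a) *\<^sub>R (LINT x|lborel. h (t + c *\<^sub>R x))"
  by (subst lborel_affine[OF c, of t]) (simp add: integral_density integral_distr)

lemma integrable_lborel_translation:
  fixes h :: "'a::euclidean_space \<Rightarrow> 'b::{banach, second_countable_topology}"
  assumes "integrable lborel h"
  shows "integrable lborel (\<lambda>x. h (x + y))"
proof -
  have "integrable (distr lborel borel ((+) y)) h"
    using assms by (simp add: lborel_distr_plus)
  then have "integrable lborel (\<lambda>x. h (y + x))"
    by (subst (asm) integrable_distr_eq) (use assms in auto)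
  then show ?thesis by (simp add: add.commute)
qed

lemma lborel_integral_translation:
  fixes h :: "'a::euclidean_space \<Rightarrow> 'b::{banach, second_countable_topology}"
  assumes "h \<in> borel_measurable borel"
  shows "(LINT x|lborel. h (x + y)) = (LINT x|lborel. h x)"
  using lborel_integral_affine[OF assms, of 1 y] by (simp add: add.commute)

section \<open>Elementary properties of the Fourier transform of integrable functions\<close>

lemma norm_fourier_kernel [simp]: "norm (exp (- \<i> * complex_of_real r)) = 1"
  "norm (exp (- (\<i> * complex_of_real r))) = 1"
  "norm (exp (\<i> * complex_of_real r)) = 1"
  using norm_exp_i_times[of "-r"] norm_exp_i_times[of r] by simp_all

lemma integrable_fourier_kernel:
  assumes "integrable lborel (f :: 'a::euclidean_space \<Rightarrow> complex)"
  shows "integrable lborel (\<lambda>x. exp (- \<i> * complex_of_real (\<xi> \<bullet> x)) * f x)"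
  by (rule Bochner_Integration.integrable_bound[OF assms]) (use assms in \<open>auto simp: norm_mult\<close>)

lemma fourier_diff:
  assumes "integrable lborel f" "integrable lborel g"
  shows "fourier (\<lambda>x. f x - g x) \<xi> = fourier f \<xi> - fourier g \<xi>"
  unfolding fourier_def using assms[THEN integrable_fourier_kernel, of \<xi>]
  by (simp add: algebra_simps)

lemma fourier_add:
  assumes "integrable lborel f" "integrable lborel g"
  shows "fourier (\<lambda>x. f x + g x) \<xi> = fourier f \<xi> + fourier g \<xi>"
  unfolding fourier_def using assms[THEN integrable_fourier_kernel, of \<xi>]
  by (simp add: algebra_simps)

lemma fourier_cmult: "fourier (\<lambda>x. c * f x) \<xi> = c * fourier f \<xi>"
  unfolding fourier_def by (subst integral_mult_right_zero[symmetric]) (simp add: algebra_simps)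

lemma fourier_divide: "fourier (\<lambda>x. f x / c) \<xi> = fourier f \<xi> / c"
  using fourier_cmult[of "inverse c" f \<xi>] by (simp add: divide_inverse mult.commute)

lemma fourier_sum:
  assumes "\<And>i. i \<in> I \<Longrightarrow> integrable lborel (f i)"
  shows "fourier (\<lambda>x. \<Sum>i\<in>I. f i x) \<xi> = (\<Sum>i\<in>I. fourier (f i) \<xi>)"
  unfolding fourier_def sum_distrib_left
  using assms[THEN integrable_fourier_kernel, of _ \<xi>] by (subst Bochner_Integration.integral_sum) auto

lemma fourier_cong_AE:
  assumes "AE x in lborel. f x = g x" "f \<in> borel_measurable borel" "g \<in> borel_measurable borel"
  shows "fourier f \<xi> = fourier g \<xi>"
  unfolding fourier_def using assms by (intro integral_cong_AE) auto

lemma norm_fourier_le: "norm (fourier f \<xi>) \<le> (LINT x|lborel. norm (f x))"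
  unfolding fourier_def by (rule order.trans[OF integral_norm_bound]) (simp add: norm_mult)

lemma continuous_on_fourier:
  assumes f: "integrable lborel f"
  shows "continuous_on UNIV (fourier f)"
  unfolding fourier_def
proof (rule continuous_at_imp_continuous_on, intro ballI)
  fix \<xi> :: 'a
  show "isCont (\<lambda>\<xi>. LINT x|lborel. exp (- \<i> * complex_of_real (\<xi> \<bullet> x)) * f x) \<xi>"
    unfolding continuous_within tendsto_at_iff_sequentially comp_def
  proof (intro allI impI)
    fix X :: "nat \<Rightarrow> 'a" assume "\<forall>i. X i \<in> UNIV - {\<xi>}" and X: "X \<longlonglongrightarrow> \<xi>"
    show "(\<lambda>i. LINT x|lborel. exp (- \<i> * complex_of_real (X i \<bullet> x)) * f x)
        \<longlonglongrightarrow> (LINT x|lborel. exp (- \<i> * complex_of_real (\<xi> \<bullet> x)) * f x)"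
      by (rule integral_dominated_convergence[where w="\<lambda>x. norm (f x)"])
         (use f in \<open>auto simp: norm_mult intro!: tendsto_intros X AE_I2\<close>)
  qed
qed

text \<open>The shift \<open>x + y\<close> multiplies the transform by the conjugate of the Fourier
  kernel, so averaging over a random shift produces the characteristic function with the sign used
  in \<open>levy_symbol\<close>.\<close>

lemma fourier_translation:
  assumes "f \<in> borel_measurable borel"
  shows "fourier (\<lambda>x. f (x + y)) \<xi> = exp (\<i> * complex_of_real (\<xi> \<bullet> y)) * fourier f \<xi>"
proof -
  have "fourier (\<lambda>x. f (x + y)) \<xi> = (LINT x|lborel.
      (\<lambda>z. exp (\<i> * complex_of_real (\<xi> \<bullet> y)) * (exp (- \<i> * complex_of_real (\<xi> \<bullet> z)) * f z)) (x + y))"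
    unfolding fourier_def
    by (intro Bochner_Integration.integral_cong)
       (auto simp: inner_add_right exp_add[symmetric] algebra_simps)
  also have "\<dots> = (LINT z|lborel. exp (\<i> * complex_of_real (\<xi> \<bullet> y)) * (exp (- \<i> * complex_of_real (\<xi> \<bullet> z)) * f z))"
    by (rule lborel_integral_translation) (use assms in measurable)
  finally show ?thesis unfolding fourier_def by simp
qed

text \<open>Fubini for a family of L1 functions. Averages over sample points, kernel variables and
  times all pass through the Fourier transform in this way; the third claim is Minkowski's
  inequality for integrals.\<close>

lemma
  fixes F :: "_ \<Rightarrow> 'a::euclidean_space \<Rightarrow> complex"
  assumes P: "sigma_finite_measure P"
    and F: "integrable (P \<Otimes>\<^sub>M lborel) (case_prod F)"
  shows integrable_mixture: "integrable lborel (\<lambda>x. LINT p|P. F p x)"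
    and fourier_mixture: "fourier (\<lambda>x. LINT p|P. F p x) \<xi> = (LINT p|P. fourier (F p) \<xi>)"
    and norm_mixture_le: "(LINT x|lborel. norm (LINT p|P. F p x)) \<le> (LINT p|P. LINT x|lborel. norm (F p x))"
proof -
  interpret P: sigma_finite_measure P by fact
  interpret pair_sigma_finite P "lborel :: 'a measure" ..
  show int: "integrable lborel (\<lambda>x. LINT p|P. F p x)"
    using integrable_snd[OF F] .
  have [measurable]: "case_prod F \<in> borel_measurable (P \<Otimes>\<^sub>M lborel)" using F by auto
  have *: "integrable (P \<Otimes>\<^sub>M lborel) (\<lambda>(p, x). exp (- \<i> * complex_of_real (\<xi> \<bullet> x)) * F p x)"
    by (rule Bochner_Integration.integrable_bound[OF F]) (auto simp: norm_mult split_beta')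
  show "fourier (\<lambda>x. LINT p|P. F p x) \<xi> = (LINT p|P. fourier (F p) \<xi>)"
    unfolding fourier_def Fubini_integral[OF *, symmetric] by simp
  have n: "integrable (P \<Otimes>\<^sub>M lborel) (\<lambda>(p, x). norm (F p x))"
    using integrable_norm[OF F] by (simp add: split_beta')
  have "(LINT x|lborel. norm (LINT p|P. F p x)) \<le> (LINT x|lborel. LINT p|P. norm (F p x))"
    by (intro integral_mono integral_norm_bound) (use int integrable_snd[OF n] in auto)
  also have "\<dots> = (LINT p|P. LINT x|lborel. norm (F p x))" using Fubini_integral[OF n] .
  finally show "(LINT x|lborel. norm (LINT p|P. F p x)) \<le> (LINT p|P. LINT x|lborel. norm (F p x))" .
qed

section \<open>Gaussians and their Fourier transforms\<close>

lemma
  shows integrable_gaussian_line: "integrable lborel (\<lambda>x::real. exp (- x\<^sup>2 / 2))"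
    and fourier_gaussian_line: "(LINT x|lborel. complex_of_real (exp (- x\<^sup>2 / 2)) * exp (\<i> * complex_of_real (s * x)))
        = complex_of_real (sqrt (2 * pi) * exp (- s\<^sup>2 / 2))"
proof -
  have eq: "exp (- x\<^sup>2 / 2) = sqrt (2 * pi) * std_normal_density x" for x :: real
    by (simp add: std_normal_density_def)
  have "integrable lborel (\<lambda>x. sqrt (2 * pi) * std_normal_density x)"
    by (intro integrable_mult_right) simp
  then show "integrable lborel (\<lambda>x::real. exp (- x\<^sup>2 / 2))" unfolding eq .
  have "char std_normal_distribution s = (LINT x|lborel. std_normal_density x *\<^sub>R iexp (s * x))"
    unfolding char_def by (subst integral_density) (auto simp: normal_density_nonneg)
  then have "(LINT x|lborel. std_normal_density x *\<^sub>R iexp (s * x)) = complex_of_real (exp (- s\<^sup>2 / 2))"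
    by (simp add: char_std_normal_distribution)
  then have "(LINT x|lborel. complex_of_real (sqrt (2 * pi)) * (std_normal_density x *\<^sub>R iexp (s * x)))
      = complex_of_real (sqrt (2 * pi)) * complex_of_real (exp (- s\<^sup>2 / 2))"
    by (subst integral_mult_right_zero) simp
  then show "(LINT x|lborel. complex_of_real (exp (- x\<^sup>2 / 2)) * exp (\<i> * complex_of_real (s * x)))
        = complex_of_real (sqrt (2 * pi) * exp (- s\<^sup>2 / 2))"
    unfolding eq by (simp add: scaleR_conv_of_real mult.assoc)
qed

text \<open>Lebesgue measure is the image of a product of line measures under the coordinate map; in
  these coordinates the oscillating Gaussian is a product of one-dimensional ones, and product
  integration applies.\<close>

lemma exp_norm_sq_prod:
  fixes f :: "'a::euclidean_space \<Rightarrow> real" and z :: 'a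
  shows "complex_of_real (exp (- (norm (\<Sum>b\<in>Basis. f b *\<^sub>R b))\<^sup>2 / 2)) * exp (\<i> * complex_of_real (z \<bullet> (\<Sum>b\<in>Basis. f b *\<^sub>R b)))
      = (\<Prod>b\<in>Basis. complex_of_real (exp (- (f b)\<^sup>2 / 2)) * exp (\<i> * complex_of_real ((z \<bullet> b) * f b)))"
proof -
  have n: "(norm (\<Sum>b\<in>Basis. f b *\<^sub>R b))\<^sup>2 = (\<Sum>b\<in>Basis. (f b)\<^sup>2)"
    unfolding power2_norm_eq_inner
    by (simp add: inner_sum_left inner_sum_right inner_Basis if_distrib power2_eq_square cong: if_cong)
  have i: "z \<bullet> (\<Sum>b\<in>Basis. f b *\<^sub>R b) = (\<Sum>b\<in>Basis. (z \<bullet> b) * f b)"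
    by (simp add: inner_sum_right mult.commute)
  show ?thesis unfolding n i prod.distrib of_real_prod[symmetric] of_real_sum sum_distrib_left
    by (simp add: exp_sum[symmetric] sum_negf sum_divide_distrib)
qed

lemma
  shows integrable_gaussian: "integrable lborel (\<lambda>x::'a::euclidean_space. exp (- (norm x)\<^sup>2 / 2))"
    and fourier_gaussian: "(LINT x|lborel. complex_of_real (exp (- (norm x)\<^sup>2 / 2)) * exp (\<i> * complex_of_real (z \<bullet> x)))
        = complex_of_real (sqrt (2 * pi) ^ DIM('a) * exp (- (norm (z::'a))\<^sup>2 / 2))"
proof -
  interpret product_sigma_finite "\<lambda>_::'a. lborel :: real measure" ..
  let ?g = "\<lambda>z b x. complex_of_real (exp (- x\<^sup>2 / 2)) * exp (\<i> * complex_of_real ((z \<bullet> (b::'a)) * x))"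
  have ig: "integrable lborel (?g z b)" for z b
    by (rule Bochner_Integration.integrable_bound[OF integrable_gaussian_line]) (auto simp: norm_mult)
  \<comment> \<open>The frequency 0 makes the plain Gaussian an instance of
    \<open>exp_norm_sq_prod\<close>.\<close>
  have "integrable lborel (\<lambda>x::'a. complex_of_real (exp (- (norm x)\<^sup>2 / 2)) * exp (\<i> * complex_of_real (0 \<bullet> x)))"
    by (subst lborel_eq, subst integrable_distr_eq) (auto simp only: exp_norm_sq_prod intro!: product_integrable_prod ig, measurable)
  then show "integrable lborel (\<lambda>x::'a. exp (- (norm x)\<^sup>2 / 2))"
    by (simp add: complex_of_real_integrable_eq)
  have "(LINT x|lborel. complex_of_real (exp (- (norm x)\<^sup>2 / 2)) * exp (\<i> * complex_of_real (z \<bullet> x)))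
      = (LINT f|Pi\<^sub>M Basis (\<lambda>_. lborel). (\<Prod>b\<in>Basis. ?g z b (f b)))"
    by (subst lborel_eq, subst integral_distr) (auto simp only: exp_norm_sq_prod, measurable)
  also have "\<dots> = (\<Prod>b\<in>Basis. LINT x|lborel. ?g z b x)"
    by (rule product_integral_prod) (use ig in auto)
  also have "\<dots> = (\<Prod>b\<in>Basis. complex_of_real (sqrt (2 * pi) * exp (- (z \<bullet> b)\<^sup>2 / 2)))"
    by (simp only: fourier_gaussian_line)
  also have "\<dots> = complex_of_real (sqrt (2 * pi) ^ DIM('a) * exp (- (norm z)\<^sup>2 / 2))"
    unfolding of_real_prod[symmetric] prod.distrib
    by (simp add: exp_sum[symmetric] sum_negf sum_divide_distrib[symmetric] euclidean_inner[of z z] power2_norm_eq_inner flip: power2_eq_square)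
  finally show "(LINT x|lborel. complex_of_real (exp (- (norm x)\<^sup>2 / 2)) * exp (\<i> * complex_of_real (z \<bullet> x)))
        = complex_of_real (sqrt (2 * pi) ^ DIM('a) * exp (- (norm (z::'a))\<^sup>2 / 2))" .
qed

section \<open>Injectivity of the Fourier transform\<close>

text \<open>A Gaussian is, up to the constant \<open>?K\<close>, its own Fourier transform;
  inserting this representation and exchanging the integrals leaves an average of values of
  \<open>fourier f\<close>. The scale \<open>c\<close> stays free because the rescaled Gaussians
  form an approximate identity as it grows.\<close>

lemma fourier_zero_gaussian:
  fixes f :: "'a::euclidean_space \<Rightarrow> complex"
  assumes f: "integrable lborel f" and zero: "\<And>\<xi>. fourier f \<xi> = 0"
  shows "(LINT y|lborel. complex_of_real (exp (- (norm (c *\<^sub>R (x - y)))\<^sup>2 / 2)) * f y) = 0"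
proof -
  define g where "g = (\<lambda>\<xi>::'a. exp (- (norm \<xi>)\<^sup>2 / 2))"
  have g: "integrable lborel g" and [measurable]: "g \<in> borel_measurable borel"
    unfolding g_def using integrable_gaussian by auto
  have g0: "g \<xi> \<ge> 0" for \<xi> by (simp add: g_def)
  note [measurable] = f[THEN borel_measurable_integrable]
  let ?K = "complex_of_real (sqrt (2 * pi) ^ DIM('a))"
  let ?F = "\<lambda>\<xi> y. complex_of_real (g \<xi>) * exp (\<i> * complex_of_real (c *\<^sub>R (x - y) \<bullet> \<xi>)) * f y"
  have int: "integrable (lborel \<Otimes>\<^sub>M lborel) (\<lambda>(\<xi>, y). ?F \<xi> y)"
  proof (rule integrable_pair_bound)
    show "integrable lborel (\<lambda>\<xi>. g \<xi> * (LINT y|lborel. norm (f y)))"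
      using g by simp
    fix \<xi> :: 'a
    have n: "norm (?F \<xi> y) = g \<xi> * norm (f y)" for y using g0 by (simp add: norm_mult)
    show "integrable lborel (\<lambda>y. case (\<xi>, y) of (\<xi>, y) \<Rightarrow> ?F \<xi> y)"
      by (rule Bochner_Integration.integrable_bound[where f="\<lambda>y. g \<xi> * norm (f y)"])
         (use f g0 in \<open>auto simp: norm_mult\<close>)
    show "(LINT y|lborel. norm (case (\<xi>, y) of (\<xi>, y) \<Rightarrow> ?F \<xi> y)) \<le> g \<xi> * (LINT y|lborel. norm (f y))"
      unfolding prod.case n by simp
  qed (auto intro: lborel.sigma_finite_measure_axioms)
  have "?K * (LINT y|lborel. complex_of_real (exp (- (norm (c *\<^sub>R (x - y)))\<^sup>2 / 2)) * f y)
      = (LINT y|lborel. (LINT \<xi>|lborel. complex_of_real (g \<xi>) * exp (\<i> * complex_of_real (c *\<^sub>R (x - y) \<bullet> \<xi>))) * f y)"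
    unfolding g_def fourier_gaussian by (subst integral_mult_right_zero[symmetric]) (simp add: algebra_simps)
  also have "\<dots> = (LINT y|lborel. (LINT \<xi>|lborel. ?F \<xi> y))"
    by simp
  also have "\<dots> = (LINT \<xi>|lborel. (LINT y|lborel. ?F \<xi> y))"
    by (rule lborel_pair.Fubini_integral[OF int])
  also have "\<dots> = (LINT \<xi>|lborel. complex_of_real (g \<xi>) * exp (\<i> * complex_of_real ((c *\<^sub>R x) \<bullet> \<xi>)) * fourier f (c *\<^sub>R \<xi>))"
  proof (rule Bochner_Integration.integral_cong[OF refl])
    fix \<xi>
    have "?F \<xi> y = complex_of_real (g \<xi>) * exp (\<i> * complex_of_real ((c *\<^sub>R x) \<bullet> \<xi>)) * (exp (- \<i> * complex_of_real (c *\<^sub>R \<xi> \<bullet> y)) * f y)" for y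
    proof -
      have "exp (\<i> * complex_of_real (c *\<^sub>R (x - y) \<bullet> \<xi>)) = exp (\<i> * complex_of_real ((c *\<^sub>R x) \<bullet> \<xi>)) * exp (- \<i> * complex_of_real (c *\<^sub>R \<xi> \<bullet> y))"
        unfolding exp_add[symmetric] by (simp add: algebra_simps inner_commute)
      then show ?thesis by (simp only: mult.assoc)
    qed
    then show "(LINT y|lborel. ?F \<xi> y) = complex_of_real (g \<xi>) * exp (\<i> * complex_of_real ((c *\<^sub>R x) \<bullet> \<xi>)) * fourier f (c *\<^sub>R \<xi>)"
      unfolding fourier_def by (simp only: integral_mult_right_zero)
  qed
  also have "\<dots> = 0" by (simp add: zero)
  finally show ?thesis by simp
qed

text \<open>Integrating \<open>f\<close> against the indicator of the box smoothed at width
  \<open>1 / c\<close> gives 0. The smoothed indicators converge off the frontier of the box, which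
  is a null set, so the limit is a multiple of the integral of \<open>f\<close> over the
  box.\<close>

lemma fourier_zero_box:
  fixes f :: "'a::euclidean_space \<Rightarrow> complex"
  assumes f: "integrable lborel f" and zero: "\<And>\<xi>. fourier f \<xi> = 0"
  shows "(LINT y:box a b|lborel. f y) = 0"
proof -
  define g where "g = (\<lambda>z::'a. exp (- (norm z)\<^sup>2 / 2))"
  have g: "integrable lborel g" and [measurable]: "g \<in> borel_measurable borel"
    unfolding g_def using integrable_gaussian by auto
  have g0: "g z \<ge> 0" for z by (simp add: g_def)
  note [measurable] = f[THEN borel_measurable_integrable]
  let ?i = "indicator (box a b) :: 'a \<Rightarrow> real"
  have zeroc: "(LINT y|lborel. f y * complex_of_real (LINT z|lborel. ?i (y + (1/c) *\<^sub>R z) * g z)) = 0" if c: "c > 0" for c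
  proof -
    let ?F = "\<lambda>x y. complex_of_real (?i x * g (c *\<^sub>R (x - y))) * f y"
    have int: "integrable (lborel \<Otimes>\<^sub>M lborel) (\<lambda>(x, y). ?F x y)"
    proof (rule integrable_pair_bound)
      show "integrable lborel (\<lambda>x. ?i x * (LINT y|lborel. norm (f y)))"
        by (intro integrable_mult_left integrable_real_indicator) (use emeasure_lborel_box_finite[of a b] in auto)
      fix x :: 'a
      have n: "norm (?F x y) \<le> ?i x * norm (f y)" for y
        by (auto simp: g_def norm_mult indicator_def mult_left_le_one_le)
      show i: "integrable lborel (\<lambda>y. case (x, y) of (x, y) \<Rightarrow> ?F x y)"
        by (rule Bochner_Integration.integrable_bound[where f="\<lambda>y. ?i x * norm (f y)"])
           (use f n in auto)
      have "(LINT y|lborel. norm (?F x y)) \<le> (LINT y|lborel. ?i x * norm (f y))"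
        by (intro integral_mono n integrable_norm) (use f i in auto)
      then show "(LINT y|lborel. norm (case (x, y) of (x, y) \<Rightarrow> ?F x y)) \<le> ?i x * (LINT y|lborel. norm (f y))"
        by simp
    qed (auto intro: lborel.sigma_finite_measure_axioms)
    have "0 = (LINT x|lborel. complex_of_real (?i x) * (LINT y|lborel. complex_of_real (g (c *\<^sub>R (x - y))) * f y))"
      unfolding g_def fourier_zero_gaussian[OF f zero] by simp
    also have "\<dots> = (LINT x|lborel. LINT y|lborel. ?F x y)"
      by (simp add: mult.assoc)
    also have "\<dots> = (LINT y|lborel. LINT x|lborel. ?F x y)"
      by (rule lborel_pair.Fubini_integral[OF int, symmetric])
    also have "\<dots> = (LINT y|lborel. complex_of_real (LINT x|lborel. ?i x * g (c *\<^sub>R (x - y))) * f y)"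
      by (simp del: of_real_mult)
    \<comment> \<open>The substitution \<open>x = y + z / c\<close> moves the scale into the
      indicator, so that the limit is taken under the fixed integrable weight
      \<open>g\<close>.\<close>
    also have "\<dots> = (LINT y|lborel. complex_of_real ((1/c) ^ DIM('a) * (LINT z|lborel. ?i (y + (1/c) *\<^sub>R z) * g z)) * f y)"
    proof -
      have "(LINT x|lborel. ?i x * g (c *\<^sub>R (x - y))) = (1/c) ^ DIM('a) * (LINT z|lborel. ?i (y + (1/c) *\<^sub>R z) * g z)" for y
        by (subst lborel_integral_affine[of _ "1/c" y]) (use c in auto)
      then show ?thesis by simp
    qed
    also have "\<dots> = complex_of_real ((1/c) ^ DIM('a)) * (LINT y|lborel. f y * complex_of_real (LINT z|lborel. ?i (y + (1/c) *\<^sub>R z) * g z))"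
      by (subst integral_mult_right_zero[symmetric]) (simp add: algebra_simps)
    finally show ?thesis using c by simp
  qed
  have lim_in: "(\<lambda>n. LINT z|lborel. ?i (y + (1 / real (Suc n)) *\<^sub>R z) * g z) \<longlonglongrightarrow> ?i y * (LINT z|lborel. g z)"
    if y: "y \<notin> frontier (box a b)" for y
  proof -
    have "(\<lambda>n. LINT z|lborel. ?i (y + (1 / real (Suc n)) *\<^sub>R z) * g z) \<longlonglongrightarrow> (LINT z|lborel. ?i y * g z)"
    proof (rule integral_dominated_convergence[where w=g])
      show "AE z in lborel. (\<lambda>n. ?i (y + (1 / real (Suc n)) *\<^sub>R z) * g z) \<longlonglongrightarrow> ?i y * g z"
      proof (intro AE_I2 tendsto_mult tendsto_const)
        fix z
        have "(\<lambda>n. y + (1 / real (Suc n)) *\<^sub>R z) \<longlonglongrightarrow> y + 0 *\<^sub>R z"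
          by (intro tendsto_intros LIMSEQ_Suc[OF lim_1_over_n])
        then have l: "(\<lambda>n. y + (1 / real (Suc n)) *\<^sub>R z) \<longlonglongrightarrow> y" by simp
        consider "y \<in> box a b" | "y \<in> - closure (box a b)"
          using y interior_subset[of "box a b"] by (auto simp: frontier_def)
        then show "(\<lambda>n. ?i (y + (1 / real (Suc n)) *\<^sub>R z)) \<longlonglongrightarrow> ?i y"
        proof cases
          case 1
          have "\<forall>\<^sub>F n in sequentially. y + (1 / real (Suc n)) *\<^sub>R z \<in> box a b"
            by (rule topological_tendstoD[OF l]) (use 1 in auto)
          then show ?thesis by (intro tendsto_eventually) (use 1 in \<open>auto elim!: eventually_mono\<close>)
        next
          case 2
          have "\<forall>\<^sub>F n in sequentially. y + (1 / real (Suc n)) *\<^sub>R z \<in> - closure (box a b)"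
            by (rule topological_tendstoD[OF l]) (use 2 in auto)
          then show ?thesis
            using 2 closure_subset[of "box a b"]
            by (intro tendsto_eventually) (auto elim!: eventually_mono simp: indicator_def)
        qed
      qed
      show "AE z in lborel. norm (?i (y + (1 / real (Suc n)) *\<^sub>R z) * g z) \<le> g z" for n
        using g0 by (auto simp: indicator_def)
    qed (use g in auto)
    then show ?thesis by simp
  qed
  have int_g0: "(LINT z|lborel. g z) \<ge> 0" by (intro integral_nonneg_AE AE_I2 g0)
  have "(\<lambda>n. LINT y|lborel. f y * complex_of_real (LINT z|lborel. ?i (y + (1 / real (Suc n)) *\<^sub>R z) * g z))
      \<longlonglongrightarrow> (LINT y|lborel. f y * complex_of_real (?i y * (LINT z|lborel. g z)))"
  proof (rule integral_dominated_convergence[where w="\<lambda>y. norm (f y) * (LINT z|lborel. g z)"])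
    have "negligible (frontier (box a b))"
      by (intro negligible_convex_frontier convex_box)
    then have "frontier (box a b) \<in> null_sets lebesgue" by (simp add: negligible_iff_null_sets)
    then have "frontier (box a b) \<in> null_sets lborel"
      by (intro null_setsI) (auto simp: null_sets_def)
    then have "AE y in lborel. y \<notin> frontier (box a b)" by (rule AE_not_in)
    then show "AE y in lborel. (\<lambda>n. f y * complex_of_real (LINT z|lborel. ?i (y + (1 / real (Suc n)) *\<^sub>R z) * g z)) \<longlonglongrightarrow> f y * complex_of_real (?i y * (LINT z|lborel. g z))"
      by eventually_elim (intro tendsto_intros lim_in)
    show "AE y in lborel. norm (f y * complex_of_real (LINT z|lborel. ?i (y + (1 / real (Suc n)) *\<^sub>R z) * g z)) \<le> norm (f y) * (LINT z|lborel. g z)" for n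
    proof (intro AE_I2)
      fix y
      have "norm (LINT z|lborel. ?i (y + (1 / real (Suc n)) *\<^sub>R z) * g z) \<le> (LINT z|lborel. g z)"
        by (rule Bochner_Integration.integral_norm_bound_integral) (use g g0 in \<open>auto simp: indicator_def intro!: Bochner_Integration.integrable_bound[OF g]\<close>)
      then show "norm (f y * complex_of_real (LINT z|lborel. ?i (y + (1 / real (Suc n)) *\<^sub>R z) * g z)) \<le> norm (f y) * (LINT z|lborel. g z)"
        by (simp add: norm_mult mult_left_mono)
    qed
  qed (use f in auto)
  moreover have "(LINT y|lborel. f y * complex_of_real (LINT z|lborel. ?i (y + (1 / real (Suc n)) *\<^sub>R z) * g z)) = 0" for n
    using zeroc[of "real (Suc n)"] by simp
  ultimately have "(LINT y|lborel. f y * complex_of_real (?i y * (LINT z|lborel. g z))) = 0"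
    by (simp add: LIMSEQ_const_iff)
  moreover have "(LINT y|lborel. f y * complex_of_real (?i y * (LINT z|lborel. g z)))
      = complex_of_real (LINT z|lborel. g z) * (LINT y:box a b|lborel. f y)"
    unfolding set_lebesgue_integral_def
    by (subst integral_mult_right_zero[symmetric]) (simp add: scaleR_conv_of_real algebra_simps)
  \<comment> \<open>The mass to be divided out is the Gaussian transform at frequency 0.\<close>
  moreover have "(LINT z|lborel. g z) \<noteq> 0"
  proof -
    have "complex_of_real (LINT z|lborel. g z) = complex_of_real (sqrt (2 * pi) ^ DIM('a))"
      using fourier_gaussian[of "0::'a"] by (simp add: g_def)
    then show ?thesis unfolding of_real_eq_iff by simp
  qed
  ultimately show ?thesis by simp
qed

text \<open>The positive and negative parts of \<open>f\<close> are densities of finite measures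
  that agree on boxes, an intersection-stable generator, hence everywhere. As \<open>ennreal\<close>
  truncates negative numbers, \<open>ennreal (f x) = ennreal (- f x)\<close> leaves only
  \<open>f x = 0\<close>.\<close>

lemma integral_box_zero_imp_AE_zero:
  fixes f :: "'a::euclidean_space \<Rightarrow> real"
  assumes f: "integrable lborel f" and zero: "\<And>a b. (LINT y:box a b|lborel. f y) = 0"
  shows "AE x in lborel. f x = 0"
proof -
  note [measurable] = f[THEN borel_measurable_integrable]
  let ?p = "\<lambda>x. ennreal (f x)" and ?n = "\<lambda>x. ennreal (- f x)"
  have E: "emeasure (density lborel ?p) (box a b) = emeasure (density lborel ?n) (box a b)" for a b
  proof -
    have i: "integrable lborel (\<lambda>x. indicator (box a b) x * f x)"
      by (rule Bochner_Integration.integrable_bound[OF f]) (auto simp: indicator_def)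
    define P N where "P = (\<integral>\<^sup>+x. ennreal (indicator (box a b) x * f x) \<partial>lborel)"
      and "N = (\<integral>\<^sup>+x. ennreal (- (indicator (box a b) x * f x)) \<partial>lborel)"
    have "enn2real P - enn2real N = 0"
      using zero[of a b] real_lebesgue_integral_def[OF i] unfolding P_def N_def set_lebesgue_integral_def by simp
    moreover have "P < \<infinity>" "N < \<infinity>"
      using i unfolding P_def N_def real_integrable_def by (auto simp: less_top)
    ultimately have "P = N"
      by (metis diff_eq_diff_eq ennreal_enn2real eq_iff_diff_eq_0 infinity_ennreal_def)
    moreover have "emeasure (density lborel ?p) (box a b) = P" "emeasure (density lborel ?n) (box a b) = N"
      unfolding P_def N_def by (auto simp: emeasure_density intro!: nn_integral_cong split: split_indicator)
    ultimately show ?thesis by simp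
  qed
  have "density lborel ?p = density lborel ?n"
  proof (rule measure_eqI_generator_eq[where E="range (\<lambda>(a, b). box a b)" and \<Omega>=UNIV and A="\<lambda>n. box (- (real n *\<^sub>R One)) (real n *\<^sub>R One)"])
    show "Int_stable (range (\<lambda>(a, b). box a b :: 'a set))"
      by (auto simp: Int_stable_def box_Int_box)
    show "sets (density lborel ?p) = sigma_sets UNIV (range (\<lambda>(a, b). box a b))"
      "sets (density lborel ?n) = sigma_sets UNIV (range (\<lambda>(a, b). box a b))"
      by (simp_all add: borel_eq_box)
    show "(\<Union>n. box (- (real n *\<^sub>R One)) (real n *\<^sub>R One)) = (UNIV :: 'a set)"
      by (rule UN_box_eq_UNIV)
    fix n
    have "emeasure (density lborel ?p) (box (- (real n *\<^sub>R One)) (real n *\<^sub>R One)) \<le> (\<integral>\<^sup>+x. ennreal (f x) \<partial>lborel)"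
      by (auto simp: emeasure_density intro!: nn_integral_mono split: split_indicator)
    also have "\<dots> < \<infinity>" using f unfolding real_integrable_def by (auto simp: less_top)
    finally show "emeasure (density lborel ?p) (box (- (real n *\<^sub>R One)) (real n *\<^sub>R One)) \<noteq> \<infinity>" by simp
  qed (auto simp: E)
  then have "AE x in lborel. ?p x = ?n x"
    by (intro sigma_finite_measure.density_unique[OF lborel.sigma_finite_measure_axioms]) auto
  then show ?thesis
  proof eventually_elim
    case (elim x)
    then show ?case by (cases "f x \<ge> 0") (auto simp: ennreal_neg ennreal_eq_0_iff)
  qed
qed

theorem fourier_zero_imp_AE_zero:
  fixes f :: "'a::euclidean_space \<Rightarrow> complex"
  assumes f: "integrable lborel f" and zero: "\<And>\<xi>. fourier f \<xi> = 0"
  shows "AE x in lborel. f x = 0"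
proof -
  have i: "integrable lborel (\<lambda>y. indicator (box a b) y *\<^sub>R f y)" for a b
    by (rule Bochner_Integration.integrable_bound[OF f]) (use f in \<open>auto simp: indicator_def\<close>)
  have "(LINT y:box a b|lborel. Re (f y)) = 0" "(LINT y:box a b|lborel. Im (f y)) = 0" for a b
    using fourier_zero_box[OF f zero, of a b] integral_Re[OF i, of a b] integral_Im[OF i, of a b]
    unfolding set_lebesgue_integral_def by simp_all
  then have "AE x in lborel. Re (f x) = 0" "AE x in lborel. Im (f x) = 0"
    using f by (auto intro!: integral_box_zero_imp_AE_zero)
  then show ?thesis by eventually_elim (simp add: complex_eq_iff)
qed

corollary fourier_eq_imp_AE_eq:
  fixes f g :: "'a::euclidean_space \<Rightarrow> complex"
  assumes f: "integrable lborel f" and g: "integrable lborel g" and eq: "\<And>\<xi>. fourier f \<xi> = fourier g \<xi>"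
  shows "AE x in lborel. f x = g x"
  using fourier_zero_imp_AE_zero[of "\<lambda>x. f x - g x"] f g eq by (simp add: fourier_diff)

section \<open>Uniqueness of Laplace transforms\<close>

lemma integrable_exp_Ici:
  assumes "(r::real) > 0"
  shows "set_integrable lborel {0..} (\<lambda>t. exp (- r * t))"
proof -
  have "(\<integral>\<^sup>+t. ennreal (exp (- r * t)) * indicator {0..} t \<partial>lborel) = ennreal (0 - (- exp (- r * 0) / r))"
  proof (rule nn_integral_FTC_atLeast)
    show "((\<lambda>t. - exp (- r * t) / r) has_real_derivative exp (- r * t)) (at t)" for t
      using assms by (auto intro!: derivative_eq_intros)
    have "((\<lambda>t. exp (- r * t)) \<longlongrightarrow> 0) at_top" using assms by real_asymp
    from tendsto_divide[OF tendsto_minus[OF this] tendsto_const[of r]]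
    show "((\<lambda>t. - exp (- r * t) / r) \<longlongrightarrow> 0) at_top" using assms by simp
  qed auto
  then have "(\<integral>\<^sup>+t. ennreal (norm (indicator {0..} t *\<^sub>R exp (- r * t))) \<partial>lborel) < \<infinity>"
    by (subst nn_integral_cong[where v="\<lambda>t. ennreal (exp (- r * t)) * indicator {0..} t"]) (auto split: split_indicator)
  then show ?thesis unfolding set_integrable_def by (intro integrableI_bounded) auto
qed

lemma
  assumes a: "Re a > 0"
  shows set_integrable_cexp_Ici: "set_integrable lborel {0..} (\<lambda>t. exp (- a * complex_of_real t))"
    and integral_cexp_Ici: "(LINT t:{0..}|lborel. exp (- a * complex_of_real t)) = 1 / a"
proof -
  show int: "set_integrable lborel {0..} (\<lambda>t. exp (- a * complex_of_real t))"
    unfolding set_integrable_def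
    by (rule Bochner_Integration.integrable_bound[OF integrable_exp_Ici[OF a, unfolded set_integrable_def]])
       (auto simp: norm_exp_eq_Re indicator_def)
  have a0: "a \<noteq> 0" using a by auto
  have eq: "(LINT t:{0..b}|lborel. exp (- a * complex_of_real t)) = 1 / a - exp (- a * complex_of_real b) / a" if "b \<ge> 0" for b
    unfolding set_lebesgue_integral_def
    by (subst integral_FTC_Icc[OF that, where F="\<lambda>t. - exp (- a * complex_of_real t) / a"])
       (auto intro!: derivative_eq_intros continuous_intros has_vector_derivative_real_field simp: a0)
  have "((\<lambda>b. LINT t:{0..b}|lborel. exp (- a * complex_of_real t)) \<longlongrightarrow> (LINT t:{0..}|lborel. exp (- a * complex_of_real t))) at_top"
    by (rule tendsto_set_lebesgue_integral_at_top) (use int in auto)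
  moreover have "((\<lambda>b. exp (- a * complex_of_real b)) \<longlongrightarrow> 0) at_top"
  proof (rule tendsto_norm_zero_cancel)
    have "((\<lambda>b. exp (- Re a * b)) \<longlongrightarrow> 0) at_top" using a by real_asymp
    then show "((\<lambda>b. norm (exp (- a * complex_of_real b))) \<longlongrightarrow> 0) at_top"
      by (simp add: norm_exp_eq_Re)
  qed
  from tendsto_diff[OF tendsto_const[of "1 / a"] tendsto_divide[OF this tendsto_const[of a] a0]]
  have "((\<lambda>b. 1 / a - exp (- a * complex_of_real b) / a) \<longlongrightarrow> 1 / a) at_top"
    by simp
  then have "((\<lambda>b. LINT t:{0..b}|lborel. exp (- a * complex_of_real t)) \<longlongrightarrow> 1 / a) at_top"
    by (rule Lim_transform_eventually) (use eq in \<open>auto intro!: eventually_mono[OF eventually_ge_at_top[of 0]]\<close>)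
  ultimately show "(LINT t:{0..}|lborel. exp (- a * complex_of_real t)) = 1 / a"
    by (intro tendsto_unique) auto
qed

text \<open>A nonempty open set is not negligible, so a continuous function on an open set cannot
  hide a nonzero value in a null set.\<close>

lemma continuous_AE_zero_imp_zero:
  fixes g :: "'a::euclidean_space \<Rightarrow> 'b::real_normed_vector"
  assumes S: "open S" and g: "continuous_on S g" and AE: "AE x in lborel. x \<in> S \<longrightarrow> g x = 0" and x: "x \<in> S"
  shows "g x = 0"
proof (rule ccontr)
  assume "g x \<noteq> 0"
  let ?U = "S \<inter> g -` (- {0})"
  have "open ?U" by (rule continuous_open_preimage[OF g S]) auto
  moreover have "x \<in> ?U" using x \<open>g x \<noteq> 0\<close> by auto
  moreover have "?U \<in> null_sets lborel"
    by (subst AE_iff_null_sets) (use AE \<open>open ?U\<close> in auto)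
  then have "negligible ?U"
    unfolding negligible_iff_null_sets by (rule null_sets_completionI)
  ultimately show False using open_not_negligible by blast
qed

lemma continuous_AE_eq_imp_eq:
  fixes g h :: "'a::euclidean_space \<Rightarrow> 'b::real_normed_vector"
  assumes "continuous_on UNIV g" "continuous_on UNIV h" "AE x in lborel. g x = h x"
  shows "g x = h x"
  using continuous_AE_zero_imp_zero[of UNIV "\<lambda>x. g x - h x" x] assms
  by (auto intro: continuous_intros)

text \<open>The hypothesis \<open>zero\<close> speaks of the moments of \<open>w\<close> in the
  variable \<open>x = exp (- t)\<close>, and \<open>w0\<close> confines this variable to (0, 1].
  Weierstrass approximation on [0, 1] passes from polynomials to every continuous
  \<open>F\<close>.\<close>

lemma weighted_exp_integral_zero:
  fixes w :: "real \<Rightarrow> complex" and F :: "real \<Rightarrow> real"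
  assumes w: "integrable lborel w" and w0: "\<And>t. t < 0 \<Longrightarrow> w t = 0"
    and zero: "\<And>n. (LINT t|lborel. w t * complex_of_real (exp (- t) ^ n)) = 0"
    and F: "continuous_on {0..1} F" and [measurable]: "F \<in> borel_measurable borel"
  shows "(LINT t|lborel. w t * complex_of_real (F (exp (- t)))) = 0"
proof -
  note [measurable] = w[THEN borel_measurable_integrable]
  define C where "C = (LINT t|lborel. norm (w t))"
  have C: "C \<ge> 0" unfolding C_def by simp
  have bd: "\<exists>B. \<forall>x\<in>{0..1}. \<bar>G x\<bar> \<le> B" if "continuous_on {0..1} G" for G :: "real \<Rightarrow> real"
    using compact_imp_bounded[OF compact_continuous_image[OF that]] by (auto simp: bounded_iff)
  have int: "integrable lborel (\<lambda>t. w t * complex_of_real (G (exp (- t))))"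
    if G: "continuous_on {0..1} G" and [measurable]: "G \<in> borel_measurable borel" for G
  proof -
    obtain B where B: "\<forall>x\<in>{0..1}. \<bar>G x\<bar> \<le> B" using bd[OF G] by blast
    show ?thesis
    proof (rule Bochner_Integration.integrable_bound[where f="\<lambda>t. B * norm (w t)"])
      have "norm (w t * complex_of_real (G (exp (- t)))) \<le> norm (B * norm (w t))" for t
        using B[rule_format, of "exp (-t)"] w0[of t] by (cases "t < 0") (auto simp: norm_mult mult.commute[of B] intro!: mult_left_mono order.trans[OF _ abs_ge_self])
      then show "AE t in lborel. norm (w t * complex_of_real (G (exp (- t)))) \<le> norm (B * norm (w t))" by simp
    qed (use w in auto)
  qed
  have "norm (LINT t|lborel. w t * complex_of_real (F (exp (- t)))) \<le> e * C" if e: "e > 0" for e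
  proof -
    obtain P where P: "real_polynomial_function P" "\<And>x. x \<in> {0..1} \<Longrightarrow> \<bar>F x - P x\<bar> < e"
      using Stone_Weierstrass_real_polynomial_function[OF _ F e] by auto
    obtain a n where Pa: "P = (\<lambda>x. \<Sum>i\<le>n. a i * x^i)"
      using P(1) unfolding real_polynomial_function_iff_sum by auto
    have cP: "continuous_on {0..1} P" and [measurable]: "P \<in> borel_measurable borel"
      unfolding Pa by (auto intro!: continuous_intros)
    have "(LINT t|lborel. w t * complex_of_real (P (exp (- t)))) = (LINT t|lborel. (\<Sum>i\<le>n. complex_of_real (a i) * (w t * complex_of_real (exp (- t) ^ i))))"
      unfolding Pa by (intro Bochner_Integration.integral_cong) (auto simp: sum_distrib_left algebra_simps)
    also have "\<dots> = (\<Sum>i\<le>n. complex_of_real (a i) * (LINT t|lborel. (w t * complex_of_real (exp (- t) ^ i))))"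
      by (subst Bochner_Integration.integral_sum)
         (auto intro!: integrable_mult_right int[of "\<lambda>x. x ^ _"] continuous_intros simp del: of_real_power)
    also have "\<dots> = 0" using zero by simp
    finally have "(LINT t|lborel. w t * complex_of_real (F (exp (- t))))
        = (LINT t|lborel. w t * complex_of_real (F (exp (- t)))) - (LINT t|lborel. w t * complex_of_real (P (exp (- t))))"
      by simp
    also have "\<dots> = (LINT t|lborel. w t * complex_of_real (F (exp (- t))) - w t * complex_of_real (P (exp (- t))))"
      by (rule Bochner_Integration.integral_diff[symmetric]) (auto intro!: int F cP)
    also have "norm \<dots> \<le> (LINT t|lborel. e * norm (w t))"
    proof (rule Bochner_Integration.integral_norm_bound_integral)
      fix t
      have "w t * complex_of_real (F (exp (- t))) - w t * complex_of_real (P (exp (- t))) = w t * complex_of_real (F (exp (- t)) - P (exp (- t)))"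
        by (simp add: algebra_simps)
      then show "norm (w t * complex_of_real (F (exp (- t))) - w t * complex_of_real (P (exp (- t)))) \<le> e * norm (w t)"
        using P(2)[of "exp (-t)"] w0[of t]
        by (cases "t < 0") (auto simp: norm_mult mult.commute[of "norm (w t)"] simp del: of_real_diff intro!: mult_right_mono)
    qed (use w int F cP in auto)
    also have "\<dots> = e * C" by (simp add: C_def)
    finally show ?thesis .
  qed
  then have le: "norm (LINT t|lborel. w t * complex_of_real (F (exp (- t)))) \<le> e * C" if "e > 0" for e
    using that by blast
  have "norm (LINT t|lborel. w t * complex_of_real (F (exp (- t)))) \<le> 0"
  proof (rule field_le_epsilon)
    fix e :: real assume e: "e > 0"
    \<comment> \<open>Dividing by \<open>C + 1\<close> instead of \<open>C\<close> covers the case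
      that \<open>w\<close> has norm 0.\<close>
    have "norm (LINT t|lborel. w t * complex_of_real (F (exp (- t)))) \<le> e / (C + 1) * C"
      by (rule le) (use e C in simp)
    also have "\<dots> \<le> e" using e C by (simp add: field_simps)
    finally show "norm (LINT t|lborel. w t * complex_of_real (F (exp (- t)))) \<le> 0 + e" by simp
  qed
  then show ?thesis by simp
qed

text \<open>The factor \<open>x\<close> damps the oscillation of functions such as
  \<open>cos (\<xi> * ln x)\<close> at 0, which makes the product continuous up to that endpoint of
  [0, 1].\<close>

lemma isCont_bounded_mult_self:
  assumes "\<And>x::real. \<bar>h x\<bar> \<le> (1::real)"
  shows "isCont (\<lambda>x. x * h x) 0"
proof -
  have "((\<lambda>x. x * h x) \<longlongrightarrow> 0) (at 0)"
  proof (rule Lim_null_comparison[where g="\<lambda>x. \<bar>x\<bar>"])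
    show "\<forall>\<^sub>F x in at 0. norm (x * h x) \<le> \<bar>x\<bar>"
      using assms by (auto simp: abs_mult intro!: always_eventually mult_left_le)
    show "((\<lambda>x::real. \<bar>x\<bar>) \<longlongrightarrow> 0) (at 0)" by (auto intro!: tendsto_eq_intros)
  qed
  then show ?thesis by (simp add: isCont_def)
qed

text \<open>The polynomials in \<open>exp (- t)\<close> uniformly approximate \<open>exp (- t) * cis (\<xi> * t)\<close>, so that a
  vanishing Laplace transform forces a vanishing Fourier transform.\<close>

theorem laplace_zero_imp_zero:
  fixes g :: "real \<Rightarrow> complex"
  assumes g: "continuous_on {0..} g"
    and int: "\<And>s. s > a \<Longrightarrow> set_integrable lborel {0..} (\<lambda>t. exp (- s * t) *\<^sub>R g t)"
    and zero: "\<And>s. s > a \<Longrightarrow> laplace g s = 0"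
    and t: "t \<ge> 0"
  shows "g t = 0"
proof -
  \<comment> \<open>The exponents \<open>c + n\<close> all lie beyond the abscissa \<open>a\<close>;
    they give the moments of \<open>w\<close> in the variable \<open>exp (- t)\<close>.\<close>
  define c where "c = \<bar>a\<bar> + 1"
  have c: "c > a" unfolding c_def by simp
  define w where "w t = indicator {0..} t *\<^sub>R (exp (- c * t) *\<^sub>R g t)" for t
  have w: "integrable lborel w" using int[OF c] unfolding w_def set_integrable_def .
  note [measurable] = w[THEN borel_measurable_integrable]
  have w0: "w t = 0" if "t < 0" for t using that by (simp add: w_def)
  have wn: "(LINT t|lborel. w t * complex_of_real (exp (- t) ^ n)) = 0" for n
  proof -
    have "w t * complex_of_real (exp (- t) ^ n) = indicator {0..} t *\<^sub>R (exp (- (c + real n) * t) *\<^sub>R g t)" for t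
    proof -
      have "exp (- (c + real n) * t) = exp (- c * t) * exp (- t) ^ n"
        unfolding exp_of_nat_mult[symmetric] exp_add[symmetric] by (simp add: algebra_simps)
      then show ?thesis unfolding w_def by (simp only:) (simp add: scaleR_conv_of_real)
    qed
    then have "(LINT t|lborel. w t * complex_of_real (exp (- t) ^ n)) = laplace g (c + real n)"
      unfolding laplace_def set_lebesgue_integral_def by (simp only:)
    then show ?thesis using zero[of "c + real n"] c by simp
  qed
  have cont: "continuous_on {0..1} (\<lambda>x. x * h (\<xi> * ln x))" if h: "continuous_on UNIV h" "\<And>x. \<bar>h x\<bar> \<le> 1" for h :: "real \<Rightarrow> real" and \<xi>
  proof (rule continuous_at_imp_continuous_on, intro ballI)
    fix x :: real assume "x \<in> {0..1}"
    show "isCont (\<lambda>x. x * h (\<xi> * ln x)) x"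
    proof (cases "x = 0")
      case True then show ?thesis using isCont_bounded_mult_self[of "\<lambda>x. h (\<xi> * ln x)"] h by simp
    next
      case False
      have "isCont h (\<xi> * ln x)" using h(1) by (simp add: continuous_on_eq_continuous_at)
      moreover have "isCont (\<lambda>x. \<xi> * ln x) x" using False by (intro continuous_intros)
      ultimately have "isCont (\<lambda>x. h (\<xi> * ln x)) x" by (rule isCont_o2[rotated])
      then show ?thesis by (intro isCont_mult) auto
    qed
  qed
  \<comment> \<open>The extra \<open>exp (- t)\<close> is the damping factor: without it the
    function of \<open>x = exp (- t)\<close> would be \<open>cos (\<xi> * ln x)\<close>, which for
    \<xi> \<noteq> 0 has no continuous extension to \<open>x = 0\<close>.\<close>
  have "fourier (\<lambda>t. exp (- t) *\<^sub>R w t) \<xi> = 0" for \<xi> :: real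
  proof -
    have z: "(LINT t|lborel. w t * complex_of_real (exp (- t) * cos (\<xi> * ln (exp (- t))))) = 0"
      "(LINT t|lborel. w t * complex_of_real (exp (- t) * sin (\<xi> * ln (exp (- t))))) = 0"
      by (rule weighted_exp_integral_zero[OF w w0 wn cont]; auto intro: continuous_intros)+
    have i: "integrable lborel (\<lambda>t. w t * complex_of_real (exp (- t) * h (\<xi> * ln (exp (- t)))))"
      if "continuous_on UNIV h" "\<And>x. \<bar>h x\<bar> \<le> 1" for h :: "real \<Rightarrow> real"
    proof -
      have [measurable]: "h \<in> borel_measurable borel" by (rule borel_measurable_continuous_onI) fact
      have "norm (w t * complex_of_real (exp (- t) * h (\<xi> * ln (exp (- t))))) \<le> norm (w t)" for t
      proof (cases "t < 0")
        case False
        then have "\<bar>exp (- t) * h (\<xi> * ln (exp (- t)))\<bar> \<le> 1 * 1"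
          unfolding abs_mult by (intro mult_mono that) auto
        then show ?thesis by (simp add: norm_mult mult_left_le del: ln_exp)
      qed (simp add: w0)
      then show ?thesis
        by (intro Bochner_Integration.integrable_bound[OF w]) (auto simp del: ln_exp)
    qed
    have "fourier (\<lambda>t. exp (- t) *\<^sub>R w t) \<xi> = (LINT t|lborel. w t * complex_of_real (exp (- t) * cos (\<xi> * ln (exp (- t)))) + \<i> * (w t * complex_of_real (exp (- t) * sin (\<xi> * ln (exp (- t))))))"
      unfolding fourier_def
    proof (intro Bochner_Integration.integral_cong refl)
      fix t
      have e: "exp (- \<i> * complex_of_real (\<xi> \<bullet> t)) = cos (\<xi> * t) - \<i> * sin (\<xi> * t)"
        using cis_conv_exp[of "- (\<xi> * t)"] by (simp add: complex_eq_iff)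
      show "exp (- \<i> * complex_of_real (\<xi> \<bullet> t)) * (exp (- t) *\<^sub>R w t) = w t * complex_of_real (exp (- t) * cos (\<xi> * ln (exp (- t)))) + \<i> * (w t * complex_of_real (exp (- t) * sin (\<xi> * ln (exp (- t)))))"
        unfolding e by (simp add: scaleR_conv_of_real algebra_simps)
    qed
    also have "\<dots> = 0"
      by (subst Bochner_Integration.integral_add) (auto intro!: i integrable_mult_right continuous_intros simp: z simp del: ln_exp of_real_mult)
    finally show ?thesis .
  qed
  moreover have "integrable lborel (\<lambda>t. exp (- t) *\<^sub>R w t)"
  proof (rule Bochner_Integration.integrable_bound[OF w])
    have "norm (exp (- t) *\<^sub>R w t) \<le> norm (w t)" for t
      by (cases "t < 0") (auto simp: w0 mult_left_le_one_le)
    then show "AE t in lborel. norm (exp (- t) *\<^sub>R w t) \<le> norm (w t)" by simp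
  qed auto
  ultimately have "AE t in lborel. exp (- t) *\<^sub>R w t = 0"
    by (intro fourier_zero_imp_AE_zero)
  then have AE: "AE t in lborel. t \<in> {0<..} \<longrightarrow> g t = 0"
    by eventually_elim (auto simp: w_def)
  have g0: "g t = 0" if "t > 0" for t
    by (rule continuous_AE_zero_imp_zero[OF _ _ AE]) (use that g in \<open>auto intro: continuous_on_subset\<close>)
  \<comment> \<open>Vanishing on the open half line says nothing at 0 by itself; the endpoint
    follows by continuity from the right.\<close>
  show ?thesis
  proof (cases "t = 0")
    case True
    have "(g \<longlongrightarrow> g 0) (at_right 0)"
      using g by (auto simp: continuous_on_def intro: tendsto_within_subset)
    moreover have "(g \<longlongrightarrow> 0) (at_right 0)"
      by (rule tendsto_eventually) (use g0 in \<open>auto simp: eventually_at_filter\<close>)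
    ultimately show ?thesis using True by (auto intro: tendsto_unique[of "at_right (0::real)"])
  qed (use g0 t in auto)
qed

corollary laplace_eq_imp_eq:
  fixes g h :: "real \<Rightarrow> complex"
  assumes "continuous_on {0..} g" "continuous_on {0..} h"
    and g: "\<And>s. s > a \<Longrightarrow> set_integrable lborel {0..} (\<lambda>t. exp (- s * t) *\<^sub>R g t)"
    and h: "\<And>s. s > a \<Longrightarrow> set_integrable lborel {0..} (\<lambda>t. exp (- s * t) *\<^sub>R h t)"
    and eq: "\<And>s. s > a \<Longrightarrow> laplace g s = laplace h s"
    and t: "t \<ge> 0"
  shows "g t = h t"
proof -
  have "g t - h t = 0"
  proof (rule laplace_zero_imp_zero[where a=a and g="\<lambda>t. g t - h t"])
    fix s assume s: "s > a"
    show "set_integrable lborel {0..} (\<lambda>t. exp (- s * t) *\<^sub>R (g t - h t))"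
      using set_integral_diff(1)[OF g[OF s] h[OF s]] by (simp add: scaleR_diff_right)
    show "laplace (\<lambda>t. g t - h t) s = 0"
      using set_integral_diff(2)[OF g[OF s] h[OF s]] eq[OF s] by (simp add: scaleR_diff_right laplace_def)
  qed (use assms in \<open>auto intro: continuous_intros\<close>)
  then show ?thesis by simp
qed

section \<open>The symbol of a Levy process\<close>

locale symbol =
  fixes M :: "'w measure" and X :: "real \<Rightarrow> 'w \<Rightarrow> 'a::euclidean_space" and \<psi> :: "'a \<Rightarrow> complex"
  assumes prob: "prob_space M"
    and X_measurable: "\<And>t. t \<ge> 0 \<Longrightarrow> X t \<in> borel_measurable M"
    and symbol: "levy_symbol M X \<psi>"
begin

sublocale prob_space M by (rule prob)

lemma integrable_char: "t \<ge> 0 \<Longrightarrow> integrable M (\<lambda>\<omega>. exp (\<i> * complex_of_real (\<xi> \<bullet> X t \<omega>)))"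
  using X_measurable[of t] by (intro integrable_const_bound[where B=1]) auto

lemma char_eq: "t \<ge> 0 \<Longrightarrow> (LINT \<omega>|M. exp (\<i> * complex_of_real (\<xi> \<bullet> X t \<omega>))) = exp (complex_of_real t * \<psi> \<xi>)"
  using symbol unfolding levy_symbol_def by auto

text \<open>A characteristic function has modulus at most 1, and at time 1 this modulus is
  \<open>exp (Re (\<psi> \<xi>))\<close>.\<close>

lemma Re_symbol_nonpos: "Re (\<psi> \<xi>) \<le> 0"
proof -
  have "norm (exp (complex_of_real 1 * \<psi> \<xi>)) \<le> (LINT \<omega>|M. norm (exp (\<i> * complex_of_real (\<xi> \<bullet> X 1 \<omega>))))"
    unfolding char_eq[of 1 \<xi>, symmetric, OF zero_le_one] by (rule integral_norm_bound)
  then show ?thesis by (simp add: prob_space norm_exp_eq_Re)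
qed

lemma continuous_on_exp_symbol:
  assumes t: "t \<ge> 0"
  shows "continuous_on UNIV (\<lambda>\<xi>. exp (complex_of_real t * \<psi> \<xi>))"
proof (rule continuous_at_imp_continuous_on, intro ballI)
  fix \<xi> :: 'a
  note [measurable] = X_measurable[OF t]
  show "isCont (\<lambda>\<xi>. exp (complex_of_real t * \<psi> \<xi>)) \<xi>"
    unfolding continuous_within tendsto_at_iff_sequentially comp_def char_eq[OF t, symmetric]
  proof (intro allI impI)
    fix x :: "nat \<Rightarrow> 'a" assume x: "x \<longlonglongrightarrow> \<xi>"
    show "(\<lambda>i. LINT \<omega>|M. exp (\<i> * complex_of_real (x i \<bullet> X t \<omega>))) \<longlonglongrightarrow> (LINT \<omega>|M. exp (\<i> * complex_of_real (\<xi> \<bullet> X t \<omega>)))"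
      by (rule integral_dominated_convergence[where w="\<lambda>_. 1"]) (auto intro!: AE_I2 tendsto_intros x)
  qed
qed

text \<open>The Laplace transform of \<open>exp (t * \<psi> \<xi>)\<close> in \<open>t\<close> at \<open>1\<close> is \<open>1 / (1 - \<psi> \<xi>)\<close>; this avoids choosing
  a continuous logarithm.\<close>

lemma continuous_on_symbol: "continuous_on UNIV \<psi>"
proof -
  have R: "(LINT t:{0..}|lborel. exp (- (1 - \<psi> \<xi>) * complex_of_real t)) = 1 / (1 - \<psi> \<xi>)" for \<xi>
    by (rule integral_cexp_Ici) (use Re_symbol_nonpos[of \<xi>] in auto)
  have nz: "1 - \<psi> \<xi> \<noteq> 0" for \<xi>
    using Re_symbol_nonpos[of \<xi>] by (auto simp: complex_eq_iff)
  have "isCont (\<lambda>\<xi>. 1 / (1 - \<psi> \<xi>)) \<xi>" for \<xi>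
    unfolding continuous_within tendsto_at_iff_sequentially comp_def R[symmetric] set_lebesgue_integral_def
  proof (intro allI impI)
    fix x :: "nat \<Rightarrow> 'a" assume x: "x \<longlonglongrightarrow> \<xi>"
    show "(\<lambda>i. LINT t|lborel. indicator {0..} t *\<^sub>R exp (- (1 - \<psi> (x i)) * complex_of_real t))
        \<longlonglongrightarrow> (LINT t|lborel. indicator {0..} t *\<^sub>R exp (- (1 - \<psi> \<xi>) * complex_of_real t))"
    proof (rule integral_dominated_convergence[where w="\<lambda>t. indicator {0..} t *\<^sub>R exp (- 1 * t)"])
      show "integrable lborel (\<lambda>t::real. indicator {0..} t *\<^sub>R exp (- 1 * t))"
        using integrable_exp_Ici[of 1] by (simp add: set_integrable_def)
      show "AE t in lborel. norm (indicator {0..} t *\<^sub>R exp (- (1 - \<psi> (x i)) * complex_of_real t)) \<le> indicator {0..} t *\<^sub>R exp (- 1 * t)" for i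
        using Re_symbol_nonpos[of "x i"] by (intro AE_I2) (auto simp: indicator_def norm_exp_eq_Re mult_nonneg_nonpos algebra_simps)
      show "AE t in lborel. (\<lambda>i. indicator {0..} t *\<^sub>R exp (- (1 - \<psi> (x i)) * complex_of_real t)) \<longlonglongrightarrow> indicator {0..} t *\<^sub>R exp (- (1 - \<psi> \<xi>) * complex_of_real t)"
      proof (intro AE_I2)
        fix t :: real
        have e: "exp (- (1 - \<psi> \<xi>) * complex_of_real t) = exp (- complex_of_real t) * exp (complex_of_real t * \<psi> \<xi>)" for \<xi>
          by (simp add: exp_add[symmetric] algebra_simps)
        show "(\<lambda>i. indicator {0..} t *\<^sub>R exp (- (1 - \<psi> (x i)) * complex_of_real t)) \<longlonglongrightarrow> indicator {0..} t *\<^sub>R exp (- (1 - \<psi> \<xi>) * complex_of_real t)"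
        proof (cases "t \<ge> 0")
          case True
          show ?thesis unfolding e
            by (intro tendsto_intros continuous_on_tendsto_compose[OF continuous_on_exp_symbol[OF True] x]) auto
        qed auto
      qed
    qed measurable
  qed
  \<comment> \<open>The resolvent \<open>1 / (1 - \<psi> \<xi>)\<close> never vanishes, so \<psi> is
    recovered from it by a continuous operation.\<close>
  then have "isCont (\<lambda>\<xi>. 1 - inverse (1 / (1 - \<psi> \<xi>))) \<xi>" for \<xi>
    by (intro isCont_diff continuous_at_within_inverse continuous_const) (use nz in simp_all)
  moreover have "(\<lambda>\<xi>. 1 - inverse (1 / (1 - \<psi> \<xi>))) = \<psi>" by (auto simp: fun_eq_iff)
  ultimately have "isCont \<psi> \<xi>" for \<xi> by (simp only:)
  then show ?thesis by (simp add: continuous_at_imp_continuous_on)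
qed

text \<open>The variance of \<open>Z = exp (\<i> * (\<xi> \<bullet> X t))\<close> bounds \<open>E Z\<^sup>2 - (E Z)\<^sup>2\<close>; divide by \<open>t\<close> and let \<open>t\<close> tend to \<open>0\<close>.\<close>

lemma norm_symbol_double: "norm (\<psi> (2 *\<^sub>R \<xi>)) \<le> 4 * norm (\<psi> \<xi>)"
proof -
  define \<phi> where "\<phi> t \<xi> = exp (complex_of_real t * \<psi> \<xi>)" for t \<xi>
  have var: "norm (\<phi> t (2 *\<^sub>R \<xi>) - \<phi> t \<xi> ^ 2) \<le> 1 - (norm (\<phi> t \<xi>))\<^sup>2" if t: "t \<ge> 0" for t
  proof -
    note [measurable] = X_measurable[OF t]
    define Z where "Z \<omega> = exp (\<i> * complex_of_real (\<xi> \<bullet> X t \<omega>))" for \<omega>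
    define c where "c = \<phi> t \<xi>"
    have Z: "(LINT \<omega>|M. Z \<omega>) = c" unfolding Z_def c_def \<phi>_def by (rule char_eq[OF t])
    have Z2: "(LINT \<omega>|M. Z \<omega> ^ 2) = \<phi> t (2 *\<^sub>R \<xi>)"
      unfolding Z_def \<phi>_def char_eq[OF t, symmetric] by (simp add: exp_double[symmetric] algebra_simps)
    have iZ: "integrable M Z" unfolding Z_def by (rule integrable_char[OF t])
    have [measurable]: "Z \<in> borel_measurable M" using iZ by auto
    have nZ: "norm (Z \<omega>) = 1" for \<omega> by (simp add: Z_def)
    have iZ2: "integrable M (\<lambda>\<omega>. Z \<omega> ^ 2)"
      by (rule integrable_const_bound[where B=1]) (auto simp: norm_power nZ)
    have "\<phi> t (2 *\<^sub>R \<xi>) - c ^ 2 = (LINT \<omega>|M. Z \<omega> ^ 2 - 2 * c * Z \<omega> + c ^ 2)"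
      using iZ iZ2 by (simp add: Z Z2 prob_space) (simp add: power2_eq_square)
    also have "\<dots> = (LINT \<omega>|M. (Z \<omega> - c) ^ 2)"
      by (simp add: power2_eq_square algebra_simps)
    also have "norm \<dots> \<le> (LINT \<omega>|M. norm ((Z \<omega> - c) ^ 2))" by (rule integral_norm_bound)
    \<comment> \<open>As \<open>Z\<close> has modulus 1, expanding the square leads to the variance
      \<open>1 - (norm c)\<^sup>2\<close>.\<close>
    also have "\<dots> = (LINT \<omega>|M. 1 + (norm c)\<^sup>2 - 2 * Re (cnj c * Z \<omega>))"
    proof (rule Bochner_Integration.integral_cong[OF refl])
      fix \<omega>
      have "norm ((Z \<omega> - c) ^ 2) = (norm (Z \<omega> - c))\<^sup>2" by (simp add: norm_power)
      also have "\<dots> = (norm (Z \<omega>))\<^sup>2 + (norm c)\<^sup>2 - 2 * Re (cnj c * Z \<omega>)"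
        unfolding cmod_power2 by (simp add: power2_eq_square algebra_simps)
      finally show "norm ((Z \<omega> - c) ^ 2) = 1 + (norm c)\<^sup>2 - 2 * Re (cnj c * Z \<omega>)" by (simp add: nZ)
    qed
    also have "\<dots> = 1 + (norm c)\<^sup>2 - 2 * Re (cnj c * c)"
    proof -
      have i: "integrable M (\<lambda>\<omega>. cnj c * Z \<omega>)" using iZ by simp
      then have "(LINT \<omega>|M. Re (cnj c * Z \<omega>)) = Re (cnj c * c)"
        using integral_Re[OF i] by (simp add: Z)
      moreover have "integrable M (\<lambda>\<omega>. Re (cnj c * Z \<omega>))" by (rule integrable_Re[OF i])
      ultimately show ?thesis by (simp add: prob_space del: times_complex.sel)
    qed
    also have "Re (cnj c * c) = (norm c)\<^sup>2"
      unfolding cmod_power2 by (simp add: power2_eq_square)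
    finally show ?thesis by (simp add: c_def)
  qed
  define a where "a = \<psi> (2 *\<^sub>R \<xi>)" define b where "b = \<psi> \<xi>"
  \<comment> \<open>Both sides of \<open>var\<close> are 0 at time 0; dividing by t compares their
    derivatives there.\<close>
  have main: "norm (a - 2 * b) \<le> - (2 * Re b)"
  proof (rule tendsto_le)
    have "((\<lambda>z. exp (z * a) - exp (z * (2 * b))) has_field_derivative (a - 2 * b)) (at 0)"
      by (auto intro!: derivative_eq_intros)
    then have "((\<lambda>z. (exp (z * a) - exp (z * (2 * b))) / z) \<longlongrightarrow> a - 2 * b) (at 0)"
      by (simp add: has_field_derivative_iff)
    moreover have "filterlim complex_of_real (at 0) (at_right 0)"
      unfolding filterlim_at by (auto intro!: tendsto_eq_intros simp: eventually_at_filter)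
    ultimately have "((\<lambda>t. (exp (complex_of_real t * a) - exp (complex_of_real t * (2 * b))) / complex_of_real t) \<longlongrightarrow> a - 2 * b) (at_right 0)"
      by (rule filterlim_compose)
    then have "((\<lambda>t. (exp (complex_of_real t * a) - exp (complex_of_real t * (2 * b))) /\<^sub>R t) \<longlongrightarrow> a - 2 * b) (at_right 0)"
      by (simp add: scaleR_conv_of_real divide_inverse mult.commute)
    then have "((\<lambda>t. norm ((exp (complex_of_real t * a) - exp (complex_of_real t * (2 * b))) /\<^sub>R t)) \<longlongrightarrow> norm (a - 2 * b)) (at_right 0)"
      by (rule tendsto_norm)
    then show "((\<lambda>t. norm ((exp (complex_of_real t * a) - exp (complex_of_real t * (2 * b))) /\<^sub>R t)) \<longlongrightarrow> norm (a - 2 * b)) (at_right 0)" .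
    have "((\<lambda>t. 1 - exp (2 * t * Re b)) has_real_derivative - (2 * Re b)) (at 0)"
      by (auto intro!: derivative_eq_intros)
    then show "((\<lambda>t. (1 - exp (2 * t * Re b)) / t) \<longlongrightarrow> - (2 * Re b)) (at_right 0)"
      by (auto simp: has_field_derivative_iff intro: tendsto_within_subset)
    show "\<forall>\<^sub>F t in at_right 0. norm ((exp (complex_of_real t * a) - exp (complex_of_real t * (2 * b))) /\<^sub>R t) \<le> (1 - exp (2 * t * Re b)) / t"
    proof (rule eventually_at_rightI[of 0 1])
      fix t :: real assume t: "t \<in> {0<..<1}"
      have "exp (complex_of_real t * b) ^ 2 = exp (complex_of_real t * (2 * b))"
        by (simp add: exp_double[symmetric] algebra_simps)
      moreover have "(norm (exp (complex_of_real t * b)))\<^sup>2 = exp (2 * t * Re b)"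
        by (simp add: norm_exp_eq_Re exp_double[symmetric] algebra_simps)
      ultimately have "norm (exp (complex_of_real t * a) - exp (complex_of_real t * (2 * b))) \<le> 1 - exp (2 * t * Re b)"
        using var[of t] t unfolding \<phi>_def a_def b_def by simp
      then show "norm ((exp (complex_of_real t * a) - exp (complex_of_real t * (2 * b))) /\<^sub>R t) \<le> (1 - exp (2 * t * Re b)) / t"
        using t by (simp add: divide_right_mono divide_inverse mult.commute)
    qed auto
  qed auto
  have "norm a \<le> norm (a - 2 * b) + norm (2 * b)"
    by (metis norm_triangle_sub add.commute)
  also have "\<dots> \<le> 4 * norm b" using main abs_Re_le_cmod[of b] by (simp add: norm_mult)
  finally show ?thesis by (simp add: a_def b_def)
qed

text \<open>Each doubling of the frequency costs at most a factor 4, so the bound on the unit ball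
  spreads to quadratic growth. This is what lets the powers of \<psi> define tempered
  distributions.\<close>

lemma symbol_growth: obtains C where "C \<ge> 0" "\<And>\<xi>. norm (\<psi> \<xi>) \<le> C * (1 + norm \<xi>) ^ 2"
proof -
  have "compact (\<psi> ` cball 0 1)"
    by (intro compact_continuous_image continuous_on_subset[OF continuous_on_symbol]) auto
  then obtain B where B: "\<And>\<xi>. norm \<xi> \<le> 1 \<Longrightarrow> norm (\<psi> \<xi>) \<le> B"
    using compact_imp_bounded by (fastforce simp: bounded_iff)
  have B0: "B \<ge> 0" using B[of 0] by (simp add: order.trans[OF norm_ge_zero])
  have pow: "norm (\<psi> (2 ^ n *\<^sub>R \<xi>)) \<le> 4 ^ n * norm (\<psi> \<xi>)" for n \<xi>
  proof (induction n)
    case (Suc n)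
    then show ?case using norm_symbol_double[of "2 ^ n *\<^sub>R \<xi>"] by simp
  qed simp
  have "norm (\<psi> \<xi>) \<le> 4 * B * (1 + norm \<xi>) ^ 2" for \<xi>
  proof -
    \<comment> \<open>With this number of doublings \<open>2 ^ n\<close> lies between
      \<open>1 + norm \<xi>\<close> and twice that value, so \<xi> is reached from the unit ball
      without losing the quadratic rate.\<close>
    define n where "n = nat \<lceil>log 2 (1 + norm \<xi>)\<rceil>"
    have l: "log 2 (1 + norm \<xi>) \<ge> 0" by (subst zero_le_log_cancel_iff) (auto simp: add_pos_nonneg)
    have "1 + norm \<xi> = 2 powr log 2 (1 + norm \<xi>)" by (simp add: add_pos_nonneg)
    also have "\<dots> \<le> 2 powr real n" unfolding n_def using l by (intro powr_mono) linarith+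
    finally have n1: "norm \<xi> \<le> 2 ^ n" by (simp add: powr_realpow)
    have "2 powr real n \<le> 2 powr (log 2 (1 + norm \<xi>) + 1)" unfolding n_def using l by (intro powr_mono) linarith+
    also have "\<dots> = 2 * (1 + norm \<xi>)" by (simp add: powr_add add_pos_nonneg)
    finally have n2: "2 ^ n \<le> 2 * (1 + norm \<xi>)" by (simp add: powr_realpow)
    have "norm (\<psi> \<xi>) = norm (\<psi> (2 ^ n *\<^sub>R ((1 / 2 ^ n) *\<^sub>R \<xi>)))" by simp
    also have "\<dots> \<le> 4 ^ n * norm (\<psi> ((1 / 2 ^ n) *\<^sub>R \<xi>))" by (rule pow)
    also have "\<dots> \<le> 4 ^ n * B" by (intro mult_left_mono B) (use n1 in \<open>auto simp: field_simps\<close>)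
    also have "(4::real) ^ n = (2 ^ n) ^ 2" by (simp add: power2_eq_square flip: power_mult_distrib)
    also have "(2 ^ n) ^ 2 * B \<le> (2 * (1 + norm \<xi>)) ^ 2 * B"
      by (intro mult_right_mono power_mono n2 B0) auto
    finally show ?thesis by (simp only: power_mult_distrib) (simp add: mult_ac)
  qed
  then show ?thesis using that[of "4 * B"] B0 by auto
qed

end

section \<open>Schwartz functions\<close>

text \<open>A class of continuous functions that pair absolutely with Schwartz functions and is
  closed under sums and products, so that it contains every term of the transformed right-hand side.
  Using \<open>1 + norm x\<close> makes the bound monotone in the exponent.\<close>

definition slowly_growing :: "('a::euclidean_space \<Rightarrow> complex) \<Rightarrow> bool" where
  "slowly_growing G \<longleftrightarrow> continuous_on UNIV G \<and> (\<exists>C N. C \<ge> 0 \<and> (\<forall>x. norm (G x) \<le> C * (1 + norm x) ^ N))"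

lemma slowly_growingI:
  "continuous_on UNIV G \<Longrightarrow> C \<ge> 0 \<Longrightarrow> (\<And>x. norm (G x) \<le> C * (1 + norm x) ^ N) \<Longrightarrow> slowly_growing G"
  unfolding slowly_growing_def by blast

lemma slowly_growing_const: "slowly_growing (\<lambda>x. c)"
  by (rule slowly_growingI[of _ "norm c" 0]) auto

lemma slowly_growing_fourier: "integrable lborel f \<Longrightarrow> slowly_growing (fourier f)"
  by (rule slowly_growingI[of _ "LINT x|lborel. norm (f x)" 0]) (auto intro: continuous_on_fourier norm_fourier_le)

lemma slowly_growing_add:
  assumes "slowly_growing G" "slowly_growing H"
  shows "slowly_growing (\<lambda>x. G x + H x)"
proof -
  obtain C n D k where *: "C \<ge> 0" "D \<ge> 0" "\<And>x. norm (G x) \<le> C * (1 + norm x) ^ n" "\<And>x. norm (H x) \<le> D * (1 + norm x) ^ k"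
    using assms unfolding slowly_growing_def by blast
  have "norm (G x + H x) \<le> (C + D) * (1 + norm x) ^ (n + k)" for x
  proof -
    have "norm (G x + H x) \<le> C * (1 + norm x) ^ n + D * (1 + norm x) ^ k"
      using *(3,4)[of x] norm_triangle_ineq[of "G x" "H x"] by linarith
    also have "\<dots> \<le> C * (1 + norm x) ^ (n + k) + D * (1 + norm x) ^ (n + k)"
      by (intro add_mono mult_left_mono power_increasing *) auto
    finally show ?thesis by (simp add: algebra_simps)
  qed
  then show ?thesis using * assms
    by (intro slowly_growingI[of _ "C + D" "n + k"]) (auto simp: slowly_growing_def intro: continuous_intros)
qed

lemma slowly_growing_mult:
  assumes "slowly_growing G" "slowly_growing H"
  shows "slowly_growing (\<lambda>x. G x * H x)"
proof -
  obtain C n D k where *: "C \<ge> 0" "D \<ge> 0" "\<And>x. norm (G x) \<le> C * (1 + norm x) ^ n" "\<And>x. norm (H x) \<le> D * (1 + norm x) ^ k"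
    using assms unfolding slowly_growing_def by blast
  have "norm (G x * H x) \<le> (C * D) * (1 + norm x) ^ (n + k)" for x
    using mult_mono[OF *(3)[of x] *(4)[of x]] *(1) by (simp add: norm_mult power_add algebra_simps)
  then show ?thesis using * assms
    by (intro slowly_growingI[of _ "C * D" "n + k"]) (auto simp: slowly_growing_def intro: continuous_intros)
qed

lemma slowly_growing_power: "slowly_growing G \<Longrightarrow> slowly_growing (\<lambda>x. G x ^ n)"
  by (induction n) (auto intro: slowly_growing_const slowly_growing_mult)

lemma slowly_growing_sum:
  "(\<And>i. i \<in> I \<Longrightarrow> slowly_growing (G i)) \<Longrightarrow> slowly_growing (\<lambda>x. \<Sum>i\<in>I. G i x)"
  by (induction I rule: infinite_finite_induct) (auto intro: slowly_growing_const slowly_growing_add)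

lemma schwartz_continuous: "schwartz \<eta> \<Longrightarrow> continuous_on UNIV \<eta>"
  by (erule schwartz.cases)
     (auto intro!: continuous_at_imp_continuous_on differentiable_imp_continuous_within)

lemma schwartz_bound:
  assumes "schwartz \<eta>"
  obtains B where "\<And>x. (1 + norm x) ^ N * norm (\<eta> x) \<le> B"
proof -
  have "bounded (range (\<lambda>x. (1 + norm x) ^ N *\<^sub>R \<eta> x))"
    using assms by (auto elim: schwartz.cases)
  then obtain B where "\<And>x. norm ((1 + norm x) ^ N *\<^sub>R \<eta> x) \<le> B"
    unfolding bounded_iff by auto
  then show ?thesis using that[of B] by simp
qed

text \<open>Every coordinate satisfies
  \<open>1 + (x \<bullet> b)\<^sup>2 \<le> (1 + norm x)\<^sup>2\<close>; multiplying over the basis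
  compares the power \<open>2 * DIM('a)\<close> with a tensor product of integrable functions of one
  variable.\<close>

lemma integrable_inverse_norm_power:
  "integrable lborel (\<lambda>x::'a::euclidean_space. inverse ((1 + norm x) ^ (2 * DIM('a))))"
proof -
  interpret product_sigma_finite "\<lambda>_::'a. lborel :: real measure" ..
  have i1: "integrable lborel (\<lambda>x::real. inverse (1 + x\<^sup>2))"
    using integrable_inverse_1_plus_square by (simp add: set_integrable_def einterval_eq)
  have "integrable lborel (\<lambda>x::'a. \<Prod>b\<in>Basis. inverse (1 + (x \<bullet> b)\<^sup>2))"
    by (subst lborel_eq, subst integrable_distr_eq)
       (auto intro!: product_integrable_prod i1 simp: inner_sum_left inner_Basis if_distrib cong: if_cong)
  then show ?thesis
  proof (rule Bochner_Integration.integrable_bound)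
    have "norm (inverse ((1 + norm x) ^ (2 * DIM('a)))) \<le> norm (\<Prod>b\<in>Basis. inverse (1 + (x \<bullet> b)\<^sup>2))" for x :: 'a
    proof -
      have "(\<Prod>b\<in>(Basis::'a set). inverse ((1 + norm x)\<^sup>2)) \<le> (\<Prod>b\<in>Basis. inverse (1 + (x \<bullet> b)\<^sup>2))"
      proof (intro prod_mono conjI)
        fix b :: 'a assume "b \<in> Basis"
        then have "(x \<bullet> b)\<^sup>2 \<le> (norm x)\<^sup>2" using Basis_le_norm[of b x] by (intro abs_le_square_iff[THEN iffD1]) auto
        then have "1 + (x \<bullet> b)\<^sup>2 \<le> (1 + norm x)\<^sup>2" by (simp add: power2_sum add_increasing2)
        then show "inverse ((1 + norm x)\<^sup>2) \<le> inverse (1 + (x \<bullet> b)\<^sup>2)"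
          by (intro le_imp_inverse_le) (auto simp: add_pos_nonneg)
      qed auto
      then show ?thesis by (simp add: power_mult power_inverse prod_nonneg)
    qed
    then show "AE x::'a in lborel. norm (inverse ((1 + norm x) ^ (2 * DIM('a)))) \<le> norm (\<Prod>b\<in>Basis. inverse (1 + (x \<bullet> b)\<^sup>2))"
      by simp
  qed measurable
qed

lemma slowly_growing_integrable:
  fixes G \<eta> :: "'a::euclidean_space \<Rightarrow> complex"
  assumes sg: "slowly_growing G" and \<eta>: "schwartz \<eta>"
  shows "integrable lborel (\<lambda>x. G x * \<eta> x)"
proof -
  obtain C N where C: "C \<ge> 0" and G: "\<And>x. norm (G x) \<le> C * (1 + norm x) ^ N"
    using sg unfolding slowly_growing_def by blast
  have [measurable]: "G \<in> borel_measurable borel"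
    using sg unfolding slowly_growing_def by (blast intro: borel_measurable_continuous_onI)
  have [measurable]: "\<eta> \<in> borel_measurable borel"
    by (rule borel_measurable_continuous_onI[OF schwartz_continuous[OF \<eta>]])
  \<comment> \<open>\<open>N\<close> of these powers absorb the growth of \<open>G\<close>; the
    other \<open>2 * DIM('a)\<close> leave an integrable majorant.\<close>
  obtain B where B: "\<And>x. (1 + norm x) ^ (N + 2 * DIM('a)) * norm (\<eta> x) \<le> B"
    using schwartz_bound[OF \<eta>] by blast
  show ?thesis
  proof (rule Bochner_Integration.integrable_bound[OF integrable_mult_right[OF integrable_inverse_norm_power]])
    have "norm (G x * \<eta> x) \<le> norm ((C * B) * inverse ((1 + norm x) ^ (2 * DIM('a))))" for x
    proof -
      have p: "(1 + norm x) ^ k > 0" for k by (simp add: add_pos_nonneg)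
      have "norm (G x * \<eta> x) \<le> C * ((1 + norm x) ^ N * norm (\<eta> x))"
        using mult_right_mono[OF G[of x] norm_ge_zero[of "\<eta> x"]] by (simp add: norm_mult mult.assoc)
      also have "(1 + norm x) ^ N * norm (\<eta> x) \<le> B * inverse ((1 + norm x) ^ (2 * DIM('a)))"
        using B[of x] p[of "2 * DIM('a)"] by (simp add: power_add field_simps)
      finally have "norm (G x * \<eta> x) \<le> C * (B * inverse ((1 + norm x) ^ (2 * DIM('a))))"
        using C by (simp add: mult_left_mono)
      also have "\<dots> \<le> norm ((C * B) * inverse ((1 + norm x) ^ (2 * DIM('a))))"
        unfolding real_norm_def mult.assoc by (rule abs_ge_self)
      finally show ?thesis .
    qed
    then show "AE x in lborel. norm (G x * \<eta> x) \<le> norm ((C * B) * inverse ((1 + norm x) ^ (2 * DIM('a))))" by simp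
  qed auto
qed

section \<open>Modulated Gaussians as test functions\<close>

text \<open>Complex polynomials in the coordinates. As \<open>schwartz\<close> is coinductive and
  asks about all directional derivatives, a class closed under differentiation is required, and
  polynomials times a Gaussian form one.\<close>

inductive cpoly :: "('a::euclidean_space \<Rightarrow> complex) \<Rightarrow> bool" where
  const: "cpoly (\<lambda>x. c)"
| inner: "cpoly (\<lambda>x. complex_of_real (x \<bullet> b))"
| add: "cpoly p \<Longrightarrow> cpoly q \<Longrightarrow> cpoly (\<lambda>x. p x + q x)"
| mult: "cpoly p \<Longrightarrow> cpoly q \<Longrightarrow> cpoly (\<lambda>x. p x * q x)"

lemma cpoly_has_derivative:
  assumes "cpoly p"
  shows "\<exists>D. (\<forall>x. (p has_derivative D x) (at x)) \<and> (\<forall>b. cpoly (\<lambda>x. D x b))"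
  using assms
proof induction
  case (const c)
  show ?case by (rule exI[of _ "\<lambda>x b. 0"]) (auto intro: cpoly.const)
next
  case (inner b)
  show ?case by (rule exI[of _ "\<lambda>x h. complex_of_real (h \<bullet> b)"]) (auto intro!: cpoly.const derivative_eq_intros)
next
  case (add p q)
  then obtain D E where "\<And>x. (p has_derivative D x) (at x)" "\<And>b. cpoly (\<lambda>x. D x b)"
    "\<And>x. (q has_derivative E x) (at x)" "\<And>b. cpoly (\<lambda>x. E x b)" by blast
  then show ?case
    by (intro exI[of _ "\<lambda>x h. D x h + E x h"]) (auto intro!: cpoly.add derivative_intros)
next
  case (mult p q)
  then obtain D E where "\<And>x. (p has_derivative D x) (at x)" "\<And>b. cpoly (\<lambda>x. D x b)"
    "\<And>x. (q has_derivative E x) (at x)" "\<And>b. cpoly (\<lambda>x. E x b)" by blast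
  with mult.hyps show ?case
    by (intro exI[of _ "\<lambda>x h. p x * E x h + D x h * q x"])
       (auto intro!: cpoly.add cpoly.mult derivative_intros)
qed

lemma cpoly_slowly_growing: "cpoly p \<Longrightarrow> slowly_growing p"
proof (induction rule: cpoly.induct)
  case (inner b)
  have "norm (complex_of_real (x \<bullet> b)) \<le> norm b * (1 + norm x) ^ 1" for x
    using Cauchy_Schwarz_ineq2[of x b] by (simp add: algebra_simps add_increasing)
  then show ?case by (intro slowly_growingI[of _ "norm b" 1]) (auto intro: continuous_intros)
qed (auto intro: slowly_growing_const slowly_growing_add slowly_growing_mult)

text \<open>\<open>1 + r \<le> exp r\<close> replaces the power by an exponential, and completing
  the square bounds \<open>K * r - r\<^sup>2 / 2\<close> by \<open>K\<^sup>2 / 2\<close>.\<close>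

lemma power_mult_gaussian_le:
  assumes "(r::real) \<ge> 0"
  shows "(1 + r) ^ K * exp (- r\<^sup>2 / 2) \<le> exp ((real K)\<^sup>2 / 2)"
proof -
  have "(1 + r) ^ K \<le> exp r ^ K" using assms by (intro power_mono) (auto simp: exp_ge_add_one_self)
  also have "\<dots> = exp (real K * r)" by (simp add: exp_of_nat_mult)
  finally have "(1 + r) ^ K * exp (- r\<^sup>2 / 2) \<le> exp (real K * r) * exp (- r\<^sup>2 / 2)"
    by (intro mult_right_mono) auto
  also have "\<dots> = exp (real K * r - r\<^sup>2 / 2)" by (simp add: exp_add[symmetric])
  also have "\<dots> \<le> exp ((real K)\<^sup>2 / 2)"
    using zero_le_power2[of "real K - r"] by (simp add: power2_diff)
  finally show ?thesis .
qed

text \<open>Coinduction with all products of a polynomial and \<open>E\<close> as invariant: a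
  derivative of \<open>E\<close> only brings down an affine factor. The modulation by
  \<open>y\<close> makes testing against \<open>E\<close> a Fourier transform at
  \<open>y\<close>.\<close>

lemma schwartz_gaussian:
  fixes y :: "'a::euclidean_space"
  defines "E \<equiv> \<lambda>x. complex_of_real (exp (- (norm x)\<^sup>2 / 2)) * exp (- \<i> * complex_of_real (y \<bullet> x))"
  shows "schwartz E"
proof -
  have E: "(E has_derivative (\<lambda>h. (- complex_of_real (h \<bullet> x) - \<i> * complex_of_real (y \<bullet> h)) * E x)) (at x)" for x
  proof -
    have eq: "E = (\<lambda>x. exp (- complex_of_real ((x \<bullet> x) / 2) - \<i> * complex_of_real (y \<bullet> x)))"
      by (auto simp: E_def fun_eq_iff exp_of_real[symmetric] exp_add[symmetric] power2_norm_eq_inner simp del: exp_of_real)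
    have "((\<lambda>x. - complex_of_real ((x \<bullet> x) / 2) - \<i> * complex_of_real (y \<bullet> x)) has_derivative
        (\<lambda>h. - complex_of_real (h \<bullet> x) - \<i> * complex_of_real (y \<bullet> h))) (at x)"
      by (auto intro!: derivative_eq_intros simp: fun_eq_iff inner_commute)
    from has_derivative_compose[OF this DERIV_exp[THEN has_field_derivative_imp_has_derivative]]
    show ?thesis unfolding eq by (simp only: mult.commute)
  qed
  have nE: "norm (E x) = exp (- (norm x)\<^sup>2 / 2)" for x by (simp add: E_def norm_mult)
  have "schwartz \<phi>" if "\<exists>p. cpoly p \<and> \<phi> = (\<lambda>x. p x * E x)" for \<phi>
    using that
  proof (coinduction arbitrary: \<phi>)
    case schwartz
    then obtain p where p: "cpoly p" and \<phi>: "\<phi> = (\<lambda>x. p x * E x)" by blast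
    obtain D where D: "\<And>x. (p has_derivative D x) (at x)" "\<And>b. cpoly (\<lambda>x. D x b)"
      using cpoly_has_derivative[OF p] by blast
    have d: "(\<phi> has_derivative (\<lambda>h. (D x h + p x * (- complex_of_real (x \<bullet> h) + - \<i> * complex_of_real (y \<bullet> h))) * E x)) (at x)" for x
      unfolding \<phi> using has_derivative_mult[OF D(1) E, of x]
      by (rule has_derivative_eq_rhs) (simp add: fun_eq_iff inner_commute algebra_simps)
    have fd: "frechet_derivative \<phi> (at x) b = (D x b + p x * (- complex_of_real (x \<bullet> b) + - \<i> * complex_of_real (y \<bullet> b))) * E x" for x b
      using frechet_derivative_at[OF d, of x] by (simp add: fun_eq_iff)
    have q: "cpoly (\<lambda>x. D x b + p x * (- complex_of_real (x \<bullet> b) + - \<i> * complex_of_real (y \<bullet> b)))" for b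
      using cpoly.mult[OF cpoly.const[of "-1"] cpoly.inner[of b]]
      by (intro cpoly.add cpoly.mult D p cpoly.const) auto
    show ?case
    proof (intro exI conjI allI ballI disjI1)
      show "\<phi> differentiable at x" for x using d[of x] by (auto simp: differentiable_def)
      show "cpoly (\<lambda>x. D x b + p x * (- complex_of_real (x \<bullet> b) + - \<i> * complex_of_real (y \<bullet> b)))" for b by (rule q)
      show "(\<lambda>x. frechet_derivative \<phi> (at x) b) = (\<lambda>x. (D x b + p x * (- complex_of_real (x \<bullet> b) + - \<i> * complex_of_real (y \<bullet> b))) * E x)" for b
        using fd by auto
      fix N
      obtain C n where C: "C \<ge> 0" "\<And>x. norm (p x) \<le> C * (1 + norm x) ^ n" using cpoly_slowly_growing[OF p] unfolding slowly_growing_def by blast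
      have "norm ((1 + norm x) ^ N *\<^sub>R \<phi> x) \<le> C * exp ((real (n + N))\<^sup>2 / 2)" for x
      proof -
        have "norm ((1 + norm x) ^ N *\<^sub>R \<phi> x) = norm (p x) * ((1 + norm x) ^ N * exp (- (norm x)\<^sup>2 / 2))"
          by (simp add: \<phi> norm_mult nE)
        also have "\<dots> \<le> C * (1 + norm x) ^ n * ((1 + norm x) ^ N * exp (- (norm x)\<^sup>2 / 2))"
          by (intro mult_right_mono C) auto
        also have "\<dots> = C * ((1 + norm x) ^ (n + N) * exp (- (norm x)\<^sup>2 / 2))"
          by (simp add: power_add)
        also have "\<dots> \<le> C * exp ((real (n + N))\<^sup>2 / 2)"
          by (intro mult_left_mono power_mult_gaussian_le C) auto
        finally show ?thesis .
      qed
      then show "bounded (range (\<lambda>x. (1 + norm x) ^ N *\<^sub>R \<phi> x))"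
        by (auto simp: bounded_iff)
    qed auto
  qed
  moreover have "\<exists>p. cpoly p \<and> E = (\<lambda>x. p x * E x)"
    by (rule exI[of _ "\<lambda>x. 1"]) (auto intro: cpoly.const)
  ultimately show ?thesis by blast
qed

text \<open>Testing against modulated Gaussians says that \<open>G\<close> times a Gaussian, an
  integrable function, has zero Fourier transform. So \<open>G\<close> vanishes almost everywhere,
  and everywhere by continuity.\<close>

theorem schwartz_separating:
  fixes G :: "'a::euclidean_space \<Rightarrow> complex"
  assumes G: "slowly_growing G"
    and zero: "\<And>\<eta>. schwartz \<eta> \<Longrightarrow> (LINT x|lborel. G x * \<eta> x) = 0"
  shows "G x = 0"
proof -
  define g where "g x = G x * complex_of_real (exp (- (norm x)\<^sup>2 / 2))" for x
  have "integrable lborel g"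
    using slowly_growing_integrable[OF G schwartz_gaussian[of 0]] by (simp add: g_def[abs_def])
  moreover have "fourier g y = 0" for y
  proof -
    have "fourier g y = (LINT x|lborel. G x * (complex_of_real (exp (- (norm x)\<^sup>2 / 2)) * exp (- \<i> * complex_of_real (y \<bullet> x))))"
      unfolding fourier_def g_def by (rule Bochner_Integration.integral_cong) (simp_all only: mult_ac)
    then show ?thesis using zero[OF schwartz_gaussian[of y]] by (simp only:)
  qed
  ultimately have "AE x in lborel. g x = 0" by (intro fourier_zero_imp_AE_zero)
  then have "AE x in lborel. G x = 0" by eventually_elim (simp add: g_def)
  moreover have "continuous_on UNIV G" using G by (simp add: slowly_growing_def)
  ultimately show ?thesis by (intro continuous_AE_eq_imp_eq[where g=G and h="\<lambda>_. 0"]) auto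
qed

corollary schwartz_separating_eq:
  assumes G: "slowly_growing G" and H: "slowly_growing H"
    and eq: "\<And>\<eta>. schwartz \<eta> \<Longrightarrow> (LINT x|lborel. G x * \<eta> x) = (LINT x|lborel. H x * \<eta> x)"
  shows "G x = H x"
proof -
  have "G x + (- 1) * H x = 0"
  proof (rule schwartz_separating[of "\<lambda>x. G x + (- 1) * H x"])
    show "slowly_growing (\<lambda>x. G x + (- 1) * H x)"
      by (intro slowly_growing_add slowly_growing_mult slowly_growing_const G H)
    fix \<eta> :: "'a \<Rightarrow> complex" assume \<eta>: "schwartz \<eta>"
    have "(LINT x|lborel. (G x + (- 1) * H x) * \<eta> x) = (LINT x|lborel. G x * \<eta> x - H x * \<eta> x)"
      by (simp add: algebra_simps)
    also have "\<dots> = 0"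
      using slowly_growing_integrable[OF G \<eta>] slowly_growing_integrable[OF H \<eta>] eq[OF \<eta>] by simp
    finally show "(LINT x|lborel. (G x + (- 1) * H x) * \<eta> x) = 0" .
  qed
  then show ?thesis by simp
qed

section \<open>The law of iterated Brownian motion\<close>

text \<open>Variance \<open>2 * t\<close> is the normalization with the second derivative as
  generator; it makes the Fourier transform \<open>exp (- t * \<xi>\<^sup>2)\<close>.\<close>

abbreviation heat_kernel :: "real \<Rightarrow> real \<Rightarrow> real" where
  "heat_kernel t \<equiv> normal_density 0 (sqrt (2 * t))"

lemma heat_kernel_scaled:
  assumes "t > 0"
  shows "sqrt (2 * t) * heat_kernel t (sqrt (2 * t) * y) = std_normal_density y"
proof -
  have "2 * (sqrt 2)\<^sup>2 * t * y\<^sup>2 / (4 * t) = y\<^sup>2" using assms by simp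
  then show ?thesis
    using assms by (simp add: normal_density_def real_sqrt_mult power_mult_distrib divide_simps)
qed

text \<open>Two forms of one average. On the right the weight is free of t and the formula stays
  meaningful at \<open>t = 0\<close>, which serves for continuity; on the left only the weight
  depends on t, which serves for Laplace transforms and derivatives.\<close>

lemma heat_kernel_integral:
  fixes h :: "real \<Rightarrow> 'b::{banach, second_countable_topology}"
  assumes t: "t > 0" and [measurable]: "h \<in> borel_measurable borel"
  shows "(LINT r|lborel. heat_kernel t r *\<^sub>R h r) = (LINT y|lborel. std_normal_density y *\<^sub>R h (sqrt (2 * t) * y))"
proof -
  have "(LINT r|lborel. heat_kernel t r *\<^sub>R h r)
      = sqrt (2 * t) *\<^sub>R (LINT y|lborel. heat_kernel t (sqrt (2 * t) * y) *\<^sub>R h (sqrt (2 * t) * y))"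
    by (subst lborel_integral_affine[of _ "sqrt (2 * t)" 0]) (use t in auto)
  also have "\<dots> = (LINT y|lborel. sqrt (2 * t) *\<^sub>R (heat_kernel t (sqrt (2 * t) * y) *\<^sub>R h (sqrt (2 * t) * y)))"
    by (rule integral_scaleR_right[symmetric])
  finally show ?thesis unfolding scaleR_scaleR heat_kernel_scaled[OF t] .
qed

lemma fourier_heat_kernel:
  assumes t: "t > 0"
  shows "fourier (\<lambda>r. complex_of_real (heat_kernel t r)) \<xi> = complex_of_real (exp (- t * \<xi>\<^sup>2))"
proof -
  have "fourier (\<lambda>r. complex_of_real (heat_kernel t r)) \<xi> = (LINT r|lborel. heat_kernel t r *\<^sub>R exp (- \<i> * complex_of_real (\<xi> * r)))"
    unfolding fourier_def by (simp add: scaleR_conv_of_real mult.commute)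
  also have "\<dots> = (LINT y|lborel. std_normal_density y *\<^sub>R exp (- \<i> * complex_of_real (\<xi> * (sqrt (2 * t) * y))))"
    by (rule heat_kernel_integral[OF t]) measurable
  also have "\<dots> = char std_normal_distribution (- \<xi> * sqrt (2 * t))"
    unfolding char_def by (subst integral_density) (auto simp: normal_density_nonneg mult_ac)
  also have "\<dots> = complex_of_real (exp (- ((- \<xi> * sqrt (2 * t))\<^sup>2 / 2)))"
    by (simp add: char_std_normal_distribution)
  also have "(- \<xi> * sqrt (2 * t))\<^sup>2 / 2 = t * \<xi>\<^sup>2"
    using t by (simp add: power_mult_distrib)
  finally show ?thesis by simp
qed

lemma integral_even:
  fixes h :: "real \<Rightarrow> 'b::{banach, second_countable_topology}"
  assumes h: "set_integrable lborel {0..} h"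
  shows "integrable lborel (\<lambda>r. h \<bar>r\<bar>)" and "(LINT r|lborel. h \<bar>r\<bar>) = 2 *\<^sub>R (LINT r:{0..}|lborel. h r)"
proof -
  let ?h = "\<lambda>r. indicator {0..} r *\<^sub>R h r"
  have i: "integrable lborel ?h" using h by (simp add: set_integrable_def)
  note [measurable] = i[THEN borel_measurable_integrable]
  have i': "integrable lborel (\<lambda>r. ?h (- r))"
    using lborel_integrable_real_affine[OF i, of "-1" 0] by simp
  have AE0: "AE r in lborel. r \<noteq> (0::real)" by (rule AE_lborel_singleton)
  \<comment> \<open>At \<open>r = 0\<close> both halves would count \<open>h 0\<close>, so the
    splitting holds off this null point.\<close>
  have eq: "h \<bar>r\<bar> = ?h r + ?h (- r)" if "r \<noteq> 0" for r using that by (auto simp: indicator_def)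
  have eqm: "h \<bar>r\<bar> = (if r = 0 then h 0 else ?h r + ?h (- r))" for r using eq by auto
  have [measurable]: "(\<lambda>r. h \<bar>r\<bar>) \<in> borel_measurable borel"
    unfolding eqm by measurable
  have AE: "AE r in lborel. ?h r + ?h (- r) = h \<bar>r\<bar>" using AE0 by eventually_elim (use eq in auto)
  have s: "integrable lborel (\<lambda>r. ?h r + ?h (- r))" using i i' by simp
  show "integrable lborel (\<lambda>r. h \<bar>r\<bar>)"
    using integrable_cong_AE_imp[OF s _ AE] by simp
  have "(LINT r|lborel. h \<bar>r\<bar>) = (LINT r|lborel. ?h r + ?h (- r))"
    by (rule integral_cong_AE) (use AE in auto)
  also have "\<dots> = (LINT r|lborel. ?h r) + (LINT r|lborel. ?h (- r))" using i i' by simp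
  also have "(LINT r|lborel. ?h (- r)) = (LINT r|lborel. ?h r)"
    by (subst (2) lborel_integral_affine[of _ "-1" 0]) auto
  finally show "(LINT r|lborel. h \<bar>r\<bar>) = 2 *\<^sub>R (LINT r:{0..}|lborel. h r)"
    by (simp add: set_lebesgue_integral_def scaleR_2)
qed

lemma set_integrable_laplace_bounded:
  fixes g :: "real \<Rightarrow> 'b::{banach, second_countable_topology}"
  assumes g: "continuous_on {0..} g" and B: "\<And>t. t \<ge> 0 \<Longrightarrow> norm (g t) \<le> B" and s: "s > 0"
  shows "set_integrable lborel {0..} (\<lambda>t. exp (- s * t) *\<^sub>R g t)"
  unfolding set_integrable_def
proof (rule Bochner_Integration.integrable_bound)
  show "integrable lborel (\<lambda>t. (indicator {0..} t *\<^sub>R exp (- s * t)) * B)"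
    using integrable_exp_Ici[OF s] unfolding set_integrable_def by (rule integrable_mult_left)
  show "(\<lambda>t. indicator {0..} t *\<^sub>R exp (- s * t) *\<^sub>R g t) \<in> borel_measurable lborel"
    using borel_measurable_continuous_on_indicator[of "{0..}" "\<lambda>t. exp (- s * t) *\<^sub>R g t"]
      continuous_on_scaleR[OF continuous_on_exp[OF continuous_on_mult_left[OF continuous_on_id, of "{0..}" "- s"]] g]
    by (simp del: scaleR_scaleR)
  show "AE t in lborel. norm (indicator {0..} t *\<^sub>R exp (- s * t) *\<^sub>R g t) \<le> norm ((indicator {0..} t *\<^sub>R exp (- s * t)) * B)"
    using B by (intro AE_I2) (auto simp: indicator_def intro: order.trans[OF _ abs_ge_self])
qed

text \<open>Fourier transforms in \<open>r\<close>: both sides become \<open>1 / (s + \<xi>\<^sup>2)\<close>.\<close>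

lemma
  fixes s :: real
  assumes s: "s > 0"
  shows integrable_heat_kernel_laplace:
      "integrable (lborel \<Otimes>\<^sub>M lborel) (\<lambda>(t, r). complex_of_real (indicator {0<..} t * exp (- s * t) * heat_kernel t r))"
    and laplace_heat_kernel:
      "AE r in lborel. (LINT t|lborel. complex_of_real (indicator {0<..} t * exp (- s * t) * heat_kernel t r))
        = complex_of_real (exp (- sqrt s * \<bar>r\<bar>) / (2 * sqrt s))"
proof -
  let ?F = "\<lambda>t r. complex_of_real (indicator {0<..} t * exp (- s * t) * heat_kernel t r)"
  have F0: "norm (?F t r) = indicator {0<..} t * exp (- s * t) * heat_kernel t r" for t r
    unfolding norm_of_real by (simp add: abs_mult normal_density_nonneg)
  show int: "integrable (lborel \<Otimes>\<^sub>M lborel) (\<lambda>(t, r). ?F t r)"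
  proof (rule integrable_pair_bound)
    show "integrable lborel (\<lambda>t. indicator {0..} t *\<^sub>R exp (- s * t))"
      using integrable_exp_Ici[OF s] by (simp add: set_integrable_def)
    show "(\<lambda>(t, r). ?F t r) \<in> borel_measurable (lborel \<Otimes>\<^sub>M lborel)"
      unfolding normal_density_def by measurable
    fix t :: real
    show "integrable lborel (\<lambda>x. case (t, x) of (t, r) \<Rightarrow> ?F t r)"
      by (cases "t > 0") (auto simp del: of_real_mult intro!: integrable_of_real)
    show "(LINT x|lborel. norm (case (t, x) of (t, r) \<Rightarrow> ?F t r)) \<le> indicator {0..} t *\<^sub>R exp (- s * t)"
      unfolding prod.case F0 by (cases "t > 0") (auto simp: indicator_def)
  qed (auto intro: lborel.sigma_finite_measure_axioms)
  define a where "a = sqrt s"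
  have a: "a > 0" and a2: "a\<^sup>2 = s" using s by (auto simp: a_def)
  let ?e = "\<lambda>r::real. complex_of_real (exp (- a * \<bar>r\<bar>) / (2 * a))"
  have ie: "set_integrable lborel {0..} (\<lambda>r. exp (- a * r) / (2 * a))"
    using integrable_exp_Ici[OF a] by (simp add: set_integrable_def)
  have int_e: "integrable lborel ?e"
    using integral_even(1)[OF ie] by (intro integrable_of_real)
  have fF: "fourier (\<lambda>r. LINT t|lborel. ?F t r) \<xi> = complex_of_real (1 / (s + \<xi>\<^sup>2))" for \<xi>
  proof -
    have pos: "s + \<xi>\<^sup>2 > 0" using s by (simp add: add_pos_nonneg)
    have "fourier (\<lambda>r. LINT t|lborel. ?F t r) \<xi> = (LINT t|lborel. fourier (?F t) \<xi>)"
      by (rule fourier_mixture[OF lborel.sigma_finite_measure_axioms int])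
    \<comment> \<open>Weighting \<open>exp (- t * \<xi>\<^sup>2)\<close> with
      \<open>exp (- s * t)\<close> leaves an elementary exponential; the integrands are compared off
      \<open>t = 0\<close>, where the kernel degenerates.\<close>
    also have "\<dots> = (LINT t|lborel. indicator {0..} t *\<^sub>R exp (- complex_of_real (s + \<xi>\<^sup>2) * complex_of_real t))"
    proof (rule integral_cong_AE)
      show "(\<lambda>t. fourier (?F t) \<xi>) \<in> borel_measurable lborel"
        unfolding fourier_def normal_density_def by measurable
      show "AE t in lborel. fourier (?F t) \<xi> = indicator {0..} t *\<^sub>R exp (- complex_of_real (s + \<xi>\<^sup>2) * complex_of_real t)"
        using AE_lborel_singleton[of "0::real"]
      proof eventually_elim
        case (elim t)
        show ?case
        proof (cases "t > 0")
          case True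
          have "fourier (?F t) \<xi> = fourier (\<lambda>r. complex_of_real (exp (- s * t)) * complex_of_real (heat_kernel t r)) \<xi>"
            using True by simp
          also have "\<dots> = complex_of_real (exp (- s * t)) * complex_of_real (exp (- t * \<xi>\<^sup>2))"
            by (simp only: fourier_cmult fourier_heat_kernel[OF True])
          also have "\<dots> = exp (- complex_of_real (s + \<xi>\<^sup>2) * complex_of_real t)"
            by (simp add: exp_of_real[symmetric] exp_add[symmetric] algebra_simps del: exp_of_real)
          finally show ?thesis using True by simp
        next
          case False
          then show ?thesis using elim by (simp add: fourier_def)
        qed
      qed
    qed measurable
    also have "\<dots> = 1 / complex_of_real (s + \<xi>\<^sup>2)"
      using integral_cexp_Ici[of "complex_of_real (s + \<xi>\<^sup>2)"] pos by (simp add: set_lebesgue_integral_def)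
    finally show ?thesis by simp
  qed
  have fe: "fourier ?e \<xi> = complex_of_real (1 / (s + \<xi>\<^sup>2))" for \<xi>
  proof -
    \<comment> \<open>The two-sided exponential is cut at 0 into two half-line exponentials, with
      \<open>c\<close> as the sign of the frequency; their integrals add up to
      \<open>2 * a / (a\<^sup>2 + \<xi>\<^sup>2)\<close>.\<close>
    let ?E = "\<lambda>c r. indicator {0..} r *\<^sub>R exp (- (complex_of_real a + c * \<i> * \<xi>) * complex_of_real r)"
    have iE: "integrable lborel (?E c)" "(LINT r|lborel. ?E c r) = 1 / (complex_of_real a + c * \<i> * \<xi>)" if "c \<in> {1, -1}" for c
      using set_integrable_cexp_Ici[of "complex_of_real a + c * \<i> * \<xi>"] integral_cexp_Ici[of "complex_of_real a + c * \<i> * \<xi>"] a that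
      by (auto simp: set_integrable_def set_lebesgue_integral_def)
    have [measurable]: "?E c \<in> borel_measurable borel" for c by measurable
    have iE': "integrable lborel (\<lambda>r. ?E (-1) (- r))"
      using lborel_integrable_real_affine[OF iE(1)[of "-1"], of "-1" 0] by simp
    have "fourier ?e \<xi> = (LINT r|lborel. (1 / (2 * complex_of_real a)) * (?E 1 r + ?E (-1) (- r)))"
      unfolding fourier_def
    proof (rule integral_cong_AE)
      show "AE r in lborel. exp (- \<i> * complex_of_real (\<xi> \<bullet> r)) * ?e r = (1 / (2 * complex_of_real a)) * (?E 1 r + ?E (-1) (- r))"
        using AE_lborel_singleton[of "0::real"]
      proof eventually_elim
        case (elim r)
        have "exp (- \<i> * complex_of_real (\<xi> \<bullet> r)) * complex_of_real (exp (- a * \<bar>r\<bar>)) = exp (- \<i> * complex_of_real (\<xi> * r) - a * \<bar>r\<bar>)"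
          unfolding exp_of_real[symmetric] exp_add[symmetric] by (rule arg_cong[where f=exp]) simp
        also have "\<dots> = ?E 1 r + ?E (-1) (- r)"
          using elim by (cases "r > 0") (auto intro!: arg_cong[where f=exp] simp: algebra_simps)
        finally show ?case by simp
      qed
    qed measurable
    also have "\<dots> = (1 / (2 * complex_of_real a)) * ((LINT r|lborel. ?E 1 r) + (LINT r|lborel. ?E (-1) (- r)))"
      using iE(1)[of 1] iE' by (subst integral_mult_right_zero, subst Bochner_Integration.integral_add) auto
    also have "(LINT r|lborel. ?E (-1) (- r)) = (LINT r|lborel. ?E (-1) r)"
      by (subst (2) lborel_integral_affine[of _ "-1" 0]) auto
    also have "(1 / (2 * complex_of_real a)) * ((LINT r|lborel. ?E 1 r) + (LINT r|lborel. ?E (-1) r))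
        = (1 / (2 * complex_of_real a)) * (1 / (complex_of_real a + \<i> * \<xi>) + 1 / (complex_of_real a - \<i> * \<xi>))"
      by (subst (1 2) iE(2)) auto
    also have "\<dots> = complex_of_real (1 / (s + \<xi>\<^sup>2))"
    proof -
      have nz: "complex_of_real a + \<i> * \<xi> \<noteq> 0" "complex_of_real a - \<i> * \<xi> \<noteq> 0"
        using a by (auto simp: complex_eq_iff)
      have "complex_of_real (s + \<xi>\<^sup>2) = (complex_of_real a + \<i> * \<xi>) * (complex_of_real a - \<i> * \<xi>)"
        by (simp add: a2[symmetric] power2_eq_square algebra_simps)
      then show ?thesis using nz a by (simp add: divide_simps)
    qed
    finally show ?thesis .
  qed
  have "AE r in lborel. (LINT t|lborel. ?F t r) = ?e r"
    by (rule fourier_eq_imp_AE_eq[OF integrable_mixture[OF lborel.sigma_finite_measure_axioms int] int_e])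
       (simp only: fF fe)
  then show "AE r in lborel. (LINT t|lborel. ?F t r) = complex_of_real (exp (- sqrt s * \<bar>r\<bar>) / (2 * sqrt s))"
    by (simp only: a_def)
qed

text \<open>\<open>iterated_exp k z t\<close> is the mean of \<open>exp (z * \<bar>I\<^sub>k(t)\<bar>)\<close>.\<close>

fun iterated_exp :: "nat \<Rightarrow> complex \<Rightarrow> real \<Rightarrow> complex" where
  "iterated_exp 0 z t = exp (complex_of_real t * z)"
| "iterated_exp (Suc k) z t = (LINT y|lborel. std_normal_density y *\<^sub>R iterated_exp k z (sqrt (2 * t) * \<bar>y\<bar>))"

lemma continuous_on_half_line_abs:
  "continuous_on {0..} g \<Longrightarrow> c \<ge> 0 \<Longrightarrow> continuous_on UNIV (\<lambda>y::real. g (c * \<bar>y\<bar>))"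
  by (erule continuous_on_compose2) (auto intro!: continuous_intros)

lemma borel_measurable_half_line_abs:
  fixes g :: "real \<Rightarrow> 'b::{second_countable_topology, real_normed_vector}"
  shows "continuous_on {0..} g \<Longrightarrow> c \<ge> 0 \<Longrightarrow> (\<lambda>y. g (c * \<bar>y\<bar>)) \<in> borel_measurable borel"
  by (intro borel_measurable_continuous_onI continuous_on_half_line_abs)

text \<open>Both claims go through the induction together: for the next layer the bound gives the
  majorant \<open>std_normal_density\<close>, and the continuity gives measurability and the
  pointwise limit.\<close>

lemma
  assumes z: "Re z \<le> 0"
  shows continuous_on_iterated_exp: "continuous_on {0..} (iterated_exp k z)"
    and norm_iterated_exp_le: "t \<ge> 0 \<Longrightarrow> norm (iterated_exp k z t) \<le> 1"
proof -
  have "continuous_on {0..} (iterated_exp k z) \<and> (\<forall>t\<ge>0. norm (iterated_exp k z t) \<le> 1)"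
  proof (induction k)
    case 0
    show ?case using z by (auto intro!: continuous_intros simp: norm_exp_eq_Re mult_nonneg_nonpos)
  next
    case (Suc k)
    then have c: "continuous_on {0..} (iterated_exp k z)" and b: "\<And>t. t \<ge> 0 \<Longrightarrow> norm (iterated_exp k z t) \<le> 1" by auto
    have [measurable]: "(\<lambda>y. iterated_exp k z (sqrt (2 * t) * \<bar>y\<bar>)) \<in> borel_measurable borel" if "t \<ge> 0" for t
      using borel_measurable_half_line_abs[OF c] that by simp
    have bd: "norm (std_normal_density y *\<^sub>R iterated_exp k z (sqrt (2 * t) * \<bar>y\<bar>)) \<le> std_normal_density y" if "t \<ge> 0" for t y
      using b[of "sqrt (2 * t) * \<bar>y\<bar>"] that by (simp add: mult_left_le)
    have "continuous_on {0..} (iterated_exp (Suc k) z)"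
      unfolding continuous_on_sequentially
    proof (intro allI ballI impI)
      fix x :: "nat \<Rightarrow> real" and t assume t: "t \<in> {0..}" and x: "(\<forall>n. x n \<in> {0..}) \<and> x \<longlonglongrightarrow> t"
      have "(\<lambda>n. LINT y|lborel. std_normal_density y *\<^sub>R iterated_exp k z (sqrt (2 * x n) * \<bar>y\<bar>))
          \<longlonglongrightarrow> (LINT y|lborel. std_normal_density y *\<^sub>R iterated_exp k z (sqrt (2 * t) * \<bar>y\<bar>))"
      proof (rule integral_dominated_convergence[where w=std_normal_density])
        show "AE y in lborel. (\<lambda>n. std_normal_density y *\<^sub>R iterated_exp k z (sqrt (2 * x n) * \<bar>y\<bar>))
          \<longlonglongrightarrow> std_normal_density y *\<^sub>R iterated_exp k z (sqrt (2 * t) * \<bar>y\<bar>)"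
          using t x by (intro AE_I2 tendsto_scaleR tendsto_const continuous_on_tendsto_compose[OF c])
            (auto intro!: tendsto_intros)
      qed (use t x bd in auto)
      then show "(iterated_exp (Suc k) z \<circ> x) \<longlonglongrightarrow> iterated_exp (Suc k) z t" by (simp add: comp_def)
    qed
    moreover have "norm (iterated_exp (Suc k) z t) \<le> 1" if t: "t \<ge> 0" for t
    proof -
      have "norm (iterated_exp (Suc k) z t) \<le> (LINT y|lborel. norm (std_normal_density y *\<^sub>R iterated_exp k z (sqrt (2 * t) * \<bar>y\<bar>)))"
        by (simp add: integral_norm_bound del: norm_scaleR)
      also have "\<dots> \<le> (LINT y|lborel. std_normal_density y)"
        by (intro integral_mono Bochner_Integration.integrable_bound[OF integrable_normal_density[of 1 0]]) (use bd t in \<open>auto simp del: norm_scaleR intro: order.trans[OF _ abs_ge_self]\<close>)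
      finally show ?thesis by simp
    qed
    ultimately show ?case by blast
  qed
  then show "continuous_on {0..} (iterated_exp k z)" "t \<ge> 0 \<Longrightarrow> norm (iterated_exp k z t) \<le> 1" by auto
qed

lemma iterated_exp_0 [simp]: "iterated_exp k z 0 = 1"
  by (induction k) auto

lemma iterated_exp_Suc_heat:
  assumes z: "Re z \<le> 0" and t: "t > 0"
  shows "iterated_exp (Suc k) z t = (LINT r|lborel. heat_kernel t r *\<^sub>R iterated_exp k z \<bar>r\<bar>)"
proof -
  have "(\<lambda>r. iterated_exp k z \<bar>r\<bar>) \<in> borel_measurable borel"
    using borel_measurable_half_line_abs[OF continuous_on_iterated_exp[OF z], of 1] by simp
  from heat_kernel_integral[OF t this] show ?thesis using t by (simp add: abs_mult)
qed

lemma set_integrable_laplace_iterated_exp: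
  "Re z \<le> 0 \<Longrightarrow> s > 0 \<Longrightarrow> set_integrable lborel {0..} (\<lambda>t. exp (- s * t) *\<^sub>R iterated_exp k z t)"
  by (rule set_integrable_laplace_bounded[OF continuous_on_iterated_exp norm_iterated_exp_le])

text \<open>The Laplace transform in t of the heat kernel is
  \<open>exp (- sqrt s * \<bar>r\<bar>) / (2 * sqrt s)\<close>. Hence the transform at level
  \<open>Suc k\<close> is that at level \<open>k\<close>, evaluated at \<open>sqrt s\<close> and
  divided by \<open>sqrt s\<close>; starting from \<open>1 / (s - z)\<close>, these divisors
  accumulate to the numerator.\<close>

theorem laplace_iterated_exp:
  assumes z: "Re z \<le> 0" and s: "s > 0"
  shows "laplace (iterated_exp k z) s
    = complex_of_real (s powr (1 / 2 ^ k - 1)) / (complex_of_real (s powr (1 / 2 ^ k)) - z)"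
  using s
proof (induction k arbitrary: s)
  case 0
  have "laplace (iterated_exp 0 z) s = (LINT t:{0..}|lborel. exp (- (complex_of_real s - z) * complex_of_real t))"
    unfolding laplace_def
    by (rule set_lebesgue_integral_cong) (auto simp: scaleR_conv_of_real exp_of_real[symmetric] exp_add[symmetric] algebra_simps simp del: exp_of_real)
  also have "\<dots> = 1 / (complex_of_real s - z)"
    by (rule integral_cexp_Ici) (use z 0 in auto)
  finally show ?case using 0 by (simp del: iterated_exp.simps)
next
  case (Suc k)
  note s = \<open>s > 0\<close>
  let ?g = "iterated_exp k z"
  let ?F = "\<lambda>t r. complex_of_real (indicator {0<..} t * exp (- s * t) * heat_kernel t r)"
  have g: "continuous_on {0..} ?g" and b: "\<And>t. t \<ge> 0 \<Longrightarrow> norm (?g t) \<le> 1"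
    using continuous_on_iterated_exp[OF z] norm_iterated_exp_le[OF z] by auto
  have [measurable]: "(\<lambda>r. ?g \<bar>r\<bar>) \<in> borel_measurable borel"
    using borel_measurable_half_line_abs[OF g, of 1] by simp
  have mF[measurable]: "(\<lambda>(t, r). ?F t r) \<in> borel_measurable (lborel \<Otimes>\<^sub>M lborel)"
    using integrable_heat_kernel_laplace[OF s] by (rule borel_measurable_integrable)
  have "norm (?F t r * ?g \<bar>r\<bar>) \<le> norm (?F t r)" for t r
    unfolding norm_mult[of "?F t r"] by (rule mult_left_le[OF b]) auto
  then have le: "norm (?F t r * ?g \<bar>r\<bar>) \<le> norm (?F t r)" for t r by blast
  have int: "integrable (lborel \<Otimes>\<^sub>M lborel) (\<lambda>(t, r). ?F t r * ?g \<bar>r\<bar>)"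
  proof (rule Bochner_Integration.integrable_bound[OF integrable_heat_kernel_laplace[OF s]])
    show "(\<lambda>(t, r). ?F t r * ?g \<bar>r\<bar>) \<in> borel_measurable (lborel \<Otimes>\<^sub>M lborel)"
      unfolding normal_density_def by measurable
  qed (use le in \<open>auto simp: split_beta' simp del: of_real_mult\<close>)
  have "laplace (iterated_exp (Suc k) z) s = (LINT t|lborel. (LINT r|lborel. ?F t r * ?g \<bar>r\<bar>))"
    unfolding laplace_def set_lebesgue_integral_def
  proof (rule integral_cong_AE)
    show "AE t in lborel. indicator {0..} t *\<^sub>R exp (- s * t) *\<^sub>R iterated_exp (Suc k) z t = (LINT r|lborel. ?F t r * ?g \<bar>r\<bar>)"
      using AE_lborel_singleton[of "0::real"]
    proof eventually_elim
      case (elim t)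
      show ?case
      proof (cases "t > 0")
        case True
        have "(LINT r|lborel. ?F t r * ?g \<bar>r\<bar>) = (LINT r|lborel. exp (- s * t) *\<^sub>R (heat_kernel t r *\<^sub>R ?g \<bar>r\<bar>))"
          using True by (simp add: scaleR_conv_of_real mult.assoc)
        also have "\<dots> = exp (- s * t) *\<^sub>R iterated_exp (Suc k) z t"
          unfolding iterated_exp_Suc_heat[OF z True] by (rule integral_scaleR_right)
        finally show ?thesis using True by simp
      next
        case False
        then show ?thesis using elim by simp
      qed
    qed
    show "(\<lambda>t. indicator {0..} t *\<^sub>R exp (- s * t) *\<^sub>R iterated_exp (Suc k) z t) \<in> borel_measurable lborel"
      using set_integrable_laplace_iterated_exp[OF z s, of "Suc k"] unfolding set_integrable_def by (rule borel_measurable_integrable)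
    show "(\<lambda>t. LINT r|lborel. ?F t r * ?g \<bar>r\<bar>) \<in> borel_measurable lborel"
      by (rule borel_measurable_integrable[OF lborel_pair.integrable_fst[OF int]])
  qed
  also have "\<dots> = (LINT r|lborel. (LINT t|lborel. ?F t r * ?g \<bar>r\<bar>))"
    by (rule lborel_pair.Fubini_integral[OF int, symmetric])
  also have "\<dots> = (LINT r|lborel. (LINT t|lborel. ?F t r) * ?g \<bar>r\<bar>)"
    by (simp del: of_real_mult)
  also have "\<dots> = (LINT r|lborel. complex_of_real (exp (- sqrt s * \<bar>r\<bar>) / (2 * sqrt s)) * ?g \<bar>r\<bar>)"
  proof (rule integral_cong_AE)
    show "AE r in lborel. (LINT t|lborel. ?F t r) * ?g \<bar>r\<bar> = complex_of_real (exp (- sqrt s * \<bar>r\<bar>) / (2 * sqrt s)) * ?g \<bar>r\<bar>"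
      using laplace_heat_kernel[OF s] by eventually_elim (simp only:)
    have "(\<lambda>r. LINT t|lborel. ?F t r) \<in> borel_measurable lborel"
      by (rule borel_measurable_integrable[OF lborel_pair.integrable_snd[OF integrable_heat_kernel_laplace[OF s]]])
    then show "(\<lambda>r. (LINT t|lborel. ?F t r) * ?g \<bar>r\<bar>) \<in> borel_measurable lborel" by measurable
  qed measurable
  also have "\<dots> = (LINT r|lborel. (1 / (2 * sqrt s)) *\<^sub>R (exp (- sqrt s * \<bar>r\<bar>) *\<^sub>R ?g \<bar>r\<bar>))"
    by (simp add: scaleR_conv_of_real)
  \<comment> \<open>Folding the even integral onto the half line gives a factor 2, which cancels the
    2 in \<open>1 / (2 * sqrt s)\<close>.\<close>
  also have "\<dots> = (1 / sqrt s) *\<^sub>R laplace ?g (sqrt s)"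
    unfolding integral_scaleR_right laplace_def
    using integral_even(2)[OF set_integrable_laplace_iterated_exp[OF z, of "sqrt s" k]] s by simp
  also have "laplace ?g (sqrt s) = complex_of_real (sqrt s powr (1 / 2 ^ k - 1)) / (complex_of_real (sqrt s powr (1 / 2 ^ k)) - z)"
    by (rule Suc.IH) (use s in auto)
  also have "sqrt s powr (1 / 2 ^ k) = s powr (1 / 2 ^ Suc k)"
    using s by (simp add: powr_half_sqrt[symmetric] powr_powr)
  also have "sqrt s powr (1 / 2 ^ k - 1) = sqrt s * s powr (1 / 2 ^ Suc k - 1)"
    using s by (simp add: powr_half_sqrt[symmetric] powr_powr powr_add[symmetric] algebra_simps)
  finally show ?case using s by (simp add: scaleR_conv_of_real)
qed

section \<open>Laplace transforms of powers and antiderivatives, and the expansion in powers of the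
  symbol\<close>

lemma
  fixes f :: "'i \<Rightarrow> 'b \<Rightarrow> 'c::{banach, second_countable_topology}"
  assumes "\<And>i. i \<in> I \<Longrightarrow> set_integrable M A (f i)"
  shows set_integrable_sum: "set_integrable M A (\<lambda>x. \<Sum>i\<in>I. f i x)"
    and set_lebesgue_integral_sum: "(LINT x:A|M. (\<Sum>i\<in>I. f i x)) = (\<Sum>i\<in>I. LINT x:A|M. f i x)"
  using assms unfolding set_integrable_def set_lebesgue_integral_def scaleR_sum_right
  by (auto intro: Bochner_Integration.integral_sum)

text \<open>Euler's integral for Gamma after the substitution of \<open>s * t\<close> for t, carried
  out with nonnegative integrals so that integrability and value come out together.\<close>

lemma
  fixes a s :: real
  assumes a: "a > 0" and s: "s > 0"
  shows set_integrable_laplace_powr: "set_integrable lborel {0..} (\<lambda>t. exp (- s * t) *\<^sub>R complex_of_real (t powr a))"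
    and laplace_powr: "laplace (\<lambda>t. complex_of_real (t powr a)) s = complex_of_real (Gamma (a + 1) / s powr (a + 1))"
proof -
  let ?h = "\<lambda>t. indicator {0..} t * t powr a / exp t"
  let ?k = "\<lambda>t. indicator {0..} t * (exp (- s * t) * t powr a)"
  have G: "(\<integral>\<^sup>+t. ennreal (?h t) \<partial>lborel) = ennreal (Gamma (a + 1))"
    using Gamma_conv_nn_integral_real[of "a + 1"] a by simp
  have h: "?h (s * t) = s powr a * ?k t" for t
  proof (cases "t \<ge> 0")
    case True
    then show ?thesis using s by (simp add: powr_mult exp_minus divide_inverse)
  next
    case False
    then have "s * t < 0" using s by (simp add: mult_pos_neg)
    then show ?thesis using False by simp
  qed
  have "ennreal (Gamma (a + 1)) = ennreal s * (\<integral>\<^sup>+t. ennreal (?h (s * t)) \<partial>lborel)"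
    unfolding G[symmetric] by (subst nn_integral_real_affine[of _ s 0]) (use s in auto)
  also have "\<dots> = ennreal s * (ennreal (s powr a) * (\<integral>\<^sup>+t. ennreal (?k t) \<partial>lborel))"
    unfolding h by (subst ennreal_mult') (auto simp: nn_integral_cmult)
  also have "\<dots> = ennreal (s powr (a + 1)) * (\<integral>\<^sup>+t. ennreal (?k t) \<partial>lborel)"
  proof -
    have "ennreal s * ennreal (s powr a) = ennreal (s powr (a + 1))"
      using s by (simp add: ennreal_mult[symmetric] powr_add)
    then show ?thesis unfolding mult.assoc[symmetric] by (simp only:)
  qed
  finally have *: "ennreal (s powr (a + 1)) * (\<integral>\<^sup>+t. ennreal (?k t) \<partial>lborel) = ennreal (Gamma (a + 1))" by simp
  have "(\<integral>\<^sup>+t. ennreal (?k t) \<partial>lborel) = ennreal (Gamma (a + 1) / s powr (a + 1))"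
  proof -
    have "ennreal (Gamma (a + 1)) = ennreal (s powr (a + 1)) * ennreal (Gamma (a + 1) / s powr (a + 1))"
      using s a by (subst ennreal_mult[symmetric]) (auto intro!: divide_nonneg_nonneg Gamma_real_nonneg)
    with * show ?thesis using s by (simp add: ennreal_mult_cancel_left)
  qed
  then have hb: "has_bochner_integral lborel ?k (Gamma (a + 1) / s powr (a + 1))"
    using s a by (intro has_bochner_integral_nn_integral) (auto intro!: divide_nonneg_nonneg Gamma_real_nonneg)
  have k: "indicator {0..} t *\<^sub>R exp (- s * t) *\<^sub>R complex_of_real (t powr a) = complex_of_real (?k t)" for t
    by (simp add: scaleR_conv_of_real)
  show "set_integrable lborel {0..} (\<lambda>t. exp (- s * t) *\<^sub>R complex_of_real (t powr a))"
    unfolding set_integrable_def k using hb by (intro integrable_of_real) (auto simp: has_bochner_integral_iff)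
  show "laplace (\<lambda>t. complex_of_real (t powr a)) s = complex_of_real (Gamma (a + 1) / s powr (a + 1))"
    unfolding laplace_def set_lebesgue_integral_def k integral_complex_of_real
    using hb by (simp add: has_bochner_integral_iff)
qed

lemma
  fixes s :: real
  assumes s: "s > 0"
  shows set_integrable_laplace_const: "set_integrable lborel {0..} (\<lambda>t. exp (- s * t) *\<^sub>R (c::complex))"
    and laplace_const: "laplace (\<lambda>t. c) s = c / complex_of_real s"
proof -
  show "set_integrable lborel {0..} (\<lambda>t. exp (- s * t) *\<^sub>R c)"
    using set_integrable_laplace_bounded[OF continuous_on_const[of _ c], of "norm c" s] s by simp
  have "laplace (\<lambda>t. c) s = (LINT t:{0..}|lborel. c * exp (- complex_of_real s * complex_of_real t))"
    unfolding laplace_def by (rule set_lebesgue_integral_cong) (auto simp: scaleR_conv_of_real exp_of_real[symmetric] simp del: exp_of_real)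
  also have "\<dots> = c * (1 / complex_of_real s)"
    using integral_cexp_Ici[of "complex_of_real s"] s by (subst set_integral_mult_right) simp
  finally show "laplace (\<lambda>t. c) s = c / complex_of_real s" by simp
qed

lemma integral_exp_Ici:
  assumes s: "(s::real) > 0" and r: "r \<ge> 0"
  shows "integrable lborel (\<lambda>t. indicator {r..} t * exp (- s * t))"
    and "(LINT t|lborel. indicator {r..} t * exp (- s * t)) = exp (- s * r) / s"
proof -
  have i: "integrable lborel (\<lambda>t::real. indicator {0..} t *\<^sub>R exp (- s * t))"
    using integrable_exp_Ici[OF s] by (simp add: set_integrable_def)
  have eq: "indicator {r..} (r + 1 * t) * exp (- s * (r + 1 * t)) = exp (- s * r) * (indicator {0..} t *\<^sub>R exp (- s * t))" for t
    by (auto simp: indicator_def exp_add[symmetric] algebra_simps)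
  show "integrable lborel (\<lambda>t. indicator {r..} t * exp (- s * t))"
    by (rule Bochner_Integration.integrable_bound[OF i]) (use r in \<open>auto simp: indicator_def\<close>)
  have "(LINT t|lborel. indicator {r..} t * exp (- s * t)) = (LINT t|lborel. indicator {r..} (r + 1 * t) * exp (- s * (r + 1 * t)))"
    by (subst lborel_integral_affine[of _ 1 r]) auto
  also have "\<dots> = exp (- s * r) * (LINT t|lborel. indicator {0..} t *\<^sub>R exp (- s * t))"
    unfolding eq by (rule integral_mult_right_zero)
  also have "(LINT t|lborel. indicator {0..} t *\<^sub>R exp (- s * t)) = 1 / s"
  proof -
    have "laplace (\<lambda>t. 1) s = complex_of_real (LINT t|lborel. indicator {0..} t *\<^sub>R exp (- s * t))"
      unfolding laplace_def set_lebesgue_integral_def integral_complex_of_real[symmetric] by (simp add: scaleR_conv_of_real)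
    then show ?thesis unfolding laplace_const[OF s] by (metis of_real_1 of_real_divide of_real_eq_iff)
  qed
  finally show "(LINT t|lborel. indicator {r..} t * exp (- s * t)) = exp (- s * r) / s" by simp
qed

text \<open>Fubini over the region r \<le> t: the integral of \<open>exp (- s * t)\<close> over t
  \<ge> r is \<open>exp (- s * r) / s\<close>.\<close>

lemma
  fixes g :: "real \<Rightarrow> complex"
  assumes g: "continuous_on {0..} g" and s: "s > 0"
    and int: "set_integrable lborel {0..} (\<lambda>t. exp (- s * t) *\<^sub>R g t)"
  shows set_integrable_laplace_antiderivative: "set_integrable lborel {0..} (\<lambda>t. exp (- s * t) *\<^sub>R integral {0..t} g)"
    and laplace_antiderivative: "laplace (\<lambda>t. integral {0..t} g) s = laplace g s / complex_of_real s"
proof -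
  have [measurable]: "(\<lambda>r. indicator {0..} r *\<^sub>R g r) \<in> borel_measurable borel"
    using borel_measurable_continuous_on_indicator[of "{0..}" g] g by simp
  let ?F = "\<lambda>r t. complex_of_real (indicator {r..} t * exp (- s * t)) * (indicator {0..} r *\<^sub>R g r)"
  have nF: "norm (?F r t) = (indicator {r..} t * exp (- s * t)) * norm (indicator {0..} r *\<^sub>R g r)" for r t
    unfolding norm_mult norm_of_real by (simp add: abs_mult)
  have iF: "(LINT t|lborel. norm (?F r t)) = norm (indicator {0..} r *\<^sub>R exp (- s * r) *\<^sub>R g r) / s" for r
    unfolding nF integral_mult_left_zero using integral_exp_Ici(2)[OF s, of r] by (cases "r \<ge> 0") auto
  have i: "integrable (lborel \<Otimes>\<^sub>M lborel) (\<lambda>(r, t). ?F r t)"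
  proof (rule integrable_pair_bound)
    show "integrable lborel (\<lambda>r. norm (indicator {0..} r *\<^sub>R exp (- s * r) *\<^sub>R g r) / s)"
      using int unfolding set_integrable_def by (intro integrable_divide integrable_norm)
    have [measurable]: "(\<lambda>x. indicator {fst x..} (snd x)) \<in> borel_measurable (lborel \<Otimes>\<^sub>M (lborel :: real measure))"
      unfolding indicator_def atLeast_iff of_bool_def by measurable
    show "(\<lambda>(r, t). ?F r t) \<in> borel_measurable (lborel \<Otimes>\<^sub>M lborel)"
      unfolding split_beta' by measurable
    fix r
    have "integrable lborel (?F r)"
      using integral_exp_Ici(1)[OF s, of r]
      by (cases "r \<ge> 0") (auto simp del: of_real_mult intro!: integrable_mult_left integrable_of_real)
    then show "integrable lborel (\<lambda>x. case (r, x) of (r, t) \<Rightarrow> ?F r t)" by simp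
    show "(LINT x|lborel. norm (case (r, x) of (r, t) \<Rightarrow> ?F r t)) \<le> norm (indicator {0..} r *\<^sub>R exp (- s * r) *\<^sub>R g r) / s"
      unfolding prod.case iF by simp
  qed (auto intro: lborel.sigma_finite_measure_axioms)
  have inner: "(LINT r|lborel. ?F r t) = indicator {0..} t *\<^sub>R exp (- s * t) *\<^sub>R integral {0..t} g" for t
  proof (cases "t \<ge> 0")
    case True
    have "set_integrable lborel {0..t} g"
      by (rule borel_integrable_atLeastAtMost') (use g in \<open>auto intro: continuous_on_subset\<close>)
    then have "(LINT r:{0..t}|lborel. g r) = integral {0..t} g" by (rule set_borel_integral_eq_integral)
    moreover have "?F r t = exp (- s * t) *\<^sub>R (indicator {0..t} r *\<^sub>R g r)" for r
      by (auto simp: indicator_def scaleR_conv_of_real)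
    ultimately show ?thesis using True by (simp add: set_lebesgue_integral_def del: of_real_mult scaleR_scaleR)
  next
    case False
    have z: "?F r t = 0" for r using False by (auto simp: indicator_def)
    show ?thesis unfolding z using False by simp
  qed
  show "set_integrable lborel {0..} (\<lambda>t. exp (- s * t) *\<^sub>R integral {0..t} g)"
    using lborel_pair.integrable_snd[OF i] unfolding inner set_integrable_def .
  have "laplace (\<lambda>t. integral {0..t} g) s = (LINT t|lborel. (LINT r|lborel. ?F r t))"
    unfolding inner laplace_def set_lebesgue_integral_def ..
  also have "\<dots> = (LINT r|lborel. (LINT t|lborel. ?F r t))"
    by (rule lborel_pair.Fubini_integral[OF i])
  also have "\<dots> = (LINT r|lborel. (indicator {0..} r *\<^sub>R exp (- s * r) *\<^sub>R g r) / complex_of_real s)"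
  proof (rule Bochner_Integration.integral_cong[OF refl])
    fix r
    have "(LINT t|lborel. ?F r t) = complex_of_real (LINT t|lborel. indicator {r..} t * exp (- s * t)) * (indicator {0..} r *\<^sub>R g r)"
      by (simp del: of_real_mult)
    then show "(LINT t|lborel. ?F r t) = (indicator {0..} r *\<^sub>R exp (- s * r) *\<^sub>R g r) / complex_of_real s"
      using integral_exp_Ici(2)[OF s, of r] by (cases "r \<ge> 0") (auto simp: scaleR_conv_of_real)
  qed
  also have "\<dots> = laplace g s / complex_of_real s"
    unfolding laplace_def set_lebesgue_integral_def by (rule integral_divide_zero)
  finally show "laplace (\<lambda>t. integral {0..t} g) s = laplace g s / complex_of_real s" .
qed

lemma has_vector_derivative_antiderivative:
  fixes g :: "real \<Rightarrow> complex"
  assumes g: "continuous_on {0..} g" and t: "t > 0"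
  shows "((\<lambda>u. integral {0..u} g) has_vector_derivative g t) (at t)"
proof -
  have "((\<lambda>u. integral {0..u} g) has_vector_derivative g t) (at t within {0..t+1})"
    by (rule integral_has_vector_derivative) (use g t in \<open>auto intro: continuous_on_subset\<close>)
  moreover have "at t within {0..t+1} = at t"
    using t by (intro at_within_interior) auto
  ultimately show ?thesis by simp
qed

lemma continuous_on_antiderivative:
  fixes g :: "real \<Rightarrow> complex"
  assumes g: "continuous_on {0..} g"
  shows "continuous_on {0..} (\<lambda>t. integral {0..t} g)"
  unfolding continuous_on_eq_continuous_within
proof
  fix t :: real assume t: "t \<in> {0..}"
  have "((\<lambda>u. integral {0..u} g) has_vector_derivative g t) (at t within {0..t+1})"
    by (rule integral_has_vector_derivative) (use g t in \<open>auto intro: continuous_on_subset\<close>)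
  then have "continuous (at t within {0..t+1}) (\<lambda>t. integral {0..t} g)"
    by (rule has_vector_derivative_continuous)
  moreover have "at t within {0..t+1} = at t within {0..}"
    by (rule at_within_nhd[of _ "{..<t+1}"]) auto
  ultimately show "continuous (at t within {0..}) (\<lambda>t. integral {0..t} g)" by simp
qed

text \<open>With \<open>b = s powr (1 / m)\<close> both Laplace transforms equal \<open>b / (s * (b - z))\<close>, by the geometric sum
  in \<open>z / b\<close>.\<close>

theorem iterated_exp_expansion:
  assumes z: "Re z \<le> 0" and t: "t \<ge> 0" and m: "m = 2 ^ k"
  shows "iterated_exp k z t = 1 + (\<Sum>j=1..m-1. z ^ j * complex_of_real (1 / Gamma (real j / real m + 1)) * complex_of_real (t powr (real j / real m)))
      + z ^ m * integral {0..t} (iterated_exp k z)"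
proof -
  let ?g = "iterated_exp k z"
  let ?c = "\<lambda>j. z ^ j * complex_of_real (1 / Gamma (real j / real m + 1))"
  let ?p = "\<lambda>j t. complex_of_real (t powr (real j / real m))"
  have m0: "m > 0" using m by simp
  have g: "continuous_on {0..} ?g" by (rule continuous_on_iterated_exp[OF z])
  have gi: "set_integrable lborel {0..} (\<lambda>t. exp (- s * t) *\<^sub>R ?g t)" if "s > 0" for s
    by (rule set_integrable_laplace_iterated_exp[OF z that])
  have i1: "set_integrable lborel {0..} (\<lambda>t. \<Sum>j=1..m-1. ?c j * (exp (- s * t) *\<^sub>R ?p j t))" if "s > 0" for s
    by (rule set_integrable_sum, rule set_integrable_mult_right, rule set_integrable_laplace_powr) (use m0 that in auto)
  have i2: "set_integrable lborel {0..} (\<lambda>t. z ^ m * (exp (- s * t) *\<^sub>R integral {0..t} ?g))" if "s > 0" for s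
    by (rule set_integrable_mult_right, rule set_integrable_laplace_antiderivative[OF g that gi[OF that]])
  have i0: "set_integrable lborel {0..} (\<lambda>t. exp (- s * t) *\<^sub>R (1::complex))" if "s > 0" for s
    by (rule set_integrable_laplace_const[OF that])
  have eq: "exp (- s * t) *\<^sub>R (1 + (\<Sum>j=1..m-1. ?c j * ?p j t) + z ^ m * integral {0..t} ?g)
      = exp (- s * t) *\<^sub>R 1 + (\<Sum>j=1..m-1. ?c j * (exp (- s * t) *\<^sub>R ?p j t)) + z ^ m * (exp (- s * t) *\<^sub>R integral {0..t} ?g)" for s t
    by (simp add: scaleR_add_right scaleR_sum_right)
  \<comment> \<open>Both sides are continuous in t with Laplace transforms at every
    \<open>s > 0\<close>, so the identity is checked on the transforms.\<close>
  show ?thesis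
  proof (rule laplace_eq_imp_eq[where a=0, OF g _ gi _ _ t])
    have "continuous_on {0..} (?p j)" if "j \<in> {1..m-1}" for j
      using that m0 by (intro continuous_on_of_real continuous_on_powr') (auto intro!: continuous_intros)
    then show "continuous_on {0..} (\<lambda>t. 1 + (\<Sum>j=1..m-1. ?c j * ?p j t) + z ^ m * integral {0..t} ?g)"
      by (intro continuous_on_add continuous_on_sum continuous_on_mult continuous_on_const continuous_on_antiderivative g)
    fix s :: real assume s: "s > 0"
    show "set_integrable lborel {0..} (\<lambda>t. exp (- s * t) *\<^sub>R (1 + (\<Sum>j=1..m-1. ?c j * ?p j t) + z ^ m * integral {0..t} ?g))"
      unfolding eq by (intro set_integral_add(1) i0 i1 i2 s)
    have "laplace (\<lambda>t. 1 + (\<Sum>j=1..m-1. ?c j * ?p j t) + z ^ m * integral {0..t} ?g) s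
        = laplace (\<lambda>t. 1) s + (\<Sum>j=1..m-1. ?c j * laplace (?p j) s) + z ^ m * laplace (\<lambda>t. integral {0..t} ?g) s"
    proof -
      have "laplace (\<lambda>t. 1 + (\<Sum>j=1..m-1. ?c j * ?p j t) + z ^ m * integral {0..t} ?g) s
          = (LINT t:{0..}|lborel. exp (- s * t) *\<^sub>R 1) + (LINT t:{0..}|lborel. (\<Sum>j=1..m-1. ?c j * (exp (- s * t) *\<^sub>R ?p j t)))
            + (LINT t:{0..}|lborel. z ^ m * (exp (- s * t) *\<^sub>R integral {0..t} ?g))"
        unfolding laplace_def eq
        by (subst set_integral_add(2)[OF set_integral_add(1)[OF i0[OF s] i1[OF s]] i2[OF s]],
            subst set_integral_add(2)[OF i0[OF s] i1[OF s]]) (rule refl)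
      also have "(LINT t:{0..}|lborel. (\<Sum>j=1..m-1. ?c j * (exp (- s * t) *\<^sub>R ?p j t)))
          = (\<Sum>j=1..m-1. (LINT t:{0..}|lborel. ?c j * (exp (- s * t) *\<^sub>R ?p j t)))"
        by (rule set_lebesgue_integral_sum, rule set_integrable_mult_right, rule set_integrable_laplace_powr) (use s m0 in auto)
      finally show ?thesis unfolding laplace_def set_integral_mult_right .
    qed
    also have "(\<Sum>j=1..m-1. ?c j * laplace (?p j) s) = (\<Sum>j=1..m-1. z ^ j * complex_of_real (1 / s powr (real j / real m + 1)))"
    proof (rule sum.cong[OF refl])
      fix j assume j: "j \<in> {1..m-1}"
      have "Gamma (real j / real m + 1) > 0" using m0 by (intro Gamma_real_pos) (auto intro: add_nonneg_pos)
      then show "?c j * laplace (?p j) s = z ^ j * complex_of_real (1 / s powr (real j / real m + 1))"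
        using j m0 s by (subst laplace_powr) auto
    qed
    also have "laplace (\<lambda>t. integral {0..t} ?g) s = laplace ?g s / complex_of_real s"
      by (rule laplace_antiderivative[OF g s gi[OF s]])
    also have "laplace (\<lambda>t. 1) s + (\<Sum>j=1..m-1. z ^ j * complex_of_real (1 / s powr (real j / real m + 1))) + z ^ m * (laplace ?g s / complex_of_real s) = laplace ?g s"
    proof -
      define b where "b = s powr (1 / real m)"
      have b: "b > 0" using s by (simp add: b_def)
      have bm: "b ^ j = s powr (real j / real m)" for j
        using s m0 by (simp add: b_def powr_realpow[symmetric] powr_powr)
      have sb: "s = b ^ m" using bm[of m] s m0 by simp
      define q where "q = z / complex_of_real b"
      \<comment> \<open>\<open>b\<close> is positive while \<open>z\<close> lies in the closed left
        half plane, so the ratio \<open>q\<close> is never 1.\<close>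
      have bz: "complex_of_real b \<noteq> z" using z b by auto
      have q1: "q \<noteq> 1" using bz b by (auto simp: q_def)
      have lap: "laplace ?g s = 1 / (complex_of_real s * (1 - q))"
      proof -
        have "laplace ?g s = complex_of_real (b / s) / (complex_of_real b - z)"
          using laplace_iterated_exp[OF z s, of k] s by (simp add: b_def m powr_diff)
        also have "\<dots> = 1 / (complex_of_real s * (1 - q))"
          using b bz s by (simp add: q_def field_simps)
        finally show ?thesis .
      qed
      have "(\<Sum>j=1..m-1. z ^ j * complex_of_real (1 / s powr (real j / real m + 1))) = (\<Sum>j=1..m-1. q ^ j) / complex_of_real s"
        unfolding sum_divide_distrib
        by (rule sum.cong[OF refl]) (use s in \<open>simp add: powr_add bm[symmetric] q_def power_divide\<close>)
      moreover have "{..<m} = insert 0 {1..m-1}" using m0 by auto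
      then have "(\<Sum>j=1..m-1. q ^ j) = (\<Sum>j<m. q ^ j) - 1" by simp
      \<comment> \<open>By this identity the antiderivative term becomes exactly the remainder of
        the finite geometric sum.\<close>
      moreover have "z ^ m = q ^ m * complex_of_real s" using b by (simp add: sb q_def power_divide)
      moreover have "(\<Sum>j<m. q ^ j) = (1 - q ^ m) / (1 - q)"
        using geometric_sum[OF q1, of m] q1 by (simp add: divide_simps) (simp add: algebra_simps)
      moreover have "laplace (\<lambda>t. 1) s = 1 / complex_of_real s" by (rule laplace_const[OF s])
      ultimately show ?thesis unfolding lap using q1 s by (simp add: divide_simps) (simp add: algebra_simps)
    qed
    finally show "laplace ?g s = laplace (\<lambda>t. 1 + (\<Sum>j=1..m-1. ?c j * ?p j t) + z ^ m * integral {0..t} ?g) s" by simp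
  qed
qed

text \<open>Termwise differentiation of the expansion: \<open>Gamma (a + 1) = a * Gamma a\<close>
  turns the derivatives of the powers into \<open>cauchy_coeff\<close>, and the antiderivative gives
  back the function itself.\<close>

theorem iterated_exp_has_derivative:
  assumes z: "Re z \<le> 0" and t: "t > 0" and m: "m = 2 ^ k"
  shows "(iterated_exp k z has_vector_derivative
      (\<Sum>j=1..m-1. cauchy_coeff m j t * z ^ j) + z ^ m * iterated_exp k z t) (at t)"
proof -
  let ?c = "\<lambda>j. z ^ j * complex_of_real (1 / Gamma (real j / real m + 1))"
  have m0: "m > 0" using m by simp
  have "((\<lambda>t. 1 + (\<Sum>j=1..m-1. ?c j * complex_of_real (t powr (real j / real m))) + z ^ m * integral {0..t} (iterated_exp k z)) has_vector_derivative
      (0 + (\<Sum>j=1..m-1. ?c j * complex_of_real (real j / real m * t powr (real j / real m - 1))) + z ^ m * iterated_exp k z t)) (at t)"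
    using t m0
    by (intro has_vector_derivative_add has_vector_derivative_sum has_vector_derivative_mult_right has_vector_derivative_const
         has_vector_derivative_antiderivative continuous_on_iterated_exp z has_vector_derivative_of_real)
       (auto intro!: derivative_eq_intros simp: has_real_derivative_iff_has_vector_derivative[symmetric])
  moreover have "?c j * complex_of_real (real j / real m * t powr (real j / real m - 1)) = cauchy_coeff m j t * z ^ j" if "j \<in> {1..m-1}" for j
  proof -
    have a: "real j / real m > 0" using that m0 by auto
    then have "Gamma (real j / real m + 1) = real j / real m * Gamma (real j / real m)"
      by (intro Gamma_plus1) auto
    then show ?thesis using a by (simp add: cauchy_coeff_def)
  qed
  ultimately have "((\<lambda>t. 1 + (\<Sum>j=1..m-1. ?c j * complex_of_real (t powr (real j / real m))) + z ^ m * integral {0..t} (iterated_exp k z)) has_vector_derivative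
      ((\<Sum>j=1..m-1. cauchy_coeff m j t * z ^ j) + z ^ m * iterated_exp k z t)) (at t)"
    by simp
  then show ?thesis
    by (rule has_vector_derivative_transform_within_open[of _ _ _ "{0<..}"])
       (use t iterated_exp_expansion[OF z _ m] in auto)
qed

section \<open>Evolution in L1\<close>

text \<open>The transforms determine \<open>u t\<close> up to a null set, so an expectation over
  paths and a Gaussian mixture with the same transforms count as the same evolution; level 0 is the
  Levy semigroup. The modulus in \<open>u \<bar>t\<bar> x\<close> states joint measurability for
  times \<open>t \<ge> 0\<close> over the whole line.\<close>

definition evolves :: "('a::euclidean_space \<Rightarrow> complex) \<Rightarrow> nat \<Rightarrow> ('a \<Rightarrow> complex) \<Rightarrow> (real \<Rightarrow> 'a \<Rightarrow> complex) \<Rightarrow> bool" where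
  "evolves \<psi> k f u \<longleftrightarrow>
     (\<lambda>(t, x). u \<bar>t\<bar> x) \<in> borel_measurable (borel \<Otimes>\<^sub>M borel) \<and>
     (\<forall>t\<ge>0. integrable lborel (u t) \<and> (LINT x|lborel. norm (u t x)) \<le> (LINT x|lborel. norm (f x)) \<and>
        (\<forall>\<xi>. fourier (u t) \<xi> = iterated_exp k (\<psi> \<xi>) t * fourier f \<xi>))"

lemma evolvesD:
  assumes "evolves \<psi> k f u"
  shows "(\<lambda>(t, x). u \<bar>t\<bar> x) \<in> borel_measurable (borel \<Otimes>\<^sub>M borel)"
    and "t \<ge> 0 \<Longrightarrow> integrable lborel (u t)"
    and "t \<ge> 0 \<Longrightarrow> (LINT x|lborel. norm (u t x)) \<le> (LINT x|lborel. norm (f x))"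
    and "t \<ge> 0 \<Longrightarrow> fourier (u t) \<xi> = iterated_exp k (\<psi> \<xi>) t * fourier f \<xi>"
  using assms unfolding evolves_def by auto

text \<open>The weight \<open>w\<close> may be signed: besides densities it will be a derivative or
  a difference quotient of heat kernels, and the norm bound then involves the integral of
  \<open>\<bar>w y\<bar>\<close>.\<close>

lemma
  assumes u: "evolves \<psi> k f u" and w: "integrable lborel w"
    and [measurable]: "\<rho> \<in> borel_measurable borel" and \<rho>: "\<And>y. \<rho> y \<ge> (0::real)"
  shows integrable_evolves_weighted: "integrable (lborel \<Otimes>\<^sub>M lborel) (\<lambda>(y, x). w y *\<^sub>R u (\<rho> y) x)"
    and fourier_evolves_mixture: "fourier (\<lambda>x. LINT y|lborel. w y *\<^sub>R u (\<rho> y) x) \<xi>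
        = (LINT y|lborel. w y *\<^sub>R iterated_exp k (\<psi> \<xi>) (\<rho> y)) * fourier f \<xi>"
    and integrable_evolves_mixture: "integrable lborel (\<lambda>x. LINT y|lborel. w y *\<^sub>R u (\<rho> y) x)"
    and norm_evolves_mixture: "(LINT x|lborel. norm (LINT y|lborel. w y *\<^sub>R u (\<rho> y) x))
        \<le> (LINT y|lborel. \<bar>w y\<bar>) * (LINT x|lborel. norm (f x))"
proof -
  note [measurable] = evolvesD(1)[OF u] borel_measurable_integrable[OF w]
  let ?I = "LINT x|lborel. norm (f x)"
  have m[measurable]: "(\<lambda>(y, x). u (\<rho> y) x) \<in> borel_measurable (borel \<Otimes>\<^sub>M borel)"
  proof -
    have "(\<lambda>p. (\<lambda>(t, x). u \<bar>t\<bar> x) (\<rho> (fst p), snd p)) \<in> borel_measurable (borel \<Otimes>\<^sub>M borel)"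
      by measurable
    then show ?thesis using \<rho> by (simp add: split_beta')
  qed
  have n: "(LINT x|lborel. norm (w y *\<^sub>R u (\<rho> y) x)) \<le> \<bar>w y\<bar> * ?I" for y
    using evolvesD(3)[OF u \<rho>, of y] by (simp add: mult_left_mono)
  have wI: "integrable lborel (\<lambda>y. \<bar>w y\<bar> * ?I)" using w by auto
  show i: "integrable (lborel \<Otimes>\<^sub>M lborel) (\<lambda>(y, x). w y *\<^sub>R u (\<rho> y) x)"
  proof (rule integrable_pair_bound[OF _ _ _ wI])
    show "(\<lambda>(y, x). w y *\<^sub>R u (\<rho> y) x) \<in> borel_measurable (lborel \<Otimes>\<^sub>M lborel)"
      by measurable
    show "integrable lborel (\<lambda>x. case (y, x) of (y, x) \<Rightarrow> w y *\<^sub>R u (\<rho> y) x)" for y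
      using evolvesD(2)[OF u \<rho>, of y] by simp
    show "(LINT x|lborel. norm (case (y, x) of (y, x) \<Rightarrow> w y *\<^sub>R u (\<rho> y) x)) \<le> \<bar>w y\<bar> * ?I" for y
      using n[of y] by simp
  qed (auto intro: lborel.sigma_finite_measure_axioms)
  note mix = lborel.sigma_finite_measure_axioms i
  show "integrable lborel (\<lambda>x. LINT y|lborel. w y *\<^sub>R u (\<rho> y) x)"
    by (rule integrable_mixture[OF mix])
  have "fourier (\<lambda>x. LINT y|lborel. w y *\<^sub>R u (\<rho> y) x) \<xi> = (LINT y|lborel. fourier (\<lambda>x. w y *\<^sub>R u (\<rho> y) x) \<xi>)"
    by (rule fourier_mixture[OF mix])
  also have "\<dots> = (LINT y|lborel. (w y *\<^sub>R iterated_exp k (\<psi> \<xi>) (\<rho> y)) * fourier f \<xi>)"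
    unfolding scaleR_conv_of_real fourier_cmult evolvesD(4)[OF u \<rho>] by (simp only: mult.assoc)
  finally show "fourier (\<lambda>x. LINT y|lborel. w y *\<^sub>R u (\<rho> y) x) \<xi>
        = (LINT y|lborel. w y *\<^sub>R iterated_exp k (\<psi> \<xi>) (\<rho> y)) * fourier f \<xi>"
    by (simp only: integral_mult_left_zero)
  have "(LINT x|lborel. norm (LINT y|lborel. w y *\<^sub>R u (\<rho> y) x)) \<le> (LINT y|lborel. LINT x|lborel. norm (w y *\<^sub>R u (\<rho> y) x))"
    by (rule norm_mixture_le[OF mix])
  also have "\<dots> \<le> (LINT y|lborel. \<bar>w y\<bar> * ?I)"
  proof (intro integral_mono n wI)
    have "integrable (lborel \<Otimes>\<^sub>M lborel) (\<lambda>(y, x). norm (w y *\<^sub>R u (\<rho> y) x))"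
      using integrable_norm[OF i] by (simp add: split_beta')
    then show "integrable lborel (\<lambda>y. LINT x|lborel. norm (w y *\<^sub>R u (\<rho> y) x))"
      by (rule lborel_pair.integrable_fst)
  qed
  finally show "(LINT x|lborel. norm (LINT y|lborel. w y *\<^sub>R u (\<rho> y) x)) \<le> (LINT y|lborel. \<bar>w y\<bar>) * ?I"
    by simp
qed

text \<open>The next level is a Gaussian mixture of the previous one and needs no further process on
  the probability space. Evolutions of every level are thus available for auxiliary initial
  functions, such as images of \<open>f\<close> under the generator.\<close>

lemma ex_evolves:
  assumes base: "\<exists>u. evolves \<psi> 0 f u"
  shows "\<exists>u. evolves \<psi> k f u"
proof (induction k)
  case (Suc k)
  then obtain u where u: "evolves \<psi> k f u" by blast
  define v where "v t x = (LINT y|lborel. std_normal_density y *\<^sub>R u (sqrt (2 * t) * \<bar>y\<bar>) x)" for t x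
  note [measurable] = evolvesD(1)[OF u]
  have "(\<lambda>(t, x). v \<bar>t\<bar> x) \<in> borel_measurable (borel \<Otimes>\<^sub>M borel)"
  proof -
    have "(\<lambda>p. LINT y|lborel. std_normal_density y *\<^sub>R (\<lambda>(t, x). u \<bar>t\<bar> x) (sqrt (2 * \<bar>fst p\<bar>) * \<bar>y\<bar>, snd p)) \<in> borel_measurable (borel \<Otimes>\<^sub>M borel)"
      by measurable
    then show ?thesis by (simp add: v_def split_beta' abs_mult)
  qed
  moreover have "integrable lborel (v t)" "(LINT x|lborel. norm (v t x)) \<le> (LINT x|lborel. norm (f x))"
    "fourier (v t) \<xi> = iterated_exp (Suc k) (\<psi> \<xi>) t * fourier f \<xi>" if "t \<ge> 0" for t \<xi>
  proof -
    have \<rho>: "(\<lambda>y. sqrt (2 * t) * \<bar>y\<bar>) \<in> borel_measurable borel" "\<And>y. sqrt (2 * t) * \<bar>y\<bar> \<ge> 0" using that by auto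
    have w: "integrable lborel std_normal_density" by simp
    show "integrable lborel (v t)" unfolding v_def by (rule integrable_evolves_mixture[OF u w \<rho>])
    have "(LINT y|lborel. \<bar>std_normal_density y\<bar>) = 1" by (simp add: normal_density_nonneg)
    then show "(LINT x|lborel. norm (v t x)) \<le> (LINT x|lborel. norm (f x))"
      using norm_evolves_mixture[OF u w \<rho>] by (simp add: v_def)
    show "fourier (v t) \<xi> = iterated_exp (Suc k) (\<psi> \<xi>) t * fourier f \<xi>"
      using fourier_evolves_mixture[OF u w \<rho>] by (simp add: v_def[abs_def])
  qed
  ultimately have "evolves \<psi> (Suc k) f v" unfolding evolves_def by auto
  then show ?case by blast
qed (rule base)

lemma evolves_0:
  assumes "evolves \<psi> k f u" "integrable lborel f"
  shows "AE x in lborel. u 0 x = f x"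
  using assms by (intro fourier_eq_imp_AE_eq) (simp_all add: evolvesD)

section \<open>The heat kernel as a differentiable curve in L1\<close>

text \<open>The time derivative of the kernel: the first term in the bracket comes from the
  exponent, the second from the normalizing square root.\<close>

definition heat_kernel_deriv :: "real \<Rightarrow> real \<Rightarrow> real" where
  "heat_kernel_deriv t r = heat_kernel t r * (r\<^sup>2 / (4 * t\<^sup>2) - 1 / (2 * t))"

lemma heat_kernel_eq: "t > 0 \<Longrightarrow> heat_kernel t r = exp (- (r\<^sup>2 / (4 * t))) / sqrt (4 * pi * t)"
  by (simp add: normal_density_def mult_ac)

lemma DERIV_heat_kernel:
  assumes t: "t > 0"
  shows "((\<lambda>t. heat_kernel t r) has_real_derivative heat_kernel_deriv t r) (at t)"
proof -
  have "((\<lambda>t. exp (- (r\<^sup>2 / (4 * t))) / sqrt (4 * pi * t)) has_real_derivative heat_kernel_deriv t r) (at t)"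
    unfolding heat_kernel_deriv_def heat_kernel_eq[OF t] using t mult_pos_pos[OF pi_gt_zero t]
    by (auto intro!: derivative_eq_intros simp: field_simps power2_eq_square mult_less_0_iff)
  then show ?thesis
    by (rule has_field_derivative_transform_within_open[of _ _ _ "{0<..}"])
       (use t heat_kernel_eq in auto)
qed

text \<open>The exponent is worst at the largest time \<open>2 * t\<close>, the normalization and
  the polynomial factor at the smallest time \<open>t / 2\<close>. The factor 2 is the ratio of the
  normalizing square roots at these two times.\<close>

lemma heat_kernel_deriv_bound:
  assumes t: "t > 0" and \<tau>: "\<tau> \<in> {t / 2..2 * t}"
  shows "\<bar>heat_kernel_deriv \<tau> r\<bar> \<le> 2 * heat_kernel (2 * t) r * (r\<^sup>2 / t\<^sup>2 + 1 / t)"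
proof -
  have \<tau>0: "\<tau> > 0" and \<tau>1: "t \<le> 2 * \<tau>" and \<tau>2: "\<tau> \<le> 2 * t" using t \<tau> by auto
  have "heat_kernel \<tau> r \<le> exp (- (r\<^sup>2 / (4 * (2 * t)))) / sqrt (4 * pi * (t / 2))"
    unfolding heat_kernel_eq[OF \<tau>0]
    by (intro frac_le) (use t \<tau>0 \<tau>1 \<tau>2 in \<open>auto intro!: frac_le\<close>)
  also have "\<dots> = 2 * heat_kernel (2 * t) r"
  proof -
    have "sqrt (4 * pi * (2 * t)) = 2 * sqrt (4 * pi * (t / 2))"
      by (rule real_sqrt_unique) (use t in \<open>auto simp: power_mult_distrib\<close>)
    moreover have "heat_kernel (2 * t) r = exp (- (r\<^sup>2 / (4 * (2 * t)))) / sqrt (4 * pi * (2 * t))"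
      by (rule heat_kernel_eq) (use t in simp)
    ultimately show ?thesis by simp
  qed
  finally have h: "heat_kernel \<tau> r \<le> 2 * heat_kernel (2 * t) r" .
  have a: "1 / (2 * \<tau>) \<le> 1 / t" using \<tau>0 \<tau>1 t by (intro frac_le) auto
  have "t\<^sup>2 \<le> 4 * \<tau>\<^sup>2" using power_mono[OF \<tau>1, of 2] t by (simp add: power_mult_distrib)
  then have b: "r\<^sup>2 / (4 * \<tau>\<^sup>2) \<le> r\<^sup>2 / t\<^sup>2" using t by (intro frac_le) auto
  have "\<bar>r\<^sup>2 / (4 * \<tau>\<^sup>2) - 1 / (2 * \<tau>)\<bar> \<le> r\<^sup>2 / t\<^sup>2 + 1 / t"
    using a b \<tau>0 abs_triangle_ineq4[of "r\<^sup>2 / (4 * \<tau>\<^sup>2)" "1 / (2 * \<tau>)"] by simp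
  then show ?thesis
    unfolding heat_kernel_deriv_def abs_mult
    by (intro mult_mono) (use h in \<open>auto simp: normal_density_nonneg\<close>)
qed

lemma
  assumes t: "t > 0"
  shows integrable_heat_kernel_bound: "integrable lborel (\<lambda>r. 2 * heat_kernel (2 * t) r * (r\<^sup>2 / t\<^sup>2 + 1 / t))"
    and integrable_heat_kernel_deriv: "integrable lborel (heat_kernel_deriv t)"
proof -
  have "integrable lborel (\<lambda>r. (2 / t\<^sup>2) * (heat_kernel (2 * t) r * r\<^sup>2) + (2 / t) * heat_kernel (2 * t) r)"
    using integrable_normal_moment[of "sqrt (2 * (2 * t))" 0 2] t by auto
  then show b: "integrable lborel (\<lambda>r. 2 * heat_kernel (2 * t) r * (r\<^sup>2 / t\<^sup>2 + 1 / t))"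
    by (simp add: field_simps)
  show "integrable lborel (heat_kernel_deriv t)"
  proof (rule Bochner_Integration.integrable_bound[OF b])
    show "heat_kernel_deriv t \<in> borel_measurable lborel"
      unfolding heat_kernel_deriv_def[abs_def] by measurable
    show "AE r in lborel. norm (heat_kernel_deriv t r) \<le> norm (2 * heat_kernel (2 * t) r * (r\<^sup>2 / t\<^sup>2 + 1 / t))"
      using heat_kernel_deriv_bound[OF t, of t] t by (auto intro: order.trans[OF _ abs_ge_self])
  qed
qed

text \<open>By the mean value theorem a difference quotient is the derivative at an intermediate
  time, so the bound on \<open>{t / 2..2 * t}\<close> is a common majorant for dominated
  convergence.\<close>

lemma tendsto_heat_kernel_quotient:
  assumes t: "t > 0"
  shows "((\<lambda>s. LINT r|lborel. \<bar>(heat_kernel s r - heat_kernel t r) / (s - t) - heat_kernel_deriv t r\<bar>) \<longlongrightarrow> 0) (at t)"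
  unfolding tendsto_at_iff_sequentially comp_def
proof (intro allI impI)
  fix X :: "nat \<Rightarrow> real" assume X: "\<forall>i. X i \<in> UNIV - {t}" "X \<longlonglongrightarrow> t"
  let ?W = "\<lambda>r. 2 * heat_kernel (2 * t) r * (r\<^sup>2 / t\<^sup>2 + 1 / t)"
  let ?q = "\<lambda>s r. (heat_kernel s r - heat_kernel t r) / (s - t)"
  have "\<forall>\<^sub>F i in sequentially. X i \<in> {t / 2<..<2 * t}"
    by (rule topological_tendstoD[OF X(2)]) (use t in auto)
  then obtain N where N: "\<And>i. i \<ge> N \<Longrightarrow> X i \<in> {t / 2<..<2 * t}"
    by (auto simp: eventually_sequentially)
  have q: "\<bar>?q s r\<bar> \<le> ?W r" if s: "s \<in> {t / 2<..<2 * t}" "s \<noteq> t" for s r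
  proof -
    have "\<exists>\<tau>. \<tau> \<in> {t / 2..2 * t} \<and> heat_kernel s r - heat_kernel t r = (s - t) * heat_kernel_deriv \<tau> r"
    proof (cases "s < t")
      case True
      from MVT2[OF this, of "\<lambda>t. heat_kernel t r" "\<lambda>t. heat_kernel_deriv t r"] obtain \<tau> where
        "s < \<tau>" "\<tau> < t" "heat_kernel t r - heat_kernel s r = (t - s) * heat_kernel_deriv \<tau> r"
        using s t DERIV_heat_kernel by auto
      then show ?thesis using s by (intro exI[of _ \<tau>]) (auto simp: algebra_simps)
    next
      case False
      then have "t < s" using s by auto
      from MVT2[OF this, of "\<lambda>t. heat_kernel t r" "\<lambda>t. heat_kernel_deriv t r"] obtain \<tau> where
        "t < \<tau>" "\<tau> < s" "heat_kernel s r - heat_kernel t r = (s - t) * heat_kernel_deriv \<tau> r"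
        using s t DERIV_heat_kernel by auto
      then show ?thesis using s by (intro exI[of _ \<tau>]) auto
    qed
    then obtain \<tau> where "\<tau> \<in> {t / 2..2 * t}" "?q s r = heat_kernel_deriv \<tau> r" using s by auto
    then show ?thesis using heat_kernel_deriv_bound[OF t] by simp
  qed
  have "(\<lambda>i. LINT r|lborel. \<bar>?q (X (i + N)) r - heat_kernel_deriv t r\<bar>) \<longlonglongrightarrow> (LINT r|(lborel::real measure). 0)"
  proof (rule integral_dominated_convergence[where w="\<lambda>r. 2 * ?W r"])
    show "integrable lborel (\<lambda>r. 2 * ?W r)"
      using integrable_heat_kernel_bound[OF t] by (rule integrable_mult_right)
    show "(\<lambda>r. \<bar>?q (X (i + N)) r - heat_kernel_deriv t r\<bar>) \<in> borel_measurable lborel" for i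
      unfolding heat_kernel_deriv_def by measurable
    show "AE r in lborel. (\<lambda>i. \<bar>?q (X (i + N)) r - heat_kernel_deriv t r\<bar>) \<longlonglongrightarrow> 0"
    proof (intro AE_I2)
      fix r
      have "((\<lambda>s. ?q s r) \<longlongrightarrow> heat_kernel_deriv t r) (at t)"
        using DERIV_heat_kernel[OF t, of r] by (simp add: has_field_derivative_iff)
      then have "(\<lambda>i. ?q (X i) r) \<longlonglongrightarrow> heat_kernel_deriv t r"
        using X unfolding tendsto_at_iff_sequentially comp_def by auto
      then have "(\<lambda>i. ?q (X (i + N)) r) \<longlonglongrightarrow> heat_kernel_deriv t r" by (rule LIMSEQ_ignore_initial_segment)
      from tendsto_rabs[OF tendsto_diff[OF this tendsto_const[of "heat_kernel_deriv t r"]]]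
      show "(\<lambda>i. \<bar>?q (X (i + N)) r - heat_kernel_deriv t r\<bar>) \<longlonglongrightarrow> 0" by simp
    qed
    show "AE r in lborel. norm \<bar>?q (X (i + N)) r - heat_kernel_deriv t r\<bar> \<le> 2 * ?W r" for i
    proof (intro AE_I2)
      fix r
      have "\<bar>?q (X (i + N)) r\<bar> \<le> ?W r" using q N[of "i + N"] X(1) by auto
      moreover have "\<bar>heat_kernel_deriv t r\<bar> \<le> ?W r" using heat_kernel_deriv_bound[OF t, of t] t by auto
      ultimately show "norm \<bar>?q (X (i + N)) r - heat_kernel_deriv t r\<bar> \<le> 2 * ?W r" unfolding real_norm_def by linarith
    qed
  qed simp
  then have "(\<lambda>i. LINT r|lborel. \<bar>?q (X (i + N)) r - heat_kernel_deriv t r\<bar>) \<longlonglongrightarrow> 0" by simp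
  then show "(\<lambda>i. LINT r|lborel. \<bar>?q (X i) r - heat_kernel_deriv t r\<bar>) \<longlonglongrightarrow> 0"
    by (rule LIMSEQ_offset)
qed

lemma L1_dist_cong_AE:
  assumes "AE x in lborel. f x - g x = h x" "f \<in> borel_measurable borel" "g \<in> borel_measurable borel" "h \<in> borel_measurable borel"
  shows "L1_dist f g = (LINT x|lborel. norm (h x))"
  unfolding L1_dist_def using assms by (intro integral_cong_AE) auto

lemma L1_dist_nonneg: "L1_dist f g \<ge> 0"
  unfolding L1_dist_def by simp

text \<open>\<open>mix\<close> maps weights on the line linearly to L1 functions, with norm at most
  that of \<open>f\<close>. For \<open>s > 0\<close> the function \<open>u s\<close> is the image of
  \<open>heat_kernel s\<close>, so the L1 derivative of the kernel is carried over.\<close>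

theorem evolves_has_L1_derivative:
  fixes \<psi> :: "'a::euclidean_space \<Rightarrow> complex"
  assumes Re: "\<And>\<xi>. Re (\<psi> \<xi>) \<le> 0" and base: "\<exists>u. evolves \<psi> 0 f u"
    and u: "evolves \<psi> (Suc k) f u" and t: "t > 0"
  shows "\<exists>h. has_L1_derivative u h t"
proof -
  obtain v where v: "evolves \<psi> k f v" using ex_evolves[OF base] by blast
  define mix where "mix w x = (LINT r|lborel. w r *\<^sub>R v \<bar>r\<bar> x)" for w x
  have mix: "integrable lborel (mix w)"
    "fourier (mix w) \<xi> = (LINT r|lborel. w r *\<^sub>R iterated_exp k (\<psi> \<xi>) \<bar>r\<bar>) * fourier f \<xi>"
    "(LINT x|lborel. norm (mix w x)) \<le> (LINT r|lborel. \<bar>w r\<bar>) * (LINT x|lborel. norm (f x))"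
    if "integrable lborel w" for w \<xi>
    unfolding mix_def
    by (rule integrable_evolves_mixture[OF v that] fourier_evolves_mixture[OF v that] norm_evolves_mixture[OF v that]; simp)+
  have iw: "integrable lborel (\<lambda>r. w r *\<^sub>R iterated_exp k (\<psi> \<xi>) \<bar>r\<bar>)" if w: "integrable lborel w" for w \<xi>
  proof (rule Bochner_Integration.integrable_bound[OF w])
    show "(\<lambda>r. w r *\<^sub>R iterated_exp k (\<psi> \<xi>) \<bar>r\<bar>) \<in> borel_measurable lborel"
      using w borel_measurable_half_line_abs[OF continuous_on_iterated_exp[OF Re], of 1 k \<xi>] by simp
    show "AE r in lborel. norm (w r *\<^sub>R iterated_exp k (\<psi> \<xi>) \<bar>r\<bar>) \<le> norm (w r)"
      using norm_iterated_exp_le[OF Re] by (auto intro!: mult_left_le)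
  qed
  have iheat: "integrable lborel (heat_kernel s)" if "s > 0" for s using that by simp
  have uf: "fourier (u s) \<xi> = fourier (mix (heat_kernel s)) \<xi>" if "s > 0" for s \<xi>
    using that by (simp only: evolvesD(4)[OF u] less_imp_le mix(2)[OF iheat] iterated_exp_Suc_heat[OF Re])
  define h where "h = mix (heat_kernel_deriv t)"
  have h: "integrable lborel h" unfolding h_def by (rule mix(1)[OF integrable_heat_kernel_deriv[OF t]])
  let ?q = "\<lambda>s r. (heat_kernel s r - heat_kernel t r) / (s - t)"
  let ?D = "\<lambda>s. LINT r|lborel. \<bar>?q s r - heat_kernel_deriv t r\<bar>"
  let ?L = "\<lambda>s. L1_dist (\<lambda>x. (u s x - u t x) / complex_of_real (s - t)) h"
  have bound: "?L s \<le> ?D s * (LINT x|lborel. norm (f x))" if s: "s > 0" "s \<noteq> t" for s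
  proof -
    have iq: "integrable lborel (\<lambda>r. ?q s r - heat_kernel_deriv t r)"
      using s t integrable_heat_kernel_deriv[OF t] by auto
    have i1: "integrable lborel (\<lambda>x. (u s x - u t x) / complex_of_real (s - t))"
      using evolvesD(2)[OF u, of s] evolvesD(2)[OF u, of t] s t by auto
    \<comment> \<open>Linearity of \<open>mix\<close> is read off from the transforms, which also
      covers that \<open>u s\<close> equals its mixture only almost everywhere.\<close>
    have AE: "AE x in lborel. (u s x - u t x) / complex_of_real (s - t) - h x = mix (\<lambda>r. ?q s r - heat_kernel_deriv t r) x"
    proof (rule fourier_eq_imp_AE_eq)
      fix \<xi>
      let ?e = "\<lambda>r. iterated_exp k (\<psi> \<xi>) \<bar>r\<bar>"
      have "(LINT r|lborel. (?q s r - heat_kernel_deriv t r) *\<^sub>R ?e r)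
          = (LINT r|lborel. (heat_kernel s r *\<^sub>R ?e r - heat_kernel t r *\<^sub>R ?e r) /\<^sub>R (s - t) - heat_kernel_deriv t r *\<^sub>R ?e r)"
        by (intro Bochner_Integration.integral_cong) (auto simp: algebra_simps divide_inverse)
      also have "\<dots> = ((LINT r|lborel. heat_kernel s r *\<^sub>R ?e r) - (LINT r|lborel. heat_kernel t r *\<^sub>R ?e r)) /\<^sub>R (s - t)
          - (LINT r|lborel. heat_kernel_deriv t r *\<^sub>R ?e r)"
        using iw[OF iheat[OF s(1)], of \<xi>] iw[OF iheat[OF t], of \<xi>] iw[OF integrable_heat_kernel_deriv[OF t], of \<xi>]
        by (subst Bochner_Integration.integral_diff, simp, simp, subst integral_scaleR_right, subst Bochner_Integration.integral_diff) auto
      finally have e: "(LINT r|lborel. (?q s r - heat_kernel_deriv t r) *\<^sub>R ?e r) = \<dots>" .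
      have "fourier (\<lambda>x. (u s x - u t x) / complex_of_real (s - t) - h x) \<xi>
          = (fourier (mix (heat_kernel s)) \<xi> - fourier (mix (heat_kernel t)) \<xi>) / complex_of_real (s - t) - fourier h \<xi>"
        using evolvesD(2)[OF u, of s] evolvesD(2)[OF u, of t] s t
        by (subst fourier_diff[OF i1 h], subst fourier_divide, subst fourier_diff) (simp_all add: uf)
      also have "\<dots> = fourier (mix (\<lambda>r. ?q s r - heat_kernel_deriv t r)) \<xi>"
        unfolding h_def mix(2)[OF iq] mix(2)[OF iheat[OF s(1)]] mix(2)[OF iheat[OF t]] mix(2)[OF integrable_heat_kernel_deriv[OF t]] e
        by (simp add: scaleR_conv_of_real algebra_simps divide_inverse)
      finally show "fourier (\<lambda>x. (u s x - u t x) / complex_of_real (s - t) - h x) \<xi> = fourier (mix (\<lambda>r. ?q s r - heat_kernel_deriv t r)) \<xi>" .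
    qed (use i1 h mix(1)[OF iq] in auto)
    have "?L s = (LINT x|lborel. norm (mix (\<lambda>r. ?q s r - heat_kernel_deriv t r) x))"
      by (rule L1_dist_cong_AE[OF AE]) (use i1 h mix(1)[OF iq] in auto)
    also have "\<dots> \<le> ?D s * (LINT x|lborel. norm (f x))" by (rule mix(3)[OF iq])
    finally show ?thesis .
  qed
  have "(?L \<longlongrightarrow> 0) (at t)"
  proof (rule tendsto_sandwich[OF _ _ tendsto_const])
    show "\<forall>\<^sub>F s in at t. 0 \<le> ?L s" by (simp add: L1_dist_nonneg)
    have "\<forall>\<^sub>F s in at t. s \<in> {0<..}" using t by (intro eventually_at_in_open') auto
    then show "\<forall>\<^sub>F s in at t. ?L s \<le> ?D s * (LINT x|lborel. norm (f x))"
      using eventually_neq_at_within[of t t UNIV] by eventually_elim (use bound in auto)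
    show "((\<lambda>s. ?D s * (LINT x|lborel. norm (f x))) \<longlongrightarrow> 0) (at t)"
      using tendsto_mult_left_zero[OF tendsto_heat_kernel_quotient[OF t]] .
  qed
  then show ?thesis unfolding has_L1_derivative_def using h by blast
qed

lemma has_vector_derivativeI_quotient:
  fixes F :: "real \<Rightarrow> complex"
  assumes "((\<lambda>s. (F s - F t) / complex_of_real (s - t)) \<longlongrightarrow> D) (at t)"
  shows "(F has_vector_derivative D) (at t)"
  unfolding has_vector_derivative_def has_derivative_iff_norm
proof
  show "bounded_linear (\<lambda>x. x *\<^sub>R D)" by (rule bounded_linear_scaleR_left)
  have "((\<lambda>s. norm ((F s - F t) / complex_of_real (s - t) - D)) \<longlongrightarrow> 0) (at t)"
    using assms by (intro tendsto_norm_zero) (simp add: LIM_zero)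
  moreover have "\<forall>\<^sub>F s in at t. norm ((F s - F t) / complex_of_real (s - t) - D) = norm (F s - F t - (s - t) *\<^sub>R D) / norm (s - t)"
    using eventually_neq_at_within[of t t UNIV]
  proof eventually_elim
    case (elim s)
    have "(F s - F t) / complex_of_real (s - t) - D = (F s - F t - (s - t) *\<^sub>R D) / complex_of_real (s - t)"
      using elim by (simp add: scaleR_conv_of_real diff_divide_distrib)
    then show ?case by (simp only: norm_divide norm_of_real real_norm_def)
  qed
  ultimately show "((\<lambda>s. norm (F s - F t - (s - t) *\<^sub>R D) / norm (s - t)) \<longlongrightarrow> 0) (at t)"
    by (rule Lim_transform_eventually)
qed

lemma norm_fourier_diff_le:
  assumes "integrable lborel f" "integrable lborel g"
  shows "norm (fourier f \<xi> - fourier g \<xi>) \<le> L1_dist f g"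
  using norm_fourier_le[of "\<lambda>x. f x - g x" \<xi>] assms by (simp add: fourier_diff L1_dist_def)

text \<open>At a fixed frequency the transform is linear and bounded by the L1 norm, so an L1 limit
  of difference quotients becomes an ordinary derivative.\<close>

lemma has_L1_derivative_fourier:
  assumes h: "has_L1_derivative v h t" and v: "\<And>s. s \<ge> 0 \<Longrightarrow> integrable lborel (v s)" and t: "t > 0"
  shows "((\<lambda>s. fourier (v s) \<xi>) has_vector_derivative fourier h \<xi>) (at t)"
proof (rule has_vector_derivativeI_quotient)
  let ?q = "\<lambda>s x. (v s x - v t x) / complex_of_real (s - t)"
  have ih: "integrable lborel h" and lim: "((\<lambda>s. L1_dist (?q s) h) \<longlongrightarrow> 0) (at t)"
    using h by (auto simp: has_L1_derivative_def)
  have "\<forall>\<^sub>F s in at t. s \<in> {0<..}" using t by (intro eventually_at_in_open') auto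
  then have "\<forall>\<^sub>F s in at t. norm ((fourier (v s) \<xi> - fourier (v t) \<xi>) / complex_of_real (s - t) - fourier h \<xi>) \<le> L1_dist (?q s) h"
  proof eventually_elim
    case (elim s)
    have i: "integrable lborel (v s)" "integrable lborel (v t)" using elim t v by auto
    then have "fourier (?q s) \<xi> = (fourier (v s) \<xi> - fourier (v t) \<xi>) / complex_of_real (s - t)"
      by (simp only: fourier_divide fourier_diff)
    then show ?case using norm_fourier_diff_le[of "?q s" h \<xi>] i ih by (simp only:) simp
  qed
  then have "((\<lambda>s. (fourier (v s) \<xi> - fourier (v t) \<xi>) / complex_of_real (s - t) - fourier h \<xi>) \<longlongrightarrow> 0) (at t)"
    using lim by (rule Lim_null_comparison)
  then show "((\<lambda>s. (fourier (v s) \<xi> - fourier (v t) \<xi>) / complex_of_real (s - t)) \<longlongrightarrow> fourier h \<xi>) (at t)"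
    by (rule LIM_zero_cancel)
qed

lemma L1_continuous_fourier:
  assumes "L1_continuous v"
  shows "continuous_on {0..} (\<lambda>t. fourier (v t) \<xi>)"
  unfolding continuous_on_def
proof
  fix t :: real assume t: "t \<in> {0..}"
  have v: "\<And>s. s \<ge> 0 \<Longrightarrow> integrable lborel (v s)"
    and lim: "((\<lambda>s. L1_dist (v s) (v t)) \<longlongrightarrow> 0) (at t within {0..})"
    using assms t by (auto simp: L1_continuous_def)
  have "\<forall>\<^sub>F s in at t within {0..}. norm (fourier (v s) \<xi> - fourier (v t) \<xi>) \<le> L1_dist (v s) (v t)"
    using t v by (auto simp: eventually_at_filter intro!: always_eventually norm_fourier_diff_le)
  then have "((\<lambda>s. fourier (v s) \<xi> - fourier (v t) \<xi>) \<longlongrightarrow> 0) (at t within {0..})"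
    using lim by (rule Lim_null_comparison)
  then show "((\<lambda>t. fourier (v t) \<xi>) \<longlongrightarrow> fourier (v t) \<xi>) (at t within {0..})" by (rule LIM_zero_cancel)
qed

text \<open>The integrating factor \<open>exp (- a * s)\<close> makes the difference stationary for
  \<open>s > 0\<close>. The common term \<open>c\<close> may be singular at 0, as the powers of t in
  the Cauchy problem are; so 0 is an exceptional point where only continuity is used.\<close>

lemma linear_ode_unique:
  fixes y :: "real \<Rightarrow> complex"
  assumes y: "continuous_on {0..} y" and z: "continuous_on {0..} z" and init: "y 0 = z 0"
    and y': "\<And>t. t > 0 \<Longrightarrow> (y has_vector_derivative c t + a * y t) (at t)"
    and z': "\<And>t. t > 0 \<Longrightarrow> (z has_vector_derivative c t + a * z t) (at t)"
    and t: "t \<ge> 0"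
  shows "y t = z t"
proof -
  define w where "w s = exp (- a * complex_of_real s) * (y s - z s)" for s
  have "w t = 0"
  proof (rule has_derivative_zero_unique_strong_interval[of "{0}" 0 t w 0 t])
    have "continuous_on {0..} w" unfolding w_def using y z by (intro continuous_intros)
    then show "continuous_on {0..t} w" by (rule continuous_on_subset) auto
    show "w 0 = 0" by (simp add: w_def init)
    fix s assume "s \<in> {0..t} - {0}"
    then have s: "s > 0" by auto
    have e: "((\<lambda>s. exp (- a * complex_of_real s)) has_vector_derivative (- a * exp (- a * complex_of_real s))) (at s)"
      by (auto intro!: has_vector_derivative_real_field derivative_eq_intros)
    have "(w has_vector_derivative 0) (at s)"
      unfolding w_def
      by (rule has_vector_derivative_eq_rhs[OF has_vector_derivative_mult[OF e has_vector_derivative_diff[OF y'[OF s] z'[OF s]]]])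
         (simp add: algebra_simps)
    then show "(w has_derivative (\<lambda>h. 0)) (at s within {0..t})"
      by (auto simp: has_vector_derivative_def intro: has_derivative_at_withinI)
  qed (use t in auto)
  then show ?thesis by (simp add: w_def)
qed

section \<open>Continuity in L1, in particular at time 0\<close>

text \<open>Prepares averaging over a Gaussian y: \<open>1 + y\<^sup>2\<close> bounds
  \<open>\<bar>y\<bar> powr b\<close> for small and large y and has an explicit mean, while the
  square root halves the power of t.\<close>

lemma powr_mult_abs_le:
  assumes t: "t \<ge> 0" and b: "0 < b" "b \<le> 1"
  shows "(sqrt (2 * t) * \<bar>y\<bar>) powr b \<le> 2 * t powr (b / 2) * (1 + y\<^sup>2)"
proof -
  have "sqrt (2 * t) powr b = 2 powr (b / 2) * t powr (b / 2)"
    using t by (simp add: powr_half_sqrt[symmetric] powr_powr powr_mult)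
  moreover have "(2::real) powr (b / 2) \<le> 2 powr 1" using b by (intro powr_mono) auto
  ultimately have 1: "sqrt (2 * t) powr b \<le> 2 * t powr (b / 2)" by (simp add: mult_right_mono)
  have 2: "\<bar>y\<bar> powr b \<le> 1 + y\<^sup>2"
  proof (cases "\<bar>y\<bar> \<le> 1")
    case True
    then have "\<bar>y\<bar> powr b \<le> 1" using b by (intro powr_le1) auto
    then show ?thesis by (simp add: add_increasing2)
  next
    case False
    then have "\<bar>y\<bar> powr b \<le> \<bar>y\<bar> powr 2" using b by (intro powr_mono) auto
    also have "\<dots> = y\<^sup>2" using False by (simp add: powr_numeral)
    finally show ?thesis by simp
  qed
  have "(sqrt (2 * t) * \<bar>y\<bar>) powr b = sqrt (2 * t) powr b * \<bar>y\<bar> powr b"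
    using t by (simp add: powr_mult)
  also have "\<dots> \<le> 2 * t powr (b / 2) * (1 + y\<^sup>2)" by (rule mult_mono[OF 1 2]) auto
  finally show ?thesis .
qed

text \<open>For the semigroup, \<open>u t - f\<close> is the integral over [0, t] of the evolution
  of \<open>g\<close>, which gives the rate t. Each layer inserts the random time
  \<open>sqrt (2 * t) * \<bar>y\<bar>\<close>; this halves the exponent and multiplies the constant
  by 4.\<close>

lemma L1_dist_evolves_initial:
  fixes \<psi> :: "'a::euclidean_space \<Rightarrow> complex"
  assumes base: "\<And>f. integrable lborel f \<Longrightarrow> \<exists>u. evolves \<psi> 0 f u"
    and fg: "gen \<psi> f g" and u: "evolves \<psi> k f u" and t: "t \<ge> 0"
  shows "L1_dist (u t) f \<le> 4 ^ k * (LINT x|lborel. norm (g x)) * t powr (1 / 2 ^ k)"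
  using u t
proof (induction k arbitrary: u t)
  case 0
  have f: "integrable lborel f" and g: "integrable lborel g" and ghat: "\<And>\<xi>. fourier g \<xi> = \<psi> \<xi> * fourier f \<xi>"
    using fg by (auto simp: gen_def)
  \<comment> \<open>\<open>v\<close> is the semigroup applied to \<open>g\<close>; its time integral
    is a mixture with the indicator of \<open>{0..t}\<close> as weight.\<close>
  obtain v where v: "evolves \<psi> 0 g v" using base[OF g] by blast
  have w: "integrable lborel (indicator {0..t} :: real \<Rightarrow> real)"
    by (intro integrable_real_indicator) (auto simp: emeasure_lborel_Icc_eq)
  have m: "abs \<in> borel_measurable (borel :: real measure)" by measurable
  let ?mix = "\<lambda>x. LINT r|lborel. indicator {0..t} r *\<^sub>R v \<bar>r\<bar> x"
  note mix = integrable_evolves_mixture[OF v w m] fourier_evolves_mixture[OF v w m] norm_evolves_mixture[OF v w m]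
  have ut: "integrable lborel (u t)" using evolvesD(2)[OF 0] .
  have "AE x in lborel. u t x - f x = ?mix x"
  proof (rule fourier_eq_imp_AE_eq)
    fix \<xi>
    have "(LINT r|lborel. indicator {0..t} r *\<^sub>R (\<psi> \<xi> * exp (complex_of_real r * \<psi> \<xi>))) = exp (complex_of_real t * \<psi> \<xi>) - exp (complex_of_real 0 * \<psi> \<xi>)"
      by (rule integral_FTC_Icc[OF \<open>t \<ge> 0\<close>])
         (auto intro!: derivative_eq_intros continuous_intros has_vector_derivative_real_field[where f="\<lambda>r. exp (r * \<psi> \<xi>)"])
    also have "(LINT r|lborel. indicator {0..t} r *\<^sub>R (\<psi> \<xi> * exp (complex_of_real r * \<psi> \<xi>))) = (LINT r|lborel. \<psi> \<xi> * (indicator {0..t} r *\<^sub>R iterated_exp 0 (\<psi> \<xi>) \<bar>r\<bar>))"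
      by (intro Bochner_Integration.integral_cong) (auto simp: indicator_def)
    finally have *: "\<psi> \<xi> * (LINT r|lborel. indicator {0..t} r *\<^sub>R iterated_exp 0 (\<psi> \<xi>) \<bar>r\<bar>) = exp (complex_of_real t * \<psi> \<xi>) - 1"
      by (simp only: integral_mult_right_zero) simp
    have "fourier ?mix \<xi> = (\<psi> \<xi> * (LINT r|lborel. indicator {0..t} r *\<^sub>R iterated_exp 0 (\<psi> \<xi>) \<bar>r\<bar>)) * fourier f \<xi>"
      using mix(2)[of \<xi>] by (simp add: ghat)
    then show "fourier (\<lambda>x. u t x - f x) \<xi> = fourier ?mix \<xi>"
      unfolding * using evolvesD(4)[OF 0, of \<xi>] by (simp add: fourier_diff[OF ut f] algebra_simps)
  qed (use ut f mix(1) in auto)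
  then have "L1_dist (u t) f = (LINT x|lborel. norm (?mix x))"
    by (rule L1_dist_cong_AE) (use ut f mix(1) in auto)
  also have "\<dots> \<le> (LINT r|lborel. \<bar>indicator {0..t} r\<bar>) * (LINT x|lborel. norm (g x))"
    by (rule mix(3)) auto
  also have "(LINT r|lborel. \<bar>indicator {0..t} r :: real\<bar>) = t" using \<open>t \<ge> 0\<close> by simp
  finally show ?case using \<open>t \<ge> 0\<close> by (simp add: mult.commute)
next
  case (Suc k)
  note u = Suc.prems(1) and t = Suc.prems(2)
  have f: "integrable lborel f" using fg by (auto simp: gen_def)
  obtain v where v: "evolves \<psi> k f v" using ex_evolves[OF base[OF f]] by blast
  let ?\<rho> = "\<lambda>y. sqrt (2 * t) * \<bar>y\<bar>"
  let ?G = "LINT x|lborel. norm (g x)"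
  define b :: real where "b = 1 / 2 ^ k"
  have b: "0 < b" "b \<le> 1" by (auto simp: b_def)
  have \<rho>: "?\<rho> \<in> borel_measurable borel" "\<And>y. ?\<rho> y \<ge> 0" using t by auto
  have w: "integrable lborel std_normal_density" by simp
  note mix = integrable_evolves_mixture[OF v w \<rho>] fourier_evolves_mixture[OF v w \<rho>] integrable_evolves_weighted[OF v w \<rho>]
  let ?F = "\<lambda>y x. std_normal_density y *\<^sub>R (v (?\<rho> y) x - f x)"
  have iv: "integrable lborel (v (?\<rho> y))" for y by (rule evolvesD(2)[OF v \<rho>(2)])
  have ut: "integrable lborel (u t)" using evolvesD(2)[OF u t] .
  have nF: "norm (?F y x) = std_normal_density y * norm (v (?\<rho> y) x - f x)" for y x
    by (simp add: normal_density_nonneg)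
  have if': "integrable (lborel \<Otimes>\<^sub>M lborel) (\<lambda>(y, x). std_normal_density y *\<^sub>R f x)"
    by (rule integrable_pair_bound[where g="\<lambda>y. std_normal_density y * (LINT x|lborel. norm (f x))"])
       (use f in \<open>auto simp: normal_density_nonneg split_beta' intro: lborel.sigma_finite_measure_axioms\<close>)
  have iF: "integrable (lborel \<Otimes>\<^sub>M lborel) (\<lambda>(y, x). ?F y x)"
    using Bochner_Integration.integrable_diff[OF mix(3) if'] by (simp add: split_beta' scaleR_diff_right)
  have "AE x in lborel. u t x = (LINT y|lborel. std_normal_density y *\<^sub>R v (?\<rho> y) x)"
    by (rule fourier_eq_imp_AE_eq[OF ut mix(1)]) (simp add: mix(2) evolvesD(4)[OF u t])
  then have "AE x in lborel. u t x - f x = (LINT y|lborel. ?F y x)"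
    using lborel_pair.AE_integrable_snd[OF mix(3)]
    by eventually_elim (simp add: scaleR_diff_right)
  then have "L1_dist (u t) f = (LINT x|lborel. norm (LINT y|lborel. ?F y x))"
    by (rule L1_dist_cong_AE) (use ut f integrable_mixture[OF lborel.sigma_finite_measure_axioms iF] in auto)
  also have "\<dots> \<le> (LINT y|lborel. LINT x|lborel. norm (?F y x))"
    by (rule norm_mixture_le[OF lborel.sigma_finite_measure_axioms iF])
  also have "\<dots> \<le> (LINT y|lborel. (4 ^ k * ?G * (2 * t powr (b / 2))) * (std_normal_density y + std_normal_density y * y ^ 2))"
  proof (rule integral_mono)
    have "integrable (lborel \<Otimes>\<^sub>M lborel) (\<lambda>(y, x). norm (?F y x))"
      using integrable_norm[OF iF] by (simp only: split_beta')
    then show "integrable lborel (\<lambda>y. LINT x|lborel. norm (?F y x))"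
      by (rule lborel_pair.integrable_fst)
    show "integrable lborel (\<lambda>y. (4 ^ k * ?G * (2 * t powr (b / 2))) * (std_normal_density y + std_normal_density y * y ^ 2))"
      by (intro integrable_mult_right Bochner_Integration.integrable_add integrable_std_normal_moment w)
    fix y :: real
    have "(LINT x|lborel. norm (?F y x)) = std_normal_density y * L1_dist (v (?\<rho> y)) f"
      unfolding nF L1_dist_def by simp
    also have "\<dots> \<le> std_normal_density y * (4 ^ k * ?G * ?\<rho> y powr b)"
      using Suc.IH[OF v \<rho>(2)] by (intro mult_left_mono) (auto simp: b_def normal_density_nonneg)
    also have "\<dots> \<le> std_normal_density y * (4 ^ k * ?G * (2 * t powr (b / 2) * (1 + y\<^sup>2)))"
      using powr_mult_abs_le[OF t b, of y] by (intro mult_left_mono) (auto simp: normal_density_nonneg)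
    finally show "(LINT x|lborel. norm (?F y x)) \<le> (4 ^ k * ?G * (2 * t powr (b / 2))) * (std_normal_density y + std_normal_density y * y ^ 2)"
      by (simp add: algebra_simps)
  qed
  also have "\<dots> = (4 ^ k * ?G * (2 * t powr (b / 2))) * ((LINT y|lborel. std_normal_density y) + (LINT y|lborel. std_normal_density y * y ^ 2))"
    by (subst integral_mult_right_zero, subst Bochner_Integration.integral_add[OF w integrable_std_normal_moment]) (rule refl)
  \<comment> \<open>The moments of order 0 and 2 are both 1; together with the 2 from
    \<open>powr_mult_abs_le\<close> they give the factor 4.\<close>
  also have "(LINT y|lborel. std_normal_density y * y ^ 2) = 1"
    using integral_std_normal_moment_even[of 1] by (simp add: fact_numeral)
  finally show ?case by (simp add: b_def algebra_simps)
qed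

text \<open>At 0 the explicit rate applies after replacing \<open>u 0\<close> by \<open>f\<close>;
  at \<open>t > 0\<close> differentiability in L1 gives continuity.\<close>

lemma evolves_L1_continuous:
  fixes \<psi> :: "'a::euclidean_space \<Rightarrow> complex"
  assumes Re: "\<And>\<xi>. Re (\<psi> \<xi>) \<le> 0" and base: "\<And>f. integrable lborel f \<Longrightarrow> \<exists>u. evolves \<psi> 0 f u"
    and fg: "gen \<psi> f g" and u: "evolves \<psi> (Suc k) f u"
  shows "L1_continuous u"
  unfolding L1_continuous_def
proof (intro conjI allI impI)
  have f: "integrable lborel f" using fg by (auto simp: gen_def)
  have iu: "integrable lborel (u t)" if "t \<ge> 0" for t using evolvesD(2)[OF u that] .
  then show "integrable lborel (u t)" if "t \<ge> 0" for t using that .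
  fix t :: real assume "t \<ge> 0"
  then consider "t = 0" | "t > 0" by linarith
  then show "((\<lambda>s. L1_dist (u s) (u t)) \<longlongrightarrow> 0) (at t within {0..})"
  proof cases
    case 1
    let ?b = "1 / 2 ^ Suc k :: real"
    have "((\<lambda>s. 4 ^ Suc k * (LINT x|lborel. norm (g x)) * s powr ?b) \<longlongrightarrow> 4 ^ Suc k * (LINT x|lborel. norm (g x)) * 0 powr ?b) (at 0 within {0..})"
      by (intro tendsto_mult tendsto_const tendsto_powr' tendsto_ident_at) (auto simp: eventually_at_filter)
    then have lim: "((\<lambda>s. 4 ^ Suc k * (LINT x|lborel. norm (g x)) * s powr ?b) \<longlongrightarrow> 0) (at 0 within {0..})" by simp
    have le: "L1_dist (u s) (u 0) \<le> 4 ^ Suc k * (LINT x|lborel. norm (g x)) * s powr ?b" if s: "s \<ge> 0" for s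
    proof -
      have "L1_dist (u s) (u 0) = L1_dist (u s) f"
        unfolding L1_dist_def using evolves_0[OF u f] iu[OF s] iu[of 0] f by (intro integral_cong_AE) auto
      then show ?thesis using L1_dist_evolves_initial[OF base fg u s] by simp
    qed
    show ?thesis unfolding 1
      by (rule tendsto_sandwich[OF _ _ tendsto_const lim])
         (use le in \<open>auto simp: L1_dist_nonneg eventually_at_filter intro!: always_eventually\<close>)
  next
    case 2
    obtain h where h: "integrable lborel h" "((\<lambda>s. L1_dist (\<lambda>x. (u s x - u t x) / complex_of_real (s - t)) h) \<longlongrightarrow> 0) (at t)"
      using evolves_has_L1_derivative[OF Re base[OF f] u 2] unfolding has_L1_derivative_def by blast
    let ?q = "\<lambda>s x. (u s x - u t x) / complex_of_real (s - t)"
    have "\<forall>\<^sub>F s in at t. s \<in> {0<..}" using 2 by (intro eventually_at_in_open') auto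
    then have le: "\<forall>\<^sub>F s in at t. L1_dist (u s) (u t) \<le> \<bar>s - t\<bar> * (L1_dist (?q s) h + (LINT x|lborel. norm (h x)))"
      using eventually_neq_at_within[of t t UNIV]
    proof eventually_elim
      case (elim s)
      have i: "integrable lborel (?q s)" using iu[of s] iu[of t] elim 2 by auto
      have "L1_dist (u s) (u t) = (LINT x|lborel. \<bar>s - t\<bar> * norm (?q s x))"
        unfolding L1_dist_def using elim
        by (intro Bochner_Integration.integral_cong) (auto simp: norm_divide simp flip: of_real_diff)
      also have "\<dots> = \<bar>s - t\<bar> * (LINT x|lborel. norm (?q s x))" by (rule integral_mult_right_zero)
      also have "(LINT x|lborel. norm (?q s x)) \<le> (LINT x|lborel. norm (?q s x - h x) + norm (h x))"
        by (intro integral_mono) (use i h(1) in \<open>auto intro: norm_triangle_sub simp: add.commute\<close>)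
      also have "\<dots> = L1_dist (?q s) h + (LINT x|lborel. norm (h x))"
        unfolding L1_dist_def using i h(1) by (intro Bochner_Integration.integral_add) auto
      finally show ?case by (simp add: mult_left_mono)
    qed
    have "((\<lambda>s. \<bar>s - t\<bar> * (L1_dist (?q s) h + (LINT x|lborel. norm (h x)))) \<longlongrightarrow> \<bar>t - t\<bar> * (0 + (LINT x|lborel. norm (h x)))) (at t)"
      by (intro tendsto_intros h(2))
    then have "((\<lambda>s. \<bar>s - t\<bar> * (L1_dist (?q s) h + (LINT x|lborel. norm (h x)))) \<longlongrightarrow> 0) (at t)" by simp
    then have "((\<lambda>s. L1_dist (u s) (u t)) \<longlongrightarrow> 0) (at t)"
      by (intro tendsto_sandwich[OF _ le tendsto_const]) (simp add: L1_dist_nonneg)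
    then show ?thesis by (rule tendsto_within_subset) auto
  qed
qed

section \<open>The Cauchy problems\<close>

text \<open>The multiplication formula: the kernel is symmetric in x and \<xi>, so Fubini moves the
  transform from the test function to \<open>h\<close>.\<close>

lemma distr_of_fun_fourier:
  fixes h \<eta> :: "'a::euclidean_space \<Rightarrow> complex"
  assumes h: "integrable lborel h" and \<eta>: "schwartz \<eta>"
  shows "distr_of_fun h \<eta> = (LINT \<xi>|lborel. fourier h \<xi> * \<eta> \<xi>)"
proof -
  have \<eta>i: "integrable lborel \<eta>"
    using slowly_growing_integrable[OF slowly_growing_const[of 1] \<eta>] by simp
  note [measurable] = borel_measurable_integrable[OF h] borel_measurable_integrable[OF \<eta>i]
  let ?F = "\<lambda>x \<xi>. h x * (exp (- \<i> * complex_of_real (x \<bullet> \<xi>)) * \<eta> \<xi>)"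
  have nF: "norm (?F x \<xi>) = norm (h x) * norm (\<eta> \<xi>)" for x \<xi> by (simp add: norm_mult)
  have i: "integrable (lborel \<Otimes>\<^sub>M lborel) (\<lambda>(x, \<xi>). ?F x \<xi>)"
  proof (rule integrable_pair_bound)
    show "integrable lborel (\<lambda>x. norm (h x) * (LINT \<xi>|lborel. norm (\<eta> \<xi>)))" using h by auto
    show "integrable lborel (\<lambda>\<xi>. case (x, \<xi>) of (x, \<xi>) \<Rightarrow> ?F x \<xi>)" for x
      using integrable_fourier_kernel[OF \<eta>i, of x] by auto
    show "(LINT \<xi>|lborel. norm (case (x, \<xi>) of (x, \<xi>) \<Rightarrow> ?F x \<xi>)) \<le> norm (h x) * (LINT \<xi>|lborel. norm (\<eta> \<xi>))" for x
      unfolding prod.case nF by simp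
  qed (auto intro: lborel.sigma_finite_measure_axioms)
  have "distr_of_fun h \<eta> = (LINT x|lborel. LINT \<xi>|lborel. ?F x \<xi>)"
    unfolding distr_of_fun_def fourier_def by (simp only: integral_mult_right_zero)
  also have "\<dots> = (LINT \<xi>|lborel. LINT x|lborel. ?F x \<xi>)"
    by (rule lborel_pair.Fubini_integral[OF i, symmetric])
  also have "\<dots> = (LINT \<xi>|lborel. fourier h \<xi> * \<eta> \<xi>)"
  proof (rule Bochner_Integration.integral_cong[OF refl])
    fix \<xi>
    have "?F x \<xi> = (exp (- \<i> * complex_of_real (\<xi> \<bullet> x)) * h x) * \<eta> \<xi>" for x
      by (simp only: inner_commute[of x \<xi>] mult_ac)
    then show "(LINT x|lborel. ?F x \<xi>) = fourier h \<xi> * \<eta> \<xi>"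
      unfolding fourier_def by (simp only: integral_mult_left_zero)
  qed
  finally show ?thesis .
qed

lemma gen_pow_fourier:
  assumes "(gen \<psi> ^^ j) f g" "integrable lborel f"
  shows "integrable lborel g" and "fourier g \<xi> = \<psi> \<xi> ^ j * fourier f \<xi>"
proof -
  have "integrable lborel g \<and> (\<forall>\<xi>. fourier g \<xi> = \<psi> \<xi> ^ j * fourier f \<xi>)"
    using assms
  proof (induction j arbitrary: g)
    case (Suc j)
    then obtain h where h: "(gen \<psi> ^^ j) f h" "gen \<psi> h g" by auto
    show ?case using Suc.IH[OF h(1) Suc.prems(2)] h(2) by (simp add: gen_def) (metis mult.assoc)
  qed auto
  then show "integrable lborel g" "fourier g \<xi> = \<psi> \<xi> ^ j * fourier f \<xi>" by auto
qed

lemma gen_powI: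
  assumes "\<And>i. i \<le> n \<Longrightarrow> integrable lborel (G i)"
    and "\<And>i \<xi>. i < n \<Longrightarrow> fourier (G (Suc i)) \<xi> = \<psi> \<xi> * fourier (G i) \<xi>"
  shows "(gen \<psi> ^^ n) (G 0) (G n)"
  using assms
proof (induction n)
  case (Suc n)
  have "(gen \<psi> ^^ n) (G 0) (G n)" by (rule Suc.IH) (use Suc.prems in auto)
  moreover have "gen \<psi> (G n) (G (Suc n))" using Suc.prems by (auto simp: gen_def)
  ultimately show ?case by auto
qed auto

text \<open>Membership in the domain of a power unfolds to one chain of functions, which provides
  all lower powers at once.\<close>

lemma gen_pow_chain:
  assumes "(gen \<psi> ^^ n) f g"
  shows "\<exists>G. G 0 = f \<and> G n = g \<and> (\<forall>i\<le>n. (gen \<psi> ^^ i) f (G i))"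
  using assms
proof (induction n arbitrary: g)
  case 0
  then show ?case by (intro exI[of _ "\<lambda>_. f"]) auto
next
  case (Suc n)
  then obtain h where h: "(gen \<psi> ^^ n) f h" "gen \<psi> h g" by auto
  obtain G where G: "G 0 = f" "G n = h" "\<And>i. i \<le> n \<Longrightarrow> (gen \<psi> ^^ i) f (G i)"
    using Suc.IH[OF h(1)] by blast
  have "(gen \<psi> ^^ Suc n) f g" by (rule Suc.prems)
  then show ?case
    by (intro exI[of _ "G(Suc n := g)"]) (use G in \<open>auto simp: le_Suc_eq simp del: relpowp.simps\<close>)
qed

text \<open>What the Cauchy problems use of a Levy process. The semigroup is asked for at every
  integrable initial function because it is also started from images of \<open>f\<close> under
  powers of the generator.\<close>

locale evolution =
  fixes \<psi> :: "'a::euclidean_space \<Rightarrow> complex"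
  assumes Re_nonpos: "\<And>\<xi>. Re (\<psi> \<xi>) \<le> 0"
    and slow: "slowly_growing \<psi>"
    and base: "\<And>f. integrable lborel f \<Longrightarrow> \<exists>u. evolves \<psi> 0 f u"
begin

definition cauchy_rhs :: "nat \<Rightarrow> ('a \<Rightarrow> complex) \<Rightarrow> real \<Rightarrow> ('a \<Rightarrow> complex) \<Rightarrow> 'a \<Rightarrow> complex" where
  "cauchy_rhs m f t v \<xi> = (\<Sum>j=1..m-1. cauchy_coeff m j t * (\<psi> \<xi> ^ j * fourier f \<xi>)) + \<psi> \<xi> ^ m * fourier v \<xi>"

lemma slowly_growing_symbol_power: "integrable lborel f \<Longrightarrow> slowly_growing (\<lambda>\<xi>. \<psi> \<xi> ^ j * fourier f \<xi>)"
  by (intro slowly_growing_mult slowly_growing_power slow slowly_growing_fourier)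

text \<open>Both sides are slowly growing functions integrated against test functions, which
  separate such functions. From here on the distributional equation is an identity at each
  frequency.\<close>

lemma cauchy_rhs_iff:
  assumes h: "integrable lborel h" and f: "integrable lborel f" and v: "integrable lborel v"
  shows "(\<forall>\<eta>. schwartz \<eta> \<longrightarrow> distr_of_fun h \<eta> =
      (\<Sum>j=1..m-1. cauchy_coeff m j t * gen_pow_distr \<psi> j f \<eta>) + gen_pow_distr \<psi> m v \<eta>)
    \<longleftrightarrow> (\<forall>\<xi>. fourier h \<xi> = cauchy_rhs m f t v \<xi>)"
proof -
  have rhs: "(\<Sum>j=1..m-1. cauchy_coeff m j t * gen_pow_distr \<psi> j f \<eta>) + gen_pow_distr \<psi> m v \<eta>
      = (LINT \<xi>|lborel. cauchy_rhs m f t v \<xi> * \<eta> \<xi>)" if \<eta>: "schwartz \<eta>" for \<eta>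
  proof -
    note i = slowly_growing_integrable[OF slowly_growing_symbol_power \<eta>]
    have "(LINT \<xi>|lborel. cauchy_rhs m f t v \<xi> * \<eta> \<xi>)
        = (LINT \<xi>|lborel. (\<Sum>j=1..m-1. cauchy_coeff m j t * ((\<psi> \<xi> ^ j * fourier f \<xi>) * \<eta> \<xi>)) + (\<psi> \<xi> ^ m * fourier v \<xi>) * \<eta> \<xi>)"
      unfolding cauchy_rhs_def by (simp add: distrib_right sum_distrib_right mult.assoc)
    also have "\<dots> = (LINT \<xi>|lborel. (\<Sum>j=1..m-1. cauchy_coeff m j t * ((\<psi> \<xi> ^ j * fourier f \<xi>) * \<eta> \<xi>))) + (LINT \<xi>|lborel. (\<psi> \<xi> ^ m * fourier v \<xi>) * \<eta> \<xi>)"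
      by (intro Bochner_Integration.integral_add Bochner_Integration.integrable_sum integrable_mult_right i f v)
    also have "(LINT \<xi>|lborel. (\<Sum>j=1..m-1. cauchy_coeff m j t * ((\<psi> \<xi> ^ j * fourier f \<xi>) * \<eta> \<xi>)))
        = (\<Sum>j=1..m-1. LINT \<xi>|lborel. cauchy_coeff m j t * ((\<psi> \<xi> ^ j * fourier f \<xi>) * \<eta> \<xi>))"
      by (intro Bochner_Integration.integral_sum integrable_mult_right i f)
    finally show ?thesis
      unfolding gen_pow_distr_def inv_fourier_distr_def by (simp only: integral_mult_right_zero)
  qed
  have sg: "slowly_growing (cauchy_rhs m f t v)"
    unfolding cauchy_rhs_def
    by (intro slowly_growing_add slowly_growing_sum slowly_growing_mult[OF slowly_growing_const] slowly_growing_symbol_power f v)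
  show ?thesis
  proof
    assume *: "\<forall>\<eta>. schwartz \<eta> \<longrightarrow> distr_of_fun h \<eta> =
      (\<Sum>j=1..m-1. cauchy_coeff m j t * gen_pow_distr \<psi> j f \<eta>) + gen_pow_distr \<psi> m v \<eta>"
    have "fourier h \<xi> = cauchy_rhs m f t v \<xi>" for \<xi>
      by (rule schwartz_separating_eq[OF slowly_growing_fourier[OF h] sg])
         (metis * rhs distr_of_fun_fourier[OF h])
    then show "\<forall>\<xi>. fourier h \<xi> = cauchy_rhs m f t v \<xi>" by blast
  next
    assume *: "\<forall>\<xi>. fourier h \<xi> = cauchy_rhs m f t v \<xi>"
    show "\<forall>\<eta>. schwartz \<eta> \<longrightarrow> distr_of_fun h \<eta> =
      (\<Sum>j=1..m-1. cauchy_coeff m j t * gen_pow_distr \<psi> j f \<eta>) + gen_pow_distr \<psi> m v \<eta>"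
      using * by (auto simp only: rhs distr_of_fun_fourier[OF h])
  qed
qed

lemma fourier_evolves_derivative:
  assumes u: "evolves \<psi> k f u" and m: "m = 2 ^ k" and t: "t > 0"
  shows "((\<lambda>s. fourier (u s) \<xi>) has_vector_derivative cauchy_rhs m f t (u t) \<xi>) (at t)"
proof -
  have "((\<lambda>s. iterated_exp k (\<psi> \<xi>) s * fourier f \<xi>) has_vector_derivative
      ((\<Sum>j=1..m-1. cauchy_coeff m j t * \<psi> \<xi> ^ j) + \<psi> \<xi> ^ m * iterated_exp k (\<psi> \<xi>) t) * fourier f \<xi>) (at t)"
    by (intro has_vector_derivative_mult_left iterated_exp_has_derivative[OF Re_nonpos t m])
  moreover have "((\<Sum>j=1..m-1. cauchy_coeff m j t * \<psi> \<xi> ^ j) + \<psi> \<xi> ^ m * iterated_exp k (\<psi> \<xi>) t) * fourier f \<xi> = cauchy_rhs m f t (u t) \<xi>"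
    using evolvesD(4)[OF u less_imp_le[OF t]] by (simp add: cauchy_rhs_def sum_distrib_left algebra_simps)
  ultimately show ?thesis
    by (simp only:, rule_tac has_vector_derivative_transform_within_open[of _ _ _ "{0<..}"])
       (use t evolvesD(4)[OF u] in auto)
qed

text \<open>At each frequency the transforms of \<open>v\<close> and \<open>u\<close> solve one
  scalar linear equation with coefficient \<open>\<psi> \<xi> ^ m\<close> and an inhomogeneity fixed
  by \<open>f\<close>. Both readings of the Cauchy problem reduce to this; they differ in how
  \<open>h\<close> is obtained.\<close>

lemma cauchy_rhs_derivative_unique:
  assumes u: "evolves \<psi> k f u" and m: "m = 2 ^ k" and f: "integrable lborel f"
    and v: "L1_continuous v" and v0: "AE x in lborel. v 0 x = f x"
    and v': "\<And>t. t > 0 \<Longrightarrow> \<exists>h. has_L1_derivative v h t \<and> (\<forall>\<xi>. fourier h \<xi> = cauchy_rhs m f t (v t) \<xi>)"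
    and t: "t \<ge> 0"
  shows "AE x in lborel. v t x = u t x"
proof (rule fourier_eq_imp_AE_eq)
  have iv: "integrable lborel (v s)" if "s \<ge> 0" for s using v that by (auto simp: L1_continuous_def)
  show "integrable lborel (v t)" "integrable lborel (u t)" using iv t evolvesD(2)[OF u t] by auto
  fix \<xi>
  show "fourier (v t) \<xi> = fourier (u t) \<xi>"
  proof (rule linear_ode_unique[where y="\<lambda>t. fourier (v t) \<xi>" and z="\<lambda>t. fourier (u t) \<xi>", OF L1_continuous_fourier[OF v] _ _ _ _ t])
    have "continuous_on {0..} (\<lambda>t. iterated_exp k (\<psi> \<xi>) t * fourier f \<xi>)"
      by (intro continuous_intros continuous_on_iterated_exp Re_nonpos)
    then show "continuous_on {0..} (\<lambda>t. fourier (u t) \<xi>)"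
      by (subst continuous_on_cong[OF refl evolvesD(4)[OF u]]) auto
    have "fourier (v 0) \<xi> = fourier f \<xi>"
      by (rule fourier_cong_AE[OF v0]) (use f iv[of 0] in auto)
    then show "fourier (v 0) \<xi> = fourier (u 0) \<xi>" using evolvesD(4)[OF u, of 0] by simp
    fix s :: real assume s: "s > 0"
    obtain h where h: "has_L1_derivative v h s" "\<forall>\<xi>. fourier h \<xi> = cauchy_rhs m f s (v s) \<xi>" using v'[OF s] by blast
    show "((\<lambda>t. fourier (v t) \<xi>) has_vector_derivative (\<Sum>j=1..m-1. cauchy_coeff m j s * (\<psi> \<xi> ^ j * fourier f \<xi>)) + \<psi> \<xi> ^ m * fourier (v s) \<xi>) (at s)"
      using has_L1_derivative_fourier[OF h(1) iv s] unfolding h(2)[rule_format] cauchy_rhs_def .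
    show "((\<lambda>t. fourier (u t) \<xi>) has_vector_derivative (\<Sum>j=1..m-1. cauchy_coeff m j s * (\<psi> \<xi> ^ j * fourier f \<xi>)) + \<psi> \<xi> ^ m * fourier (u s) \<xi>) (at s)"
      using fourier_evolves_derivative[OF u m s] unfolding cauchy_rhs_def .
  qed
qed

text \<open>The heat kernel argument yields some L1 derivative without identifying it; its transform
  is then the derivative of the scalar transform, which is known.\<close>

lemma evolves_cauchy_derivative:
  assumes u: "evolves \<psi> k f u" and m: "m = 2 ^ k" and f: "integrable lborel f" and k: "k \<ge> 1" and t: "t > 0"
  shows "\<exists>h. has_L1_derivative u h t \<and> (\<forall>\<xi>. fourier h \<xi> = cauchy_rhs m f t (u t) \<xi>)"
proof -
  obtain k' where k': "k = Suc k'" using k by (cases k) auto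
  obtain h where h: "has_L1_derivative u h t"
    using evolves_has_L1_derivative[OF Re_nonpos base[OF f] u[unfolded k'] t] by blast
  have "fourier h \<xi> = cauchy_rhs m f t (u t) \<xi>" for \<xi>
    using has_L1_derivative_fourier[OF h evolvesD(2)[OF u] t, of \<xi>] fourier_evolves_derivative[OF u m t]
    by (rule vector_derivative_unique_at)
  then show ?thesis using h by blast
qed

theorem evolves_solves_cauchy:
  assumes u: "evolves \<psi> k f u" and m: "m = 2 ^ k" and k: "k \<ge> 1" and fg: "gen \<psi> f g"
  shows "unique_solution (solves_cauchy \<psi> m f) u"
  unfolding unique_solution_def
proof (intro conjI allI impI)
  have f: "integrable lborel f" using fg by (simp add: gen_def)
  obtain k' where k': "k = Suc k'" using k by (cases k) auto
  have cont: "L1_continuous u"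
    using evolves_L1_continuous[OF Re_nonpos base fg] u unfolding k' by blast
  show "solves_cauchy \<psi> m f u"
    unfolding solves_cauchy_def
  proof (intro conjI cont evolves_0[OF u f] allI impI)
    fix t :: real assume t: "t > 0"
    obtain h where h: "has_L1_derivative u h t" "\<forall>\<xi>. fourier h \<xi> = cauchy_rhs m f t (u t) \<xi>"
      using evolves_cauchy_derivative[OF u m f k t] by blast
    have "integrable lborel h" using h(1) by (simp add: has_L1_derivative_def)
    then show "\<exists>h. has_L1_derivative u h t \<and> (\<forall>\<eta>. schwartz \<eta> \<longrightarrow> distr_of_fun h \<eta> =
        (\<Sum>j=1..m-1. cauchy_coeff m j t * gen_pow_distr \<psi> j f \<eta>) + gen_pow_distr \<psi> m (u t) \<eta>)"
      using h cauchy_rhs_iff[OF _ f evolvesD(2)[OF u less_imp_le[OF t]]] by blast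
  qed
  fix v t assume v: "solves_cauchy \<psi> m f v" and t: "(t::real) \<ge> 0"
  show "AE x in lborel. v t x = u t x"
  proof (rule cauchy_rhs_derivative_unique[OF u m f _ _ _ t])
    show cv: "L1_continuous v" "AE x in lborel. v 0 x = f x" using v by (auto simp: solves_cauchy_def)
    fix s :: real assume s: "s > 0"
    then obtain h where h: "has_L1_derivative v h s" "\<forall>\<eta>. schwartz \<eta> \<longrightarrow> distr_of_fun h \<eta> =
        (\<Sum>j=1..m-1. cauchy_coeff m j s * gen_pow_distr \<psi> j f \<eta>) + gen_pow_distr \<psi> m (v s) \<eta>"
      using v unfolding solves_cauchy_def by blast
    have "integrable lborel h" "integrable lborel (v s)"
      using h(1) cv(1) s by (auto simp: has_L1_derivative_def L1_continuous_def)
    then show "\<exists>h. has_L1_derivative v h s \<and> (\<forall>\<xi>. fourier h \<xi> = cauchy_rhs m f s (v s) \<xi>)"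
      using h cauchy_rhs_iff[OF _ f] by blast
  qed
qed

text \<open>For \<open>j < m\<close> the power j of the generator at \<open>u t\<close> is the
  evolution of that power of \<open>f\<close>. As \<open>f\<close> is only placed in the domain of
  the power \<open>m - 1\<close>, the power m at \<open>u t\<close> comes from the equation: it is
  the L1 derivative minus the lower terms.\<close>

theorem evolves_solves_cauchy_strongly:
  assumes u: "evolves \<psi> k f u" and m: "m = 2 ^ k" and k: "k \<ge> 1" and fg: "gen \<psi> f g"
    and dom: "f \<in> gen_dom \<psi> (m - 1)"
  shows "unique_solution (solves_cauchy_strongly \<psi> m f) u"
  unfolding unique_solution_def
proof (intro conjI allI impI)
  have f: "integrable lborel f" using fg by (simp add: gen_def)
  have m2: "m \<ge> 2" using m k by (cases k) auto
  obtain k' where k': "k = Suc k'" using k by (cases k) auto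
  have cont: "L1_continuous u"
    using evolves_L1_continuous[OF Re_nonpos base fg] u unfolding k' by blast
  obtain Lf where Lf: "Lf 0 = f" "\<And>j. j \<le> m - 1 \<Longrightarrow> (gen \<psi> ^^ j) f (Lf j)"
    using dom gen_pow_chain unfolding gen_dom_def by blast
  have iLf: "integrable lborel (Lf j)" "fourier (Lf j) \<xi> = \<psi> \<xi> ^ j * fourier f \<xi>" if "j \<le> m - 1" for j \<xi>
    using gen_pow_fourier[OF Lf(2)[OF that] f] by auto
  show "solves_cauchy_strongly \<psi> m f u"
    unfolding solves_cauchy_strongly_def
  proof (intro conjI cont evolves_0[OF u f] allI impI)
    fix t :: real assume t: "t > 0"
    obtain h where h: "has_L1_derivative u h t" "\<And>\<xi>. fourier h \<xi> = cauchy_rhs m f t (u t) \<xi>"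
      using evolves_cauchy_derivative[OF u m f k t] by blast
    have ih: "integrable lborel h" using h(1) by (simp add: has_L1_derivative_def)
    have "\<exists>w. integrable lborel w \<and> (\<forall>\<xi>. fourier w \<xi> = iterated_exp k (\<psi> \<xi>) t * fourier (Lf j) \<xi>)" if j: "j \<le> m - 1" for j
    proof -
      obtain w where "evolves \<psi> k (Lf j) w" using ex_evolves[OF base[OF iLf(1)[OF j]]] by blast
      from evolvesD[OF this] t show ?thesis by (intro exI[of _ "w t"]) auto
    qed
    then obtain w where w: "\<And>j. j \<le> m - 1 \<Longrightarrow> integrable lborel (w j)"
      "\<And>j \<xi>. j \<le> m - 1 \<Longrightarrow> fourier (w j) \<xi> = iterated_exp k (\<psi> \<xi>) t * fourier (Lf j) \<xi>"
      by metis
    define Lv where "Lv x = h x - (\<Sum>j=1..m-1. cauchy_coeff m j t * Lf j x)" for x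
    have isum: "integrable lborel (\<lambda>x. \<Sum>j=1..m-1. cauchy_coeff m j t * Lf j x)"
      by (intro Bochner_Integration.integrable_sum integrable_mult_right iLf) auto
    have iLv: "integrable lborel Lv" unfolding Lv_def using ih isum by auto
    have "fourier (\<lambda>x. \<Sum>j=1..m-1. cauchy_coeff m j t * Lf j x) \<xi> = (\<Sum>j=1..m-1. cauchy_coeff m j t * (\<psi> \<xi> ^ j * fourier f \<xi>))" for \<xi>
      by (subst fourier_sum) (auto intro!: integrable_mult_right iLf sum.cong simp: fourier_cmult iLf(2))
    then have fLv: "fourier Lv \<xi> = \<psi> \<xi> ^ m * fourier (u t) \<xi>" for \<xi>
      unfolding Lv_def[abs_def] fourier_diff[OF ih isum] using h(2) by (simp add: cauchy_rhs_def)
    have ut: "integrable lborel (u t)" "\<And>\<xi>. fourier (u t) \<xi> = iterated_exp k (\<psi> \<xi>) t * fourier f \<xi>"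
      using evolvesD(2)[OF u, of t] evolvesD(4)[OF u, of t] t by auto
    \<comment> \<open>The chain of successive powers runs from \<open>u t\<close> through the
      evolved powers of \<open>f\<close>, with \<open>Lv\<close> as last link.\<close>
    let ?G = "\<lambda>i. if i = 0 then u t else if i = m then Lv else w i"
    have fG: "fourier (?G i) \<xi> = \<psi> \<xi> ^ i * fourier (u t) \<xi>" if "i \<le> m" for i \<xi>
      using that fLv w(2)[of i \<xi>] iLf(2)[of i \<xi>] m2 by (auto simp: ut(2))
    have "(gen \<psi> ^^ m) (?G 0) (?G m)"
    proof (rule gen_powI)
      fix i assume i: "i \<le> m"
      show "integrable lborel (?G i)" using i ut(1) iLv w(1)[of i] by auto
    next
      fix i \<xi> assume "i < m"
      then show "fourier (?G (Suc i)) \<xi> = \<psi> \<xi> * fourier (?G i) \<xi>"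
        using fG[of "Suc i" \<xi>] fG[of i \<xi>] by (simp only: Suc_leI less_imp_le power_Suc mult.assoc)
    qed
    then have "(gen \<psi> ^^ m) (u t) Lv" using m2 by simp
    then show "\<exists>h Lf Lv. has_L1_derivative u h t \<and> (\<forall>j\<in>{1..m-1}. (gen \<psi> ^^ j) f (Lf j)) \<and> (gen \<psi> ^^ m) (u t) Lv \<and>
        (AE x in lborel. h x = (\<Sum>j=1..m-1. cauchy_coeff m j t * Lf j x) + Lv x)"
      by (intro exI[of _ h] exI[of _ Lf] exI[of _ Lv]) (use h Lf in \<open>auto simp: Lv_def\<close>)
  qed
  fix v t assume v: "solves_cauchy_strongly \<psi> m f v" and t: "(t::real) \<ge> 0"
  show "AE x in lborel. v t x = u t x"
  proof (rule cauchy_rhs_derivative_unique[OF u m f _ _ _ t])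
    show cv: "L1_continuous v" "AE x in lborel. v 0 x = f x" using v by (auto simp: solves_cauchy_strongly_def)
    fix s :: real assume s: "s > 0"
    then obtain h L Lv where h: "has_L1_derivative v h s" "\<And>j. j \<in> {1..m-1} \<Longrightarrow> (gen \<psi> ^^ j) f (L j)"
      "(gen \<psi> ^^ m) (v s) Lv" "AE x in lborel. h x = (\<Sum>j=1..m-1. cauchy_coeff m j s * L j x) + Lv x"
      using v unfolding solves_cauchy_strongly_def by blast
    have ih: "integrable lborel h" and iv: "integrable lborel (v s)"
      using h(1) cv(1) s by (auto simp: has_L1_derivative_def L1_continuous_def)
    note L = gen_pow_fourier[OF h(2) f] and Lv = gen_pow_fourier[OF h(3) iv]
    have isum: "integrable lborel (\<lambda>x. \<Sum>j=1..m-1. cauchy_coeff m j s * L j x)"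
      by (intro Bochner_Integration.integrable_sum integrable_mult_right L) auto
    have "fourier h \<xi> = cauchy_rhs m f s (v s) \<xi>" for \<xi>
    proof -
      have "fourier h \<xi> = fourier (\<lambda>x. (\<Sum>j=1..m-1. cauchy_coeff m j s * L j x) + Lv x) \<xi>"
        by (rule fourier_cong_AE[OF h(4)]) (use ih isum Lv(1) in \<open>auto intro: borel_measurable_integrable simp flip: measurable_lborel1\<close>)
      also have "\<dots> = (\<Sum>j=1..m-1. fourier (\<lambda>x. cauchy_coeff m j s * L j x) \<xi>) + fourier Lv \<xi>"
        unfolding fourier_add[OF isum Lv(1)] by (subst fourier_sum) (auto intro!: integrable_mult_right L)
      also have "\<dots> = cauchy_rhs m f s (v s) \<xi>"
        unfolding cauchy_rhs_def fourier_cmult using L(2) Lv(2) by simp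
      finally show ?thesis .
    qed
    then show "\<exists>h. has_L1_derivative v h s \<and> (\<forall>\<xi>. fourier h \<xi> = cauchy_rhs m f s (v s) \<xi>)" using h(1) by blast
  qed
qed

end

section \<open>The fractional Cauchy problem by Laplace and Fourier transforms\<close>

lemma laplace_integrable_iff:
  "laplace_integrable v s \<longleftrightarrow> integrable (lborel \<Otimes>\<^sub>M lborel) (\<lambda>(t, x). indicator {0..} t *\<^sub>R exp (- s * t) *\<^sub>R v t x)"
proof -
  have "(\<lambda>p. indicator ({0..} \<times> UNIV) p *\<^sub>R (case p of (t, x) \<Rightarrow> exp (- s * t) *\<^sub>R v t x))
      = (\<lambda>(t, x). indicator {0..} t *\<^sub>R exp (- s * t) *\<^sub>R v t x)"
    by (auto simp: fun_eq_iff indicator_def)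
  then show ?thesis unfolding laplace_integrable_def set_integrable_def by (simp only:)
qed

text \<open>Integrability jointly in time and space lets the transform in x and the transform in t
  be exchanged.\<close>

lemma
  fixes v :: "real \<Rightarrow> 'a::euclidean_space \<Rightarrow> complex"
  assumes v: "laplace_integrable v s"
  shows integrable_laplace: "integrable lborel (\<lambda>x. laplace (\<lambda>t. v t x) s)"
    and fourier_laplace: "fourier (\<lambda>x. laplace (\<lambda>t. v t x) s) \<xi> = laplace (\<lambda>t. fourier (v t) \<xi>) s"
    and set_integrable_laplace_fourier: "set_integrable lborel {0..} (\<lambda>t. exp (- s * t) *\<^sub>R fourier (v t) \<xi>)"
proof -
  let ?F = "\<lambda>t x. indicator {0..} t *\<^sub>R exp (- s * t) *\<^sub>R v t x"
  have i: "integrable (lborel \<Otimes>\<^sub>M lborel) (\<lambda>(t, x). ?F t x)" using v unfolding laplace_integrable_iff .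
  have fF: "fourier (?F t) \<xi> = indicator {0..} t *\<^sub>R exp (- s * t) *\<^sub>R fourier (v t) \<xi>" for t
    by (simp only: scaleR_conv_of_real fourier_cmult)
  show "integrable lborel (\<lambda>x. laplace (\<lambda>t. v t x) s)"
    unfolding laplace_def set_lebesgue_integral_def by (rule integrable_mixture[OF lborel.sigma_finite_measure_axioms i])
  show "fourier (\<lambda>x. laplace (\<lambda>t. v t x) s) \<xi> = laplace (\<lambda>t. fourier (v t) \<xi>) s"
    unfolding laplace_def set_lebesgue_integral_def fourier_mixture[OF lborel.sigma_finite_measure_axioms i] fF ..
  have [measurable]: "(\<lambda>(t, x). ?F t x) \<in> borel_measurable (lborel \<Otimes>\<^sub>M lborel)" using i by auto
  have "integrable (lborel \<Otimes>\<^sub>M lborel) (\<lambda>(t, x). exp (- \<i> * complex_of_real (\<xi> \<bullet> x)) * ?F t x)"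
  proof (rule Bochner_Integration.integrable_bound[OF i])
    have "(\<lambda>p. exp (- \<i> * complex_of_real (\<xi> \<bullet> snd p)) * (case p of (t, x) \<Rightarrow> ?F t x)) \<in> borel_measurable (lborel \<Otimes>\<^sub>M lborel)"
      by measurable
    then show "(\<lambda>(t, x). exp (- \<i> * complex_of_real (\<xi> \<bullet> x)) * ?F t x) \<in> borel_measurable (lborel \<Otimes>\<^sub>M lborel)"
      by (simp only: split_beta')
  qed (auto simp: norm_mult)
  then have "integrable lborel (\<lambda>t. fourier (?F t) \<xi>)"
    unfolding fourier_def by (rule lborel_pair.integrable_fst)
  then show "set_integrable lborel {0..} (\<lambda>t. exp (- s * t) *\<^sub>R fourier (v t) \<xi>)"
    unfolding fF set_integrable_def .
qed

lemma laplace_cong: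
  "(\<And>t. t \<ge> 0 \<Longrightarrow> g t = h t) \<Longrightarrow> laplace g s = laplace h s"
  unfolding laplace_def by (intro set_lebesgue_integral_cong) auto

lemma laplace_mult_right: "laplace (\<lambda>t. g t * c) s = laplace g s * c"
  unfolding laplace_def by (simp only: mult_scaleR_left[symmetric] set_integral_mult_left)

text \<open>Serves the generator relation, which is imposed only for \<open>t > 0\<close>; the
  single point 0 carries no mass.\<close>

lemma laplace_cong_pos:
  assumes g: "set_integrable lborel {0..} (\<lambda>t. exp (- s * t) *\<^sub>R g t)"
    and h: "set_integrable lborel {0..} (\<lambda>t. exp (- s * t) *\<^sub>R h t)"
    and eq: "\<And>t. t > 0 \<Longrightarrow> g t = h t"
  shows "laplace g s = laplace h s"
  unfolding laplace_def set_lebesgue_integral_def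
proof (rule integral_cong_AE)
  show "AE t in lborel. indicator {0..} t *\<^sub>R exp (- s * t) *\<^sub>R g t = indicator {0..} t *\<^sub>R exp (- s * t) *\<^sub>R h t"
    using AE_lborel_singleton[of "0::real"]
  proof eventually_elim
    case (elim t)
    show ?case using elim eq[of t] by (cases "t \<ge> 0") auto
  qed
qed (use g h in \<open>auto simp: set_integrable_def simp del: scaleR_scaleR\<close>)

text \<open>For \<open>y = b / (a - z) * c\<close> this is \<open>y * z = a * y - b * c\<close>, the
  fractional equation after both transforms, and it gives existence. The converse in
  \<open>resolvent_solve\<close> gives uniqueness.\<close>

lemma resolvent_identity:
  fixes a z :: "'a::field"
  shows "a - z \<noteq> 0 \<Longrightarrow> b / (a - z) * (z * c) = a * (b / (a - z) * c) - b * c"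
  by (simp add: divide_simps) (simp add: algebra_simps)

lemma resolvent_solve:
  fixes a z :: "'a::field"
  assumes "a - z \<noteq> 0" "y * z = a * y - b * c"
  shows "y = b / (a - z) * c"
proof -
  have "y * (a - z) = b * c" using assms(2) by (simp add: algebra_simps)
  then show ?thesis using assms(1) by (simp add: eq_divide_eq)
qed

context evolution
begin

lemma evolves_laplace_integrable:
  assumes u: "evolves \<psi> k f u" and s: "s > 0"
  shows "laplace_integrable u s"
proof -
  have w: "integrable lborel (\<lambda>t. indicator {0..} t *\<^sub>R exp (- s * t))"
    using integrable_exp_Ici[OF s] by (simp add: set_integrable_def)
  have "integrable (lborel \<Otimes>\<^sub>M lborel) (\<lambda>(t, x). (indicator {0..} t *\<^sub>R exp (- s * t)) *\<^sub>R u \<bar>t\<bar> x)"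
    by (rule integrable_evolves_weighted[OF u w]) auto
  moreover have "(\<lambda>(t, x). (indicator {0..} t *\<^sub>R exp (- s * t)) *\<^sub>R u \<bar>t\<bar> x) = (\<lambda>(t, x). indicator {0..} t *\<^sub>R exp (- s * t) *\<^sub>R u t x)"
    by (auto simp: fun_eq_iff indicator_def)
  ultimately show ?thesis unfolding laplace_integrable_iff by (simp only:)
qed

lemma laplace_fourier_evolves:
  assumes u: "evolves \<psi> k f u" and s: "s > 0" and m: "m = 2 ^ k"
  shows "laplace (\<lambda>t. fourier (u t) \<xi>) s
    = complex_of_real (s powr (1 / real m - 1)) / (complex_of_real (s powr (1 / real m)) - \<psi> \<xi>) * fourier f \<xi>"
proof -
  have "laplace (\<lambda>t. fourier (u t) \<xi>) s = laplace (\<lambda>t. iterated_exp k (\<psi> \<xi>) t * fourier f \<xi>) s"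
    by (rule laplace_cong) (rule evolvesD(4)[OF u])
  also have "\<dots> = laplace (iterated_exp k (\<psi> \<xi>)) s * fourier f \<xi>" by (rule laplace_mult_right)
  finally show ?thesis using laplace_iterated_exp[OF Re_nonpos s] m by simp
qed

text \<open>The symbol stays in the closed left half plane and \<open>s powr b\<close> is positive,
  so the resolvent meets no pole.\<close>

lemma powr_minus_symbol_nonzero: "s > 0 \<Longrightarrow> complex_of_real (s powr b) - \<psi> \<xi> \<noteq> 0"
proof
  assume s: "s > 0" and "complex_of_real (s powr b) - \<psi> \<xi> = 0"
  then have "Re (\<psi> \<xi>) = s powr b" by (metis Re_complex_of_real eq_iff_diff_eq_0)
  then show False using Re_nonpos[of \<xi>] s by simp
qed

text \<open>The generator and the evolution are both Fourier multipliers and commute, so the Caputo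
  derivative of \<open>u\<close> is the evolution started from \<open>g\<close> in place of
  \<open>f\<close>.\<close>

theorem evolves_solves_fractional_cauchy:
  assumes u: "evolves \<psi> k f u" and m: "m = 2 ^ k" and k: "k \<ge> 1" and fg: "gen \<psi> f g"
  shows "unique_solution (solves_fractional_cauchy \<psi> (1 / real m) f) u"
  unfolding unique_solution_def
proof (intro conjI allI impI)
  let ?b = "1 / real m"
  have f: "integrable lborel f" and g: "integrable lborel g" and ghat: "\<And>\<xi>. fourier g \<xi> = \<psi> \<xi> * fourier f \<xi>"
    using fg by (auto simp: gen_def)
  obtain k' where k': "k = Suc k'" using k by (cases k) auto
  have cont: "L1_continuous u"
    using evolves_L1_continuous[OF Re_nonpos base fg] u unfolding k' by blast
  obtain h where h: "evolves \<psi> k g h" using ex_evolves[OF base[OF g]] by blast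
  show "solves_fractional_cauchy \<psi> ?b f u"
    unfolding solves_fractional_cauchy_def
  proof (intro conjI cont evolves_0[OF u f] exI[of _ h] allI impI)
    show "gen \<psi> (u t) (h t)" if "t > 0" for t
      using that evolvesD(2)[OF u, of t] evolvesD(2)[OF h, of t] evolvesD(4)[OF u, of t] evolvesD(4)[OF h, of t]
      by (auto simp: gen_def ghat)
    show "has_caputo_derivative ?b u h"
      unfolding has_caputo_derivative_def
    \<comment> \<open>Bounded L1 norms give Laplace transforms at every \<open>s > 0\<close>, hence
      the threshold 0.\<close>
    proof (intro exI[of _ 0] conjI allI impI order_refl)
      fix s :: real assume s: "s > 0"
      show iu: "laplace_integrable u s" and ih: "laplace_integrable h s"
        using evolves_laplace_integrable[OF u s] evolves_laplace_integrable[OF h s] by auto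
      have i1: "integrable lborel (\<lambda>x. complex_of_real (s powr ?b) * laplace (\<lambda>t. u t x) s)"
        by (rule integrable_mult_right[OF integrable_laplace[OF iu]])
      have i2: "integrable lborel (\<lambda>x. complex_of_real (s powr (?b - 1)) * u 0 x)"
        by (rule integrable_mult_right[OF evolvesD(2)[OF u order_refl]])
      show "AE x in lborel. laplace (\<lambda>t. h t x) s = complex_of_real (s powr ?b) * laplace (\<lambda>t. u t x) s - complex_of_real (s powr (?b - 1)) * u 0 x"
      proof (rule fourier_eq_imp_AE_eq[OF integrable_laplace[OF ih] Bochner_Integration.integrable_diff[OF i1 i2]])
        fix \<xi>
        have u0: "fourier (u 0) \<xi> = fourier f \<xi>" using evolvesD(4)[OF u, of 0] by simp
        show "fourier (\<lambda>x. laplace (\<lambda>t. h t x) s) \<xi>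
            = fourier (\<lambda>x. complex_of_real (s powr ?b) * laplace (\<lambda>t. u t x) s - complex_of_real (s powr (?b - 1)) * u 0 x) \<xi>"
          unfolding fourier_diff[OF i1 i2] fourier_cmult fourier_laplace[OF iu] fourier_laplace[OF ih]
            laplace_fourier_evolves[OF u s m] laplace_fourier_evolves[OF h s m] ghat u0
          by (rule resolvent_identity[OF powr_minus_symbol_nonzero[OF s]])
      qed
    qed
  qed
  fix v t assume v: "solves_fractional_cauchy \<psi> ?b f v" and t: "(t::real) \<ge> 0"
  then obtain w a where cv: "L1_continuous v" and v0: "AE x in lborel. v 0 x = f x"
    and gw: "\<And>t. t > 0 \<Longrightarrow> gen \<psi> (v t) (w t)" and a: "a \<ge> 0"
    and cap: "\<And>s. s > a \<Longrightarrow> laplace_integrable v s" "\<And>s. s > a \<Longrightarrow> laplace_integrable w s"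
      "\<And>s. s > a \<Longrightarrow> AE x in lborel. laplace (\<lambda>t. w t x) s = complex_of_real (s powr ?b) * laplace (\<lambda>t. v t x) s - complex_of_real (s powr (?b - 1)) * v 0 x"
    unfolding solves_fractional_cauchy_def has_caputo_derivative_def by blast
  have iv: "integrable lborel (v s)" if "s \<ge> 0" for s using cv that by (auto simp: L1_continuous_def)
  show "AE x in lborel. v t x = u t x"
  proof (rule fourier_eq_imp_AE_eq[OF iv[OF t] evolvesD(2)[OF u t]])
    fix \<xi>
    show "fourier (v t) \<xi> = fourier (u t) \<xi>"
    proof (rule laplace_eq_imp_eq[where a=a and g="\<lambda>t. fourier (v t) \<xi>" and h="\<lambda>t. fourier (u t) \<xi>", OF L1_continuous_fourier[OF cv] L1_continuous_fourier[OF cont] _ _ _ t])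
      fix s assume s: "s > a"
      then have s0: "s > 0" using a by simp
      note i = cap(1,2)[OF s]
      show "set_integrable lborel {0..} (\<lambda>t. exp (- s * t) *\<^sub>R fourier (v t) \<xi>)"
        by (rule set_integrable_laplace_fourier[OF i(1)])
      show "set_integrable lborel {0..} (\<lambda>t. exp (- s * t) *\<^sub>R fourier (u t) \<xi>)"
        by (rule set_integrable_laplace_fourier[OF evolves_laplace_integrable[OF u s0]])
      have i1: "integrable lborel (\<lambda>x. complex_of_real (s powr ?b) * laplace (\<lambda>t. v t x) s)"
        by (rule integrable_mult_right[OF integrable_laplace[OF i(1)]])
      have i2: "integrable lborel (\<lambda>x. complex_of_real (s powr (?b - 1)) * v 0 x)"
        by (rule integrable_mult_right[OF iv[OF order_refl]])
      have v0f: "fourier (v 0) \<xi> = fourier f \<xi>"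
        by (rule fourier_cong_AE[OF v0]) (use f iv[of 0] in auto)
      let ?V = "laplace (\<lambda>t. fourier (v t) \<xi>) s"
      have "laplace (\<lambda>t. fourier (w t) \<xi>) s = laplace (\<lambda>t. fourier (v t) \<xi> * \<psi> \<xi>) s"
      proof (rule laplace_cong_pos[OF set_integrable_laplace_fourier[OF i(2)]])
        show "set_integrable lborel {0..} (\<lambda>t. exp (- s * t) *\<^sub>R (fourier (v t) \<xi> * \<psi> \<xi>))"
          using set_integrable_laplace_fourier[OF i(1)] unfolding mult_scaleR_left[symmetric] by (intro set_integrable_mult_left)
        show "fourier (w t) \<xi> = fourier (v t) \<xi> * \<psi> \<xi>" if "t > 0" for t
          using gw[OF that] by (simp add: gen_def mult.commute)
      qed
      also have "\<dots> = ?V * \<psi> \<xi>" by (rule laplace_mult_right)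
      finally have W: "fourier (\<lambda>x. laplace (\<lambda>t. w t x) s) \<xi> = ?V * \<psi> \<xi>" by (simp only: fourier_laplace[OF i(2)])
      have "fourier (\<lambda>x. laplace (\<lambda>t. w t x) s) \<xi>
          = fourier (\<lambda>x. complex_of_real (s powr ?b) * laplace (\<lambda>t. v t x) s - complex_of_real (s powr (?b - 1)) * v 0 x) \<xi>"
        by (rule fourier_cong_AE[OF cap(3)[OF s]
              borel_measurable_integrable[OF integrable_laplace[OF i(2)], unfolded measurable_lborel2]
              borel_measurable_integrable[OF Bochner_Integration.integrable_diff[OF i1 i2], unfolded measurable_lborel2]])
      then have "?V * \<psi> \<xi> = complex_of_real (s powr ?b) * ?V - complex_of_real (s powr (?b - 1)) * fourier f \<xi>"
        unfolding W fourier_diff[OF i1 i2] fourier_cmult fourier_laplace[OF i(1)] v0f .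
      then have "?V = complex_of_real (s powr (?b - 1)) / (complex_of_real (s powr ?b) - \<psi> \<xi>) * fourier f \<xi>"
        by (rule resolvent_solve[OF powr_minus_symbol_nonzero[OF s0]])
      then show "?V = laplace (\<lambda>t. fourier (u t) \<xi>) s"
        using laplace_fourier_evolves[OF u s0 m] by simp
    qed
  qed
qed

theorem evolves_unique_solution_of_both:
  assumes "evolves \<psi> k f u" "m = 2 ^ k" "k \<ge> 1" "f \<in> gen_dom \<psi> 1"
  shows "unique_solution_of_both \<psi> m f u"
proof -
  obtain g where g: "gen \<psi> f g" using assms(4) by (auto simp: gen_dom_def)
  show ?thesis
    unfolding unique_solution_of_both_def
    by (intro conjI impI evolves_solves_cauchy[OF assms(1-3) g] evolves_solves_cauchy_strongly[OF assms(1-3) g]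
        evolves_solves_fractional_cauchy[OF assms(1-3) g])
qed

end

section \<open>Iterated processes\<close>

text \<open>The time is approximated from the right by a grid of countably many values, on each of
  which only one random variable is involved. The modulus extends a process on
  \<open>t \<ge> 0\<close> to all real times.\<close>

lemma right_continuous_joint_measurable:
  fixes X :: "real \<Rightarrow> 'w \<Rightarrow> 'b::metric_space"
  assumes X: "\<And>t. t \<ge> 0 \<Longrightarrow> X t \<in> borel_measurable N"
    and rc: "\<And>\<omega> t. \<omega> \<in> space N \<Longrightarrow> t \<ge> 0 \<Longrightarrow> ((\<lambda>s. X s \<omega>) \<longlongrightarrow> X t \<omega>) (at_right t)"
  shows "(\<lambda>(t, \<omega>). X \<bar>t\<bar> \<omega>) \<in> borel_measurable (borel \<Otimes>\<^sub>M N)"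
proof (rule borel_measurable_LIMSEQ_metric)
  \<comment> \<open>The added 1 puts the grid point strictly to the right of
    \<open>\<bar>t\<bar>\<close> even when \<open>\<bar>t\<bar>\<close> is itself on the grid, as a
    limit along \<open>at_right\<close> demands.\<close>
  let ?s = "\<lambda>i t. (real (nat \<lfloor>real (Suc i) * \<bar>t\<bar>\<rfloor>) + 1) / real (Suc i)"
  show "(\<lambda>(t, \<omega>). X (?s i t) \<omega>) \<in> borel_measurable (borel \<Otimes>\<^sub>M N)" for i
  proof -
    have "(\<lambda>p. X ((real (nat \<lfloor>real (Suc i) * \<bar>fst p\<bar>\<rfloor>) + 1) / real (Suc i)) (snd p)) \<in> borel_measurable (borel \<Otimes>\<^sub>M N)"
    proof (rule measurable_compose_countable[where f="\<lambda>j p. X ((real j + 1) / real (Suc i)) (snd p)"])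
      fix j :: nat
      have [measurable]: "X ((real j + 1) / real (Suc i)) \<in> borel_measurable N" by (rule X) simp
      show "(\<lambda>p. X ((real j + 1) / real (Suc i)) (snd p)) \<in> borel_measurable (borel \<Otimes>\<^sub>M N)" by measurable
    qed measurable
    then show ?thesis by (simp add: split_beta')
  qed
  fix p :: "real \<times> 'w" assume p: "p \<in> space (borel \<Otimes>\<^sub>M N)"
  obtain t \<omega> where t: "p = (t, \<omega>)" by (cases p)
  then have \<omega>: "\<omega> \<in> space N" using p by (auto simp: space_pair_measure)
  have b: "\<bar>t\<bar> < ?s i t" "?s i t \<le> \<bar>t\<bar> + 1 / real (Suc i)" for i
  proof -
    have n: "real (nat \<lfloor>real (Suc i) * \<bar>t\<bar>\<rfloor>) = real_of_int \<lfloor>real (Suc i) * \<bar>t\<bar>\<rfloor>" by simp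
    have "real (Suc i) * \<bar>t\<bar> < real (nat \<lfloor>real (Suc i) * \<bar>t\<bar>\<rfloor>) + 1" unfolding n by linarith
    then show "\<bar>t\<bar> < ?s i t" by (subst pos_less_divide_eq) (auto simp: mult.commute)
    have "real (nat \<lfloor>real (Suc i) * \<bar>t\<bar>\<rfloor>) + 1 \<le> real (Suc i) * \<bar>t\<bar> + 1" unfolding n by linarith
    then have "?s i t \<le> (real (Suc i) * \<bar>t\<bar> + 1) / real (Suc i)" by (rule divide_right_mono) simp
    also have "\<dots> = \<bar>t\<bar> + 1 / real (Suc i)" by (simp add: add_divide_distrib del: of_nat_Suc)
    finally show "?s i t \<le> \<bar>t\<bar> + 1 / real (Suc i)" .
  qed
  have "(\<lambda>i. ?s i t) \<longlonglongrightarrow> \<bar>t\<bar>"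
  proof (rule real_tendsto_sandwich[OF _ _ tendsto_const])
    have "(\<lambda>i. \<bar>t\<bar> + 1 / real (Suc i)) \<longlonglongrightarrow> \<bar>t\<bar> + 0"
      by (intro tendsto_intros LIMSEQ_Suc[OF lim_1_over_n])
    then show "(\<lambda>i. \<bar>t\<bar> + 1 / real (Suc i)) \<longlonglongrightarrow> \<bar>t\<bar>" by simp
  qed (use b in \<open>auto intro!: always_eventually less_imp_le\<close>)
  then have "filterlim (\<lambda>i. ?s i t) (at_right \<bar>t\<bar>) sequentially"
    unfolding filterlim_at using b by (auto intro!: always_eventually simp: less_imp_neq[symmetric])
  from filterlim_compose[OF rc[OF \<omega>] this]
  show "(\<lambda>i. case p of (t, \<omega>) \<Rightarrow> X (?s i t) \<omega>) \<longlonglongrightarrow> (case p of (t, \<omega>) \<Rightarrow> X \<bar>t\<bar> \<omega>)"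
    unfolding t by simp
qed

lemma sigma_algebra_process_sigma: "sigma_algebra (space M) (process_sigma M T X)"
  unfolding process_sigma_def by (rule sigma_algebra_sigma_sets) auto

lemma measurable_process_sigma:
  assumes "t \<in> T"
  shows "X t \<in> borel_measurable (sigma (space M) (process_sigma M T X))"
proof (rule measurableI)
  fix A :: "'b set" assume "A \<in> sets borel"
  then have "X t -` A \<inter> space M \<in> process_sigma M T X"
    unfolding process_sigma_def using assms by (intro sigma_sets.Basic) auto
  then show "X t -` A \<inter> space (sigma (space M) (process_sigma M T X)) \<in> sets (sigma (space M) (process_sigma M T X))"
    using sigma_algebra.sigma_sets_eq[OF sigma_algebra_process_sigma[of M T X]]
      sigma_algebra.axioms(1)[OF sigma_algebra_process_sigma[of M T X]]
    by (simp add: space_measure_of_conv sets_measure_of_conv)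
       (metis algebra_iff_Int)
qed simp

text \<open>At time 0 the two-sided process shows \<open>P\<close>, so its sigma-algebra does not
  observe \<open>Q 0\<close>; the constant value \<open>c\<close> makes \<open>Q 0\<close>
  measurable nevertheless.\<close>

lemma two_sided_joint_measurable:
  fixes P Q :: "real \<Rightarrow> 'w \<Rightarrow> 'b::metric_space"
  assumes P: "\<And>\<omega> t. \<omega> \<in> space M \<Longrightarrow> t \<ge> 0 \<Longrightarrow> ((\<lambda>s. P s \<omega>) \<longlongrightarrow> P t \<omega>) (at_right t)"
    and Q: "\<And>\<omega> t. \<omega> \<in> space M \<Longrightarrow> t \<ge> 0 \<Longrightarrow> ((\<lambda>s. Q s \<omega>) \<longlongrightarrow> Q t \<omega>) (at_right t)"
    and Q0: "\<And>\<omega>. \<omega> \<in> space M \<Longrightarrow> Q 0 \<omega> = c"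
  shows "(\<lambda>(t, \<omega>). two_sided P Q t \<omega>) \<in> borel_measurable (borel \<Otimes>\<^sub>M sigma (space M) (process_sigma M UNIV (two_sided P Q)))"
proof -
  let ?N = "sigma (space M) (process_sigma M UNIV (two_sided P Q))"
  have sp: "space ?N = space M" by (simp add: space_measure_of_conv)
  have Z: "two_sided P Q t \<in> borel_measurable ?N" for t by (rule measurable_process_sigma) simp
  have mP: "P t \<in> borel_measurable ?N" if "t \<ge> 0" for t
    using Z[of t] that by (simp add: two_sided_def[abs_def])
  have mQ: "Q t \<in> borel_measurable ?N" if "t \<ge> 0" for t
  proof (cases "t = 0")
    case True
    have "(\<lambda>_. c) \<in> borel_measurable ?N" by simp
    then show ?thesis unfolding True by (rule measurable_cong[THEN iffD1, rotated]) (simp add: Q0 sp)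
  next
    case False
    then show ?thesis using Z[of "- t"] that by (simp add: two_sided_def[abs_def])
  qed
  have [measurable]: "(\<lambda>(t, \<omega>). P \<bar>t\<bar> \<omega>) \<in> borel_measurable (borel \<Otimes>\<^sub>M ?N)"
    by (rule right_continuous_joint_measurable[OF mP]) (auto simp: sp P)
  have [measurable]: "(\<lambda>(t, \<omega>). Q \<bar>t\<bar> \<omega>) \<in> borel_measurable (borel \<Otimes>\<^sub>M ?N)"
    by (rule right_continuous_joint_measurable[OF mQ]) (auto simp: sp Q)
  have "(\<lambda>p. if 0 \<le> fst p then (case p of (t, \<omega>) \<Rightarrow> P \<bar>t\<bar> \<omega>) else (case p of (t, \<omega>) \<Rightarrow> Q \<bar>t\<bar> \<omega>)) \<in> borel_measurable (borel \<Otimes>\<^sub>M ?N)"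
    by measurable
  moreover have "(\<lambda>p. if 0 \<le> fst p then (case p of (t, \<omega>) \<Rightarrow> P \<bar>t\<bar> \<omega>) else (case p of (t, \<omega>) \<Rightarrow> Q \<bar>t\<bar> \<omega>)) = (\<lambda>(t, \<omega>). two_sided P Q t \<omega>)"
    by (auto simp: fun_eq_iff two_sided_def)
  ultimately show ?thesis by simp
qed

section \<open>Independence and conditioning on the time change\<close>

context prob_space
begin

text \<open>By independence, the joint law of \<open>S\<close> and of the identity map into the
  space with sigma-algebra \<open>B\<close> is a product, and Fubini applies. Taking the sample
  point itself as second coordinate avoids a path space: \<open>V\<close> only has to be jointly
  measurable over \<open>B\<close>.\<close>

lemma indep_expectation_freeze:
  fixes g :: "'b::topological_space \<Rightarrow> complex" and V :: "'c::topological_space \<Rightarrow> 'a \<Rightarrow> 'b"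
  assumes indep: "indep_set A B"
    and A: "sigma_algebra (space M) A" and B: "sigma_algebra (space M) B"
    and S: "S \<in> borel_measurable (sigma (space M) A)"
    and V: "(\<lambda>(l, \<omega>). V l \<omega>) \<in> borel_measurable (borel \<Otimes>\<^sub>M sigma (space M) B)"
    and [measurable]: "g \<in> borel_measurable borel" and g: "\<And>x. norm (g x) \<le> 1"
  shows "(LINT \<omega>|M. g (V (S \<omega>) \<omega>)) = (LINT \<omega>|M. LINT \<omega>'|M. g (V (S \<omega>) \<omega>'))"
proof -
  let ?N = "sigma (space M) B"
  have AM: "A \<subseteq> sets M" and BM: "B \<subseteq> sets M"
    using indep unfolding indep_sets2_eq by auto
  have sA: "sets (sigma (space M) A) = A" and sB: "sets ?N = B" and spA: "space (sigma (space M) A) = space M" and spB: "space ?N = space M"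
    using sigma_algebra.sigma_sets_eq[OF A] sigma_algebra.sigma_sets_eq[OF B] AM BM sets.space_closed[of M]
    by (auto simp: space_measure_of_conv sets_measure_of_conv)
  have SM[measurable]: "S \<in> borel_measurable M"
    using S AM sA by (auto simp: measurable_def space_measure_of_conv)
  have idM[measurable]: "(\<lambda>\<omega>. \<omega>) \<in> measurable M ?N"
  proof (rule measurableI)
    fix X assume "X \<in> sets ?N"
    then have "X \<in> sets M" using BM sB by auto
    then show "(\<lambda>\<omega>. \<omega>) -` X \<inter> space M \<in> sets M" by simp
  qed (simp add: spB)
  interpret D1: prob_space "distr M borel S" by (rule prob_space_distr) measurable
  interpret D2: prob_space "distr M ?N (\<lambda>\<omega>. \<omega>)" by (rule prob_space_distr) measurable
  interpret D: pair_prob_space "distr M borel S" "distr M ?N (\<lambda>\<omega>. \<omega>)" ..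
  have dist: "distr M borel S \<Otimes>\<^sub>M distr M ?N (\<lambda>\<omega>. \<omega>) = distr M (borel \<Otimes>\<^sub>M ?N) (\<lambda>\<omega>. (S \<omega>, \<omega>))"
  proof (rule pair_measure_eqI)
    fix X Y assume "X \<in> sets (distr M borel S)" "Y \<in> sets (distr M ?N (\<lambda>\<omega>. \<omega>))"
    then have X[measurable]: "X \<in> sets borel" and Y: "Y \<in> sets ?N" by auto
    have SX: "S -` X \<inter> space M \<in> A" using measurable_sets[OF S X] by (simp add: sA spA)
    have YB: "Y \<in> B" and Ysp: "Y \<subseteq> space M" using Y sB sets.sets_into_space[OF Y] by (auto simp: spB)
    have "emeasure (distr M (borel \<Otimes>\<^sub>M ?N) (\<lambda>\<omega>. (S \<omega>, \<omega>))) (X \<times> Y) = emeasure M ((S -` X \<inter> space M) \<inter> Y)"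
      by (subst emeasure_distr) (use Y Ysp in \<open>auto intro!: arg_cong[where f="emeasure M"]\<close>)
    also have "\<dots> = emeasure M (S -` X \<inter> space M) * emeasure M Y"
      unfolding emeasure_eq_measure using indep SX YB
      by (subst indep_setD[OF indep SX YB]) (auto simp: ennreal_mult)
    also have "\<dots> = emeasure (distr M borel S) X * emeasure (distr M ?N (\<lambda>\<omega>. \<omega>)) Y"
      using Y Ysp by (simp add: emeasure_distr Int_absorb2)
    finally show "emeasure (distr M borel S) X * emeasure (distr M ?N (\<lambda>\<omega>. \<omega>)) Y = emeasure (distr M (borel \<Otimes>\<^sub>M ?N) (\<lambda>\<omega>. (S \<omega>, \<omega>))) (X \<times> Y)" by simp
  qed (auto intro: D1.sigma_finite_measure_axioms D2.sigma_finite_measure_axioms cong: sets_pair_measure_cong)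
  note [measurable] = V
  have gV[measurable]: "(\<lambda>(l, \<omega>). g (V l \<omega>)) \<in> borel_measurable (borel \<Otimes>\<^sub>M ?N)"
  proof -
    have "(\<lambda>p. g (case p of (l, \<omega>) \<Rightarrow> V l \<omega>)) \<in> borel_measurable (borel \<Otimes>\<^sub>M ?N)" by measurable
    then show ?thesis by (simp add: split_beta')
  qed
  have int: "integrable (distr M borel S \<Otimes>\<^sub>M distr M ?N (\<lambda>\<omega>. \<omega>)) (\<lambda>(l, \<omega>). g (V l \<omega>))"
    by (rule D.integrable_const_bound[where B=1]) (use g in \<open>auto simp: split_beta' intro!: gV[unfolded split_beta']\<close>)
  have [measurable]: "(\<lambda>l. LINT \<omega>'|M. g (V l \<omega>')) \<in> borel_measurable borel"
  proof -
    have "(\<lambda>(l, \<omega>). g (V l \<omega>)) \<in> borel_measurable (borel \<Otimes>\<^sub>M M)"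
    proof -
      have "(\<lambda>p. (\<lambda>(l, \<omega>). g (V l \<omega>)) (fst p, snd p)) \<in> borel_measurable (borel \<Otimes>\<^sub>M M)"
        by (rule measurable_compose[OF measurable_Pair[OF measurable_fst measurable_compose[OF measurable_snd idM]] gV])
      then show ?thesis by (simp add: split_beta')
    qed
    then show ?thesis by (intro borel_measurable_lebesgue_integral) (simp add: split_beta')
  qed
  have "(LINT \<omega>|M. g (V (S \<omega>) \<omega>)) = (LINT p|distr M (borel \<Otimes>\<^sub>M ?N) (\<lambda>\<omega>. (S \<omega>, \<omega>)). (\<lambda>(l, \<omega>). g (V l \<omega>)) p)"
    by (subst integral_distr) (auto intro: gV)
  also have "\<dots> = (LINT l|distr M borel S. LINT \<omega>'|distr M ?N (\<lambda>\<omega>. \<omega>). g (V l \<omega>'))"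
    unfolding dist[symmetric] by (rule D.integral_fst[OF int, symmetric])
  also have "\<dots> = (LINT l|distr M borel S. LINT \<omega>'|M. g (V l \<omega>'))"
  proof (rule Bochner_Integration.integral_cong[OF refl])
    fix l :: 'c
    have "(\<lambda>\<omega>. g (V l \<omega>)) \<in> borel_measurable ?N"
      using measurable_Pair2[OF gV, of l] by simp
    then show "(LINT \<omega>'|distr M ?N (\<lambda>\<omega>. \<omega>). g (V l \<omega>')) = (LINT \<omega>'|M. g (V l \<omega>'))"
      by (rule integral_distr[OF idM])
  qed
  also have "\<dots> = (LINT \<omega>|M. LINT \<omega>'|M. g (V (S \<omega>) \<omega>'))"
    by (subst integral_distr) auto
  finally show ?thesis .
qed

lemma iterated_joint_measurable:
  assumes "\<And>i. i \<in> {1..k} \<Longrightarrow> (\<lambda>(t, \<omega>). Y i t \<omega>) \<in> borel_measurable (borel \<Otimes>\<^sub>M N)"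
  shows "(\<lambda>(t, \<omega>). iterated Y k t \<omega>) \<in> borel_measurable (borel \<Otimes>\<^sub>M N)"
  using assms
proof (induction k)
  case 0
  show ?case by (simp add: split_beta')
next
  case (Suc k)
  have [measurable]: "(\<lambda>(t, \<omega>). iterated Y k t \<omega>) \<in> borel_measurable (borel \<Otimes>\<^sub>M N)"
    "(\<lambda>(t, \<omega>). Y (Suc k) t \<omega>) \<in> borel_measurable (borel \<Otimes>\<^sub>M N)"
    by (rule Suc.IH; use Suc.prems in auto) (use Suc.prems in auto)
  have "(\<lambda>p. (\<lambda>(t, \<omega>). iterated Y k t \<omega>) ((\<lambda>(t, \<omega>). Y (Suc k) t \<omega>) p, snd p)) \<in> borel_measurable (borel \<Otimes>\<^sub>M N)"
    by measurable
  then show ?case by (simp add: split_beta')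
qed

text \<open>The hypothesis \<open>law\<close> says that \<open>\<bar>Y i t\<bar>\<close> is distributed as \<open>\<bar>N\<bar>\<close> with \<open>N\<close> normal of variance \<open>2 * \<bar>t\<bar>\<close>.\<close>

lemma expectation_iterated_exp:
  assumes A: "\<And>i. i \<in> {1..k} \<Longrightarrow> sigma_algebra (space M) (A i)"
    and indep: "indep_sets A {1..k}"
    and Y: "\<And>i. i \<in> {1..k} \<Longrightarrow> (\<lambda>(t, \<omega>). Y i t \<omega>) \<in> borel_measurable (borel \<Otimes>\<^sub>M sigma (space M) (A i))"
    and law: "\<And>i t h. i \<in> {1..k} \<Longrightarrow> (\<lambda>r. h \<bar>r\<bar>) \<in> borel_measurable borel \<Longrightarrow>
        (LINT \<omega>|M. h \<bar>Y i t \<omega>\<bar>) = (LINT y|lborel. std_normal_density y *\<^sub>R (h (sqrt (2 * \<bar>t\<bar>) * \<bar>y\<bar>) :: complex))"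
    and z: "Re z \<le> 0"
  shows "(LINT \<omega>|M. exp (complex_of_real \<bar>iterated Y k t \<omega>\<bar> * z)) = iterated_exp k z \<bar>t\<bar>"
  using A indep Y law
proof (induction k arbitrary: t)
  case 0
  show ?case by (simp add: prob_space)
next
  case (Suc k)
  \<comment> \<open>\<open>Y (Suc k)\<close> is the layer evaluated at the deterministic time t. Its
    value is frozen, and the remaining layers generate \<open>?C\<close>.\<close>
  let ?C = "sigma_sets (space M) (\<Union>i\<in>{1..k}. A i)"
  have Apow: "A i \<subseteq> Pow (space M)" if "i \<in> {1..Suc k}" for i
    using Suc.prems(1)[OF that] by (simp add: sigma_algebra_iff2)
  have sA: "sigma_sets (space M) (A i) = A i" if "i \<in> {1..Suc k}" for i
    by (rule sigma_algebra.sigma_sets_eq[OF Suc.prems(1)[OF that]])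
  let ?J = "\<lambda>b::bool. if b then {Suc k} else {1..k}"
  have "indep_sets (\<lambda>b. sigma_sets (space M) (\<Union>i\<in>?J b. A i)) UNIV"
  proof (rule indep_sets_collect_sigma)
    have "(\<Union>b\<in>UNIV. ?J b) = {1..Suc k}" by (auto simp: UNIV_bool)
    then show "indep_sets A (\<Union>b\<in>UNIV. ?J b)" using Suc.prems(2) by (simp only:)
    show "Int_stable (A i)" if "i \<in> ?J b" for i b
    proof -
      have "i \<in> {1..Suc k}" using that by (auto split: if_splits)
      then interpret sigma_algebra "space M" "A i" by (rule Suc.prems(1))
      show ?thesis by (auto simp: Int_stable_def)
    qed
    show "disjoint_family_on ?J UNIV" by (auto simp: disjoint_family_on_def)
  qed
  then have "indep_set (A (Suc k)) ?C"
    using sA[of "Suc k"] unfolding indep_set_def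
    by (elim indep_sets_mono_sets) (auto split: bool.splits if_splits)
  moreover have sC: "sigma_algebra (space M) ?C"
    by (rule sigma_algebra_sigma_sets) (use Apow in fastforce)
  moreover have mS: "Y (Suc k) t \<in> borel_measurable (sigma (space M) (A (Suc k)))"
    using measurable_Pair2[OF Suc.prems(3)[of "Suc k"], of t] by simp
  moreover have "(\<lambda>(t, \<omega>). iterated Y k t \<omega>) \<in> borel_measurable (borel \<Otimes>\<^sub>M sigma (space M) ?C)"
  proof (rule iterated_joint_measurable)
    fix i assume i: "i \<in> {1..k}"
    have "(\<lambda>\<omega>. \<omega>) \<in> measurable (sigma (space M) ?C) (sigma (space M) (A i))"
    proof (rule measurableI)
      fix X assume "X \<in> sets (sigma (space M) (A i))"
      then have X: "X \<in> A i" using sigma_algebra.sets_measure_of_eq[OF Suc.prems(1)[of i]] i by auto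
      then have "X \<in> ?C" using i by (intro sigma_sets.Basic) auto
      moreover have "X \<subseteq> space M" using X Apow[of i] i by auto
      ultimately show "(\<lambda>\<omega>. \<omega>) -` X \<inter> space (sigma (space M) ?C) \<in> sets (sigma (space M) ?C)"
        using sigma_algebra.sets_measure_of_eq[OF sC] by (simp add: space_measure_of_conv Int_absorb2)
    qed (simp add: space_measure_of_conv)
    from measurable_Pair[OF measurable_fst measurable_compose[OF measurable_snd this]]
    have "(\<lambda>p. (\<lambda>(t, \<omega>). Y i t \<omega>) (fst p, snd p)) \<in> borel_measurable (borel \<Otimes>\<^sub>M sigma (space M) ?C)"
      by (rule measurable_compose) (use Suc.prems(3)[of i] i in auto)
    then show "(\<lambda>(t, \<omega>). Y i t \<omega>) \<in> borel_measurable (borel \<Otimes>\<^sub>M sigma (space M) ?C)" by (simp add: split_beta')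
  qed
  ultimately have "(LINT \<omega>|M. (\<lambda>x. exp (complex_of_real \<bar>x\<bar> * z)) (iterated Y k (Y (Suc k) t \<omega>) \<omega>))
      = (LINT \<omega>|M. LINT \<omega>'|M. (\<lambda>x. exp (complex_of_real \<bar>x\<bar> * z)) (iterated Y k (Y (Suc k) t \<omega>) \<omega>'))"
    by (intro indep_expectation_freeze[where A="A (Suc k)" and B="?C"])
       (use Suc.prems(1) z in \<open>auto simp: norm_exp_eq_Re mult_nonneg_nonpos\<close>)
  also have "\<dots> = (LINT \<omega>|M. iterated_exp k z \<bar>Y (Suc k) t \<omega>\<bar>)"
  proof -
    have "indep_sets A {1..k}" by (rule indep_sets_mono_index[OF _ Suc.prems(2)]) auto
    then have "(LINT \<omega>'|M. exp (complex_of_real \<bar>iterated Y k s \<omega>'\<bar> * z)) = iterated_exp k z \<bar>s\<bar>" for s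
      by (intro Suc.IH) (use Suc.prems in auto)
    then show ?thesis by (simp only:)
  qed
  also have "\<dots> = (LINT y|lborel. std_normal_density y *\<^sub>R iterated_exp k z (sqrt (2 * \<bar>t\<bar>) * \<bar>y\<bar>))"
    by (rule Suc.prems(4)) (use borel_measurable_half_line_abs[OF continuous_on_iterated_exp[OF z], of 1] in auto)
  finally show ?case by simp
qed

end

context prob_space
begin

lemma joint_measurable_sub_sigma_algebra:
  assumes F: "F \<in> borel_measurable (borel \<Otimes>\<^sub>M sigma (space M) A)" and A: "A \<subseteq> sets M"
  shows "F \<in> borel_measurable (borel \<Otimes>\<^sub>M M)"
proof -
  have s: "sigma_sets (space M) A \<subseteq> sets M" by (rule sets.sigma_sets_subset[OF A])
  have Apow: "A \<subseteq> Pow (space M)" using A sets.space_closed[of M] by blast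
  have "(\<lambda>\<omega>. \<omega>) \<in> measurable M (sigma (space M) A)"
    by (rule measurableI)
       (use s Apow in \<open>auto simp: space_measure_of_conv sets_measure_of_conv\<close>)
  from measurable_Pair[OF measurable_fst measurable_compose[OF measurable_snd this]]
  have "(\<lambda>p. F (fst p, snd p)) \<in> borel_measurable (borel \<Otimes>\<^sub>M M)"
    by (rule measurable_compose) (rule F)
  then show ?thesis by simp
qed

text \<open>Each sample contributes a translate of \<open>f\<close>, with the same L1 norm and with
  a transform multiplied by a phase; the mean of this phase is what \<open>law\<close>
  prescribes.\<close>

lemma expectation_translation_evolves:
  fixes R :: "real \<Rightarrow> 'a \<Rightarrow> 'b::euclidean_space"
  assumes R[measurable]: "(\<lambda>(t, \<omega>). R \<bar>t\<bar> \<omega>) \<in> borel_measurable (borel \<Otimes>\<^sub>M M)"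
    and law: "\<And>t \<xi>. t \<ge> 0 \<Longrightarrow> (LINT \<omega>|M. exp (\<i> * complex_of_real (\<xi> \<bullet> R t \<omega>))) = iterated_exp k (\<psi> \<xi>) t"
    and f: "integrable lborel f"
    and u: "\<And>t x. t \<ge> 0 \<Longrightarrow> u t x = (LINT \<omega>|M. f (x + R t \<omega>))"
  shows "evolves \<psi> k f u"
  unfolding evolves_def
proof (intro conjI allI impI)
  have f'[measurable]: "f \<in> borel_measurable borel" using borel_measurable_integrable[OF f] by simp
  have "(\<lambda>p. LINT \<omega>|M. f (snd p + (case (fst p, \<omega>) of (t, \<omega>) \<Rightarrow> R \<bar>t\<bar> \<omega>))) \<in> borel_measurable (borel \<Otimes>\<^sub>M borel)"
    by measurable
  then show "(\<lambda>(t, x). u \<bar>t\<bar> x) \<in> borel_measurable (borel \<Otimes>\<^sub>M borel)"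
    by (simp add: u split_beta')
  fix t :: real assume t: "t \<ge> 0"
  have Rt[measurable]: "R t \<in> borel_measurable M"
    using measurable_Pair2[OF R, of t] t by simp
  let ?F = "\<lambda>\<omega> x. f (x + R t \<omega>)"
  have i: "integrable (M \<Otimes>\<^sub>M lborel) (\<lambda>(\<omega>, x). ?F \<omega> x)"
  proof (rule integrable_pair_bound)
    show "integrable M (\<lambda>_. LINT x|lborel. norm (f x))" by simp
    show "(\<lambda>(\<omega>, x). ?F \<omega> x) \<in> borel_measurable (M \<Otimes>\<^sub>M lborel)" by measurable
    show "integrable lborel (\<lambda>x. case (\<omega>, x) of (\<omega>, x) \<Rightarrow> ?F \<omega> x)" for \<omega>
      using integrable_lborel_translation[OF f, of "R t \<omega>"] by simp
    show "(LINT x|lborel. norm (case (\<omega>, x) of (\<omega>, x) \<Rightarrow> ?F \<omega> x)) \<le> (LINT x|lborel. norm (f x))" for \<omega>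
      using lborel_integral_translation[of "\<lambda>x. norm (f x)" "R t \<omega>"] by simp
  qed (auto intro: lborel.sigma_finite_measure_axioms sigma_finite_measure_axioms)
  have ut: "u t = (\<lambda>x. LINT \<omega>|M. ?F \<omega> x)" using u[OF t] by auto
  show "integrable lborel (u t)"
    unfolding ut by (rule integrable_mixture[OF sigma_finite_measure_axioms i])
  have "(LINT x|lborel. norm (u t x)) \<le> (LINT \<omega>|M. LINT x|lborel. norm (?F \<omega> x))"
    unfolding ut by (rule norm_mixture_le[OF sigma_finite_measure_axioms i])
  also have "\<dots> = (LINT \<omega>|M. LINT x|lborel. norm (f x))"
    using lborel_integral_translation[of "\<lambda>x. norm (f x)"] by simp
  finally show "(LINT x|lborel. norm (u t x)) \<le> (LINT x|lborel. norm (f x))"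
    by (simp add: prob_space)
  fix \<xi>
  have "fourier (u t) \<xi> = (LINT \<omega>|M. fourier (?F \<omega>) \<xi>)"
    unfolding ut by (rule fourier_mixture[OF sigma_finite_measure_axioms i])
  also have "\<dots> = (LINT \<omega>|M. exp (\<i> * complex_of_real (\<xi> \<bullet> R t \<omega>)) * fourier f \<xi>)"
    by (simp only: fourier_translation[OF f'])
  also have "\<dots> = iterated_exp k (\<psi> \<xi>) t * fourier f \<xi>"
    by (simp only: integral_mult_left_zero law[OF t])
  finally show "fourier (u t) \<xi> = iterated_exp k (\<psi> \<xi>) t * fourier f \<xi>" .
qed

text \<open>The common form of both versions. \<open>A\<close> carries the independence of the
  layers, \<open>C\<close> and \<open>D\<close> that of the clock and the outer process. Freezing
  the clock leaves \<open>exp (\<bar>l\<bar> * \<psi> \<xi>)\<close> by \<open>V_law\<close>; the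
  sign of the clock disappears here.\<close>

lemma iterated_composition_evolves:
  fixes V :: "real \<Rightarrow> 'a \<Rightarrow> 'b::euclidean_space" and Y :: "nat \<Rightarrow> real \<Rightarrow> 'a \<Rightarrow> real"
  assumes A: "\<And>i. i \<in> {1..k} \<Longrightarrow> sigma_algebra (space M) (A i)"
    and indep: "indep_sets A {1..k}"
    and Y: "\<And>i. i \<in> {1..k} \<Longrightarrow> (\<lambda>(t, \<omega>). Y i t \<omega>) \<in> borel_measurable (borel \<Otimes>\<^sub>M sigma (space M) (A i))"
    and Y_law: "\<And>i t h. i \<in> {1..k} \<Longrightarrow> (\<lambda>r. h \<bar>r\<bar>) \<in> borel_measurable borel \<Longrightarrow>
        (LINT \<omega>|M. h \<bar>Y i t \<omega>\<bar>) = (LINT y|lborel. std_normal_density y *\<^sub>R (h (sqrt (2 * \<bar>t\<bar>) * \<bar>y\<bar>) :: complex))"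
    and CD: "indep_set C D" "sigma_algebra (space M) C" "sigma_algebra (space M) D"
    and S: "\<And>t. t \<ge> 0 \<Longrightarrow> iterated Y k t \<in> borel_measurable (sigma (space M) C)"
    and V: "(\<lambda>(l, \<omega>). V l \<omega>) \<in> borel_measurable (borel \<Otimes>\<^sub>M sigma (space M) D)"
    and V_law: "\<And>l \<xi>. (LINT \<omega>|M. exp (\<i> * complex_of_real (\<xi> \<bullet> V l \<omega>))) = exp (complex_of_real \<bar>l\<bar> * \<psi> \<xi>)"
    and Re: "\<And>\<xi>. Re (\<psi> \<xi>) \<le> 0"
    and f: "integrable lborel f"
    and u: "\<And>t x. t \<ge> 0 \<Longrightarrow> u t x = (LINT \<omega>|M. f (x + V (iterated Y k t \<omega>) \<omega>))"
  shows "evolves \<psi> k f u"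
proof (rule expectation_translation_evolves[OF _ _ f u])
  have [measurable]: "(\<lambda>(l, \<omega>). V l \<omega>) \<in> borel_measurable (borel \<Otimes>\<^sub>M M)"
    by (rule joint_measurable_sub_sigma_algebra[OF V]) (use CD(1) in \<open>auto simp: indep_sets2_eq\<close>)
  have [measurable]: "(\<lambda>(t, \<omega>). iterated Y k t \<omega>) \<in> borel_measurable (borel \<Otimes>\<^sub>M M)"
  proof (rule iterated_joint_measurable)
    fix i assume i: "i \<in> {1..k}"
    show "(\<lambda>(t, \<omega>). Y i t \<omega>) \<in> borel_measurable (borel \<Otimes>\<^sub>M M)"
      by (rule joint_measurable_sub_sigma_algebra[OF Y[OF i]]) (use indep i in \<open>auto simp: indep_sets_def\<close>)
  qed
  have "(\<lambda>p. (\<lambda>(l, \<omega>). V l \<omega>) ((\<lambda>(t, \<omega>). iterated Y k t \<omega>) (\<bar>fst p\<bar>, snd p), snd p)) \<in> borel_measurable (borel \<Otimes>\<^sub>M M)"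
    by measurable
  then show "(\<lambda>(t, \<omega>). V (iterated Y k \<bar>t\<bar> \<omega>) \<omega>) \<in> borel_measurable (borel \<Otimes>\<^sub>M M)"
    by (simp add: split_beta')
  fix t :: real and \<xi> :: 'b assume t: "t \<ge> 0"
  have "(LINT \<omega>|M. exp (\<i> * complex_of_real (\<xi> \<bullet> V (iterated Y k t \<omega>) \<omega>)))
      = (LINT \<omega>|M. LINT \<omega>'|M. exp (\<i> * complex_of_real (\<xi> \<bullet> V (iterated Y k t \<omega>) \<omega>')))"
    by (rule indep_expectation_freeze[OF CD S[OF t] V, where g="\<lambda>y. exp (\<i> * complex_of_real (\<xi> \<bullet> y))"]) auto
  also have "\<dots> = (LINT \<omega>|M. exp (complex_of_real \<bar>iterated Y k t \<omega>\<bar> * \<psi> \<xi>))"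
    by (simp only: V_law)
  also have "\<dots> = iterated_exp k (\<psi> \<xi>) \<bar>t\<bar>"
    by (rule expectation_iterated_exp[OF A indep Y Y_law Re])
  finally show "(LINT \<omega>|M. exp (\<i> * complex_of_real (\<xi> \<bullet> V (iterated Y k t \<omega>) \<omega>))) = iterated_exp k (\<psi> \<xi>) t"
    using t by simp
qed

end

section \<open>Levy processes and Brownian motions as input\<close>

text \<open>The semigroup is the mean of translates of \<open>f\<close> by \<open>X t\<close>, level
  0 of the general construction; right-continuous paths give its joint measurability.\<close>

lemma levy_symbol_evolution:
  assumes X: "levy_process M X" and \<psi>: "levy_symbol M X \<psi>"
  shows "evolution \<psi>"
proof -
  have mX: "\<And>t. t \<ge> 0 \<Longrightarrow> X t \<in> borel_measurable M" and ps: "prob_space M"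
    and rc: "\<And>\<omega> t. \<omega> \<in> space M \<Longrightarrow> t \<ge> 0 \<Longrightarrow> ((\<lambda>s. X s \<omega>) \<longlongrightarrow> X t \<omega>) (at_right t)"
    using X by (auto simp: levy_process_def)
  interpret symbol M X \<psi> by (rule symbol.intro[OF ps mX \<psi>])
  show ?thesis
  proof
    show "Re (\<psi> \<xi>) \<le> 0" for \<xi> by (rule Re_symbol_nonpos)
    obtain C where "C \<ge> 0" "\<And>\<xi>. norm (\<psi> \<xi>) \<le> C * (1 + norm \<xi>) ^ 2" using symbol_growth by blast
    then show "slowly_growing \<psi>" by (rule slowly_growingI[OF continuous_on_symbol])
    fix f :: "'b \<Rightarrow> complex" assume f: "integrable lborel f"
    have "evolves \<psi> 0 f (\<lambda>t x. LINT \<omega>|M. f (x + X t \<omega>))"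
      by (rule expectation_translation_evolves[OF right_continuous_joint_measurable[OF mX rc] _ f refl])
         (auto simp: char_eq)
    then show "\<exists>u. evolves \<psi> 0 f u" by blast
  qed
qed

lemma brownian_motion_right_continuous:
  assumes "brownian_motion M B" "\<omega> \<in> space M" "t \<ge> 0"
  shows "((\<lambda>s. B s \<omega>) \<longlongrightarrow> B t \<omega>) (at_right t)"
proof -
  have "continuous_on {0..} (\<lambda>t. B t \<omega>)" using assms by (auto simp: brownian_motion_def)
  then have "((\<lambda>s. B s \<omega>) \<longlongrightarrow> B t \<omega>) (at t within {0..})" using assms(3) by (auto simp: continuous_on_def)
  then show ?thesis by (rule tendsto_within_subset) (use assms(3) in auto)
qed

text \<open>For \<open>t > 0\<close> the density of the increment from 0 is rescaled. At
  \<open>t = 0\<close> the kernel degenerates, but the scaled form reduces to \<open>h 0\<close>, so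
  one formula covers all times.\<close>

lemma brownian_motion_abs_law:
  fixes h :: "real \<Rightarrow> complex"
  assumes B: "brownian_motion M B" and h: "(\<lambda>r. h \<bar>r\<bar>) \<in> borel_measurable borel" and t: "t \<ge> 0"
  shows "(LINT \<omega>|M. h \<bar>B t \<omega>\<bar>) = (LINT y|lborel. std_normal_density y *\<^sub>R h (sqrt (2 * t) * \<bar>y\<bar>))"
proof -
  interpret prob_space M using B by (simp add: brownian_motion_def)
  have B0: "\<And>\<omega>. \<omega> \<in> space M \<Longrightarrow> B 0 \<omega> = 0" using B by (simp add: brownian_motion_def)
  show ?thesis
  proof (cases "t = 0")
    case True
    have "(LINT \<omega>|M. h \<bar>B 0 \<omega>\<bar>) = (LINT \<omega>|M. h 0)"
      by (rule Bochner_Integration.integral_cong) (auto simp: B0)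
    then show ?thesis using True by (simp add: prob_space)
  next
    case False
    then have t0: "t > 0" using t by simp
    have "distributed M lborel (\<lambda>\<omega>. B t \<omega> - B 0 \<omega>) (\<lambda>x. ennreal (heat_kernel t x))"
    proof -
      have "distributed M lborel (\<lambda>\<omega>. B t \<omega> - B 0 \<omega>) (normal_density 0 (sqrt (2 * (t - 0))))"
        using B t0 unfolding brownian_motion_def by blast
      then show ?thesis by simp
    qed
    then have D: "distr M lborel (\<lambda>\<omega>. B t \<omega> - B 0 \<omega>) = density lborel (\<lambda>x. ennreal (heat_kernel t x))"
      and m: "(\<lambda>\<omega>. B t \<omega> - B 0 \<omega>) \<in> measurable M lborel"
      by (auto simp: distributed_def)
    have "(LINT \<omega>|M. h \<bar>B t \<omega>\<bar>) = (LINT \<omega>|M. h \<bar>B t \<omega> - B 0 \<omega>\<bar>)"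
      by (rule Bochner_Integration.integral_cong) (auto simp: B0)
    also have "\<dots> = (LINT r|distr M lborel (\<lambda>\<omega>. B t \<omega> - B 0 \<omega>). h \<bar>r\<bar>)"
      by (rule integral_distr[symmetric]) (use m h in auto)
    also have "\<dots> = (LINT r|lborel. heat_kernel t r *\<^sub>R h \<bar>r\<bar>)"
      unfolding D by (rule integral_density) (use h in \<open>auto simp: normal_density_nonneg\<close>)
    also have "\<dots> = (LINT y|lborel. std_normal_density y *\<^sub>R h \<bar>sqrt (2 * t) * y\<bar>)"
      by (rule heat_kernel_integral[OF t0 h])
    finally show ?thesis using t by (simp add: abs_mult)
  qed
qed

lemma path_law_eq_imp_distr_eq:
  fixes X Y :: "real \<Rightarrow> 'w \<Rightarrow> 'b::topological_space"
  assumes "path_law M X = path_law M Y"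
    and X: "\<And>t. t \<ge> 0 \<Longrightarrow> X t \<in> borel_measurable M" and Y: "\<And>t. t \<ge> 0 \<Longrightarrow> Y t \<in> borel_measurable M"
    and t: "t \<ge> 0"
  shows "distr M borel (X t) = distr M borel (Y t)"
proof -
  have "distr (path_law M Z) borel (\<lambda>p. p t) = distr M borel (Z t)" if Z: "\<And>t. t \<ge> 0 \<Longrightarrow> Z t \<in> borel_measurable M" for Z :: "real \<Rightarrow> 'w \<Rightarrow> 'b"
    unfolding path_law_def
    by (subst distr_distr) (use t Z in \<open>auto intro!: distr_cong measurable_component_singleton measurable_restrict simp: comp_def\<close>)
  from this[of X, OF X] this[of Y, OF Y] assms(1) show ?thesis by simp
qed

text \<open>Extending each layer evenly in time absorbs the absolute values, so the first version
  becomes a plain composition like the second.\<close>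

lemma iterated_abs_eq_iterated:
  "iterated_abs B (Suc k) \<bar>t\<bar> \<omega> = iterated (\<lambda>i s. B i \<bar>s\<bar>) (Suc k) t \<omega>"
proof (induction k arbitrary: t)
  case (Suc k)
  have "iterated_abs B (Suc (Suc k)) \<bar>t\<bar> \<omega> = iterated_abs B (Suc k) \<bar>B (Suc (Suc k)) \<bar>t\<bar> \<omega>\<bar> \<omega>" by simp
  also have "\<dots> = iterated (\<lambda>i s. B i \<bar>s\<bar>) (Suc k) (B (Suc (Suc k)) \<bar>t\<bar> \<omega>) \<omega>" by (rule Suc.IH)
  finally show ?case by simp
qed simp

theorem theorem1p1:
  fixes M :: "'w measure"
    and X0 Xp Xm :: "real \<Rightarrow> 'w \<Rightarrow> 'a::euclidean_space"
    and \<psi> f :: "'a \<Rightarrow> complex"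
    and B W :: "nat \<Rightarrow> real \<Rightarrow> 'w \<Rightarrow> real"
    and k m :: nat
  assumes "levy_process M X0"
    and "levy_symbol M X0 \<psi>"
    and "k \<ge> 1"
    and "m = 2 ^ k"
    and "f \<in> gen_dom \<psi> 1"
  shows "((\<forall>i\<in>{1..k}. brownian_motion M (B i)) \<and>
         prob_space.indep_sets M (\<lambda>i. process_sigma M {0..} (B i)) {1..k} \<and>
         prob_space.indep_set M (process_sigma M {0..} (iterated_abs B k)) (process_sigma M {0..} X0)
         \<longrightarrow> unique_solution_of_both \<psi> m f
               (\<lambda>t x. LINT \<omega>|M. f (x + X0 \<bar>iterated_abs B k t \<omega>\<bar> \<omega>))) \<and>
        (levy_process M Xp \<and> path_law M Xp = path_law M X0 \<and>
         levy_process M Xm \<and> path_law M Xm = path_law M X0 \<and>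
         prob_space.indep_set M (process_sigma M {0..} Xp) (process_sigma M {0..} Xm) \<and>
         (\<forall>i\<in>{1..k}. two_sided_brownian_motion M (W i)) \<and>
         prob_space.indep_sets M (\<lambda>i. process_sigma M UNIV (W i)) {1..k} \<and>
         prob_space.indep_set M (process_sigma M {0..} (iterated W k))
           (process_sigma M UNIV (two_sided Xp Xm))
         \<longrightarrow> unique_solution_of_both \<psi> m f
               (\<lambda>t x. LINT \<omega>|M. f (two_sided (\<lambda>s \<omega>. x + Xp s \<omega>) (\<lambda>s \<omega>. x + Xm s \<omega>)
                                     (iterated W k t \<omega>) \<omega>)))"
proof -
  interpret prob_space M using assms(1) by (simp add: levy_process_def)
  interpret evolution \<psi> by (rule levy_symbol_evolution[OF assms(1,2)])
  have f: "integrable lborel f" using assms(5) by (simp add: gen_dom_def)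
  \<comment> \<open>All that remains is to show \<open>evolves\<close> for the two
    expectations.\<close>
  note reduce = evolves_unique_solution_of_both[OF _ assms(4,3,5)]
  have mX0: "\<And>t. t \<ge> 0 \<Longrightarrow> X0 t \<in> borel_measurable M"
    and rcX0: "\<And>\<omega> t. \<omega> \<in> space M \<Longrightarrow> t \<ge> 0 \<Longrightarrow> ((\<lambda>s. X0 s \<omega>) \<longlongrightarrow> X0 t \<omega>) (at_right t)"
    using assms(1) by (auto simp: levy_process_def)
  have char0: "(LINT \<omega>|M. exp (\<i> * complex_of_real (\<xi> \<bullet> X0 t \<omega>))) = exp (complex_of_real t * \<psi> \<xi>)" if "t \<ge> 0" for t \<xi>
    using assms(2) that by (simp add: levy_symbol_def)
  show ?thesis
  proof (intro conjI impI)
    assume H: "(\<forall>i\<in>{1..k}. brownian_motion M (B i)) \<and>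
         indep_sets (\<lambda>i. process_sigma M {0..} (B i)) {1..k} \<and>
         indep_set (process_sigma M {0..} (iterated_abs B k)) (process_sigma M {0..} X0)"
    let ?Y = "\<lambda>i s. B i \<bar>s\<bar>"
    have S_eq: "iterated_abs B k t = iterated ?Y k t" if "t \<ge> 0" for t
      using iterated_abs_eq_iterated[of B "k - 1" t] that assms(3) by (auto simp: fun_eq_iff)
    have "evolves \<psi> k f (\<lambda>t x. LINT \<omega>|M. f (x + X0 \<bar>iterated_abs B k t \<omega>\<bar> \<omega>))"
    proof (rule iterated_composition_evolves[where Y="?Y" and V="\<lambda>l. X0 \<bar>l\<bar>"
          and A="\<lambda>i. process_sigma M {0..} (B i)" and C="process_sigma M {0..} (iterated_abs B k)" and D="process_sigma M {0..} X0"])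
      show "(\<lambda>(t, \<omega>). B i \<bar>t\<bar> \<omega>) \<in> borel_measurable (borel \<Otimes>\<^sub>M sigma (space M) (process_sigma M {0..} (B i)))"
        if "i \<in> {1..k}" for i
        using H that by (intro right_continuous_joint_measurable measurable_process_sigma)
          (auto simp: space_measure_of_conv intro: brownian_motion_right_continuous)
      show "(\<lambda>(l, \<omega>). X0 \<bar>l\<bar> \<omega>) \<in> borel_measurable (borel \<Otimes>\<^sub>M sigma (space M) (process_sigma M {0..} X0))"
        by (intro right_continuous_joint_measurable measurable_process_sigma)
           (auto simp: space_measure_of_conv intro: rcX0)
      show "(LINT \<omega>|M. h \<bar>B i \<bar>t\<bar> \<omega>\<bar>) = (LINT y|lborel. std_normal_density y *\<^sub>R h (sqrt (2 * \<bar>t\<bar>) * \<bar>y\<bar>))"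
        if "i \<in> {1..k}" "(\<lambda>r. h \<bar>r\<bar>) \<in> borel_measurable borel" for i t and h :: "real \<Rightarrow> complex"
        using H that by (intro brownian_motion_abs_law) auto
      show "iterated ?Y k t \<in> borel_measurable (sigma (space M) (process_sigma M {0..} (iterated_abs B k)))" if "t \<ge> 0" for t
        using measurable_process_sigma[of t "{0..}" "iterated_abs B k" M] that by (simp add: S_eq)
      show "(LINT \<omega>|M. exp (\<i> * complex_of_real (\<xi> \<bullet> X0 \<bar>l\<bar> \<omega>))) = exp (complex_of_real \<bar>l\<bar> * \<psi> \<xi>)" for l \<xi>
        by (rule char0) simp
    qed (use H f S_eq Re_nonpos sigma_algebra_process_sigma in auto)
    then show "unique_solution_of_both \<psi> m f (\<lambda>t x. LINT \<omega>|M. f (x + X0 \<bar>iterated_abs B k t \<omega>\<bar> \<omega>))"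
      by (rule reduce)
  next
    assume H: "levy_process M Xp \<and> path_law M Xp = path_law M X0 \<and>
         levy_process M Xm \<and> path_law M Xm = path_law M X0 \<and>
         indep_set (process_sigma M {0..} Xp) (process_sigma M {0..} Xm) \<and>
         (\<forall>i\<in>{1..k}. two_sided_brownian_motion M (W i)) \<and>
         indep_sets (\<lambda>i. process_sigma M UNIV (W i)) {1..k} \<and>
         indep_set (process_sigma M {0..} (iterated W k)) (process_sigma M UNIV (two_sided Xp Xm))"
    \<comment> \<open>\<open>Xp\<close> and \<open>Xm\<close> share the path law of
      \<open>X0\<close>, hence its marginals and its symbol.\<close>
    have char_eq: "(LINT \<omega>|M. exp (\<i> * complex_of_real (\<xi> \<bullet> X t \<omega>))) = exp (complex_of_real t * \<psi> \<xi>)"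
      if X: "levy_process M X" "path_law M X = path_law M X0" and t: "t \<ge> 0" for X t \<xi>
    proof -
      have mX: "\<And>t. t \<ge> 0 \<Longrightarrow> X t \<in> borel_measurable M" using X(1) by (auto simp: levy_process_def)
      have "(LINT \<omega>|M. exp (\<i> * complex_of_real (\<xi> \<bullet> X t \<omega>))) = (LINT y|distr M borel (X t). exp (\<i> * complex_of_real (\<xi> \<bullet> y)))"
        by (rule integral_distr[symmetric]) (use mX[OF t] in auto)
      also have "\<dots> = (LINT y|distr M borel (X0 t). exp (\<i> * complex_of_real (\<xi> \<bullet> y)))"
        by (simp only: path_law_eq_imp_distr_eq[OF X(2) mX mX0 t])
      also have "\<dots> = (LINT \<omega>|M. exp (\<i> * complex_of_real (\<xi> \<bullet> X0 t \<omega>)))"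
        by (rule integral_distr) (use mX0[OF t] in auto)
      finally show ?thesis using char0[OF t] by simp
    qed
    have rc: "\<And>\<omega> t. \<omega> \<in> space M \<Longrightarrow> t \<ge> 0 \<Longrightarrow> ((\<lambda>s. Xp s \<omega>) \<longlongrightarrow> Xp t \<omega>) (at_right t)"
      "\<And>\<omega> t. \<omega> \<in> space M \<Longrightarrow> t \<ge> 0 \<Longrightarrow> ((\<lambda>s. Xm s \<omega>) \<longlongrightarrow> Xm t \<omega>) (at_right t)"
      "\<And>\<omega>. \<omega> \<in> space M \<Longrightarrow> Xm 0 \<omega> = 0"
      using H by (auto simp: levy_process_def)
    have "evolves \<psi> k f (\<lambda>t x. LINT \<omega>|M. f (two_sided (\<lambda>s \<omega>. x + Xp s \<omega>) (\<lambda>s \<omega>. x + Xm s \<omega>) (iterated W k t \<omega>) \<omega>))"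
    proof (rule iterated_composition_evolves[where Y=W and V="two_sided Xp Xm"
          and A="\<lambda>i. process_sigma M UNIV (W i)" and C="process_sigma M {0..} (iterated W k)" and D="process_sigma M UNIV (two_sided Xp Xm)"])
      fix i t and h :: "real \<Rightarrow> complex" assume i: "i \<in> {1..k}"
      obtain P Q where W: "brownian_motion M P" "brownian_motion M Q" "W i = two_sided P Q"
        using H i unfolding two_sided_brownian_motion_def by blast
      show "(\<lambda>(t, \<omega>). W i t \<omega>) \<in> borel_measurable (borel \<Otimes>\<^sub>M sigma (space M) (process_sigma M UNIV (W i)))"
        unfolding W(3)
        by (rule two_sided_joint_measurable[OF brownian_motion_right_continuous[OF W(1)] brownian_motion_right_continuous[OF W(2)], where c=0])
           (use W(2) in \<open>simp_all add: brownian_motion_def\<close>)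
      assume h: "(\<lambda>r. h \<bar>r\<bar>) \<in> borel_measurable borel"
      show "(LINT \<omega>|M. h \<bar>W i t \<omega>\<bar>) = (LINT y|lborel. std_normal_density y *\<^sub>R h (sqrt (2 * \<bar>t\<bar>) * \<bar>y\<bar>))"
        using brownian_motion_abs_law[OF W(1) h, of t] brownian_motion_abs_law[OF W(2) h, of "- t"]
        by (cases "t \<ge> 0") (auto simp: W(3) two_sided_def)
    next
      show "(\<lambda>(l, \<omega>). two_sided Xp Xm l \<omega>) \<in> borel_measurable (borel \<Otimes>\<^sub>M sigma (space M) (process_sigma M UNIV (two_sided Xp Xm)))"
        by (rule two_sided_joint_measurable[OF rc])
      show "iterated W k t \<in> borel_measurable (sigma (space M) (process_sigma M {0..} (iterated W k)))" if "t \<ge> 0" for t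
        using that by (intro measurable_process_sigma) simp
      show "(LINT \<omega>|M. exp (\<i> * complex_of_real (\<xi> \<bullet> two_sided Xp Xm l \<omega>))) = exp (complex_of_real \<bar>l\<bar> * \<psi> \<xi>)" for l \<xi>
        using char_eq[of Xp l] char_eq[of Xm "- l"] H by (cases "l \<ge> 0") (auto simp: two_sided_def)
      \<comment> \<open>The starting point x is the same on both branches and comes out as a
        translation.\<close>
      show "(LINT \<omega>|M. f (two_sided (\<lambda>s \<omega>. x + Xp s \<omega>) (\<lambda>s \<omega>. x + Xm s \<omega>) (iterated W k t \<omega>) \<omega>))
          = (LINT \<omega>|M. f (x + two_sided Xp Xm (iterated W k t \<omega>) \<omega>))" for t x
        by (rule Bochner_Integration.integral_cong) (auto simp: two_sided_def)
    qed (use H f Re_nonpos sigma_algebra_process_sigma in auto)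
    then show "unique_solution_of_both \<psi> m f (\<lambda>t x. LINT \<omega>|M. f (two_sided (\<lambda>s \<omega>. x + Xp s \<omega>) (\<lambda>s \<omega>. x + Xm s \<omega>)
        (iterated W k t \<omega>) \<omega>))"
      by (rule reduce)
  qed
qed

end
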